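(* Let $m\in\mathbb{Z}$, let $f$ be a density function and $P$ a payoff function satisfying the standing assumptions (S) of the context, and let $\alpha\in\delta_V$ be such that $P_\alpha$ and $f_\alpha$ satisfy assumptions (A) and (B) of the context. For $f_\alpha$, write the constants in (A)(iii) as $a+\alpha$ (lower half-plane) and $b-\alpha$ (upper half-plane), with orders $\gamma^-$ and $\gamma^+$; that is, $-a$ and $b$ are the imaginary parts of the nearest singularities of $\hat f$. Let $\varepsilon_D=\frac1\pi|\operatorname{Im}[\hat f(2^m\pi+\mathrm{i}\alpha)]|$, $\varepsilon_V=\frac1\pi|\operatorname{Im}[\hat P(2^m\pi-\mathrm{i}\alpha)]|$, $\mu\in\mathbb{R}$, and let $C_+,C_->0$ be the constants of the density-coefficient bound recalled in the context. Let $y_N^*$ be the largest of the local maxima $y_1^*,\dots,y_N^*$ in $(0,\infty)\cap(1+\mu,\infty)$ of $$G_+(y)=\left(C_+e^{\alpha\mu}(y-\mu)^{\gamma^+-1}e^{-(b-\alpha)(y-\mu)}+\varepsilon_D(y-\mu)^{-1}\right)\left(|P_\alpha(y)|+\varepsilon_V|y|^{-1}\right).$$ If $U=u/2^m>\max\left(0,\mu+1,\mu+\frac{\gamma^+-1}{b-\alpha},y_N^*\right)$ then, up to $O(U^{-2})$, $$\bar T^+(u)\le C_+e^{\alpha\mu}\left(\|P_\alpha\|_{L^\infty([U,\infty))}+\varepsilon_VU^{-1}\right)\frac{(U-\mu)^{\gamma^+-1}e^{-(b-\alpha)(U-\mu)}}{(b-\alpha)-\frac{\gamma^+-1}{U-\mu}}+\varepsilon_D\left(\|P_\alpha\|_{L^1([U,\infty))}+\varepsilon_V\right)\max\left\{U^{-1},(U-\mu)^{-1}\right\}.$$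 An analogous bound holds for the left tail: let $y_1^*$ be the smallest of the local maxima in $(-\infty,0)\cap(-\infty,\mu-1)$ of $$G_-(y)=\left(C_-e^{\alpha\mu}|y-\mu|^{\gamma^--1}e^{-(a+\alpha)|y-\mu|}+\varepsilon_D|y-\mu|^{-1}\right)\left(|P_\alpha(y)|+\varepsilon_V|y|^{-1}\right).$$ If $L=l/2^m<\min\left(0,\mu-1,\mu-\frac{\gamma^--1}{a+\alpha},y_1^*\right)$ then, up to $O(L^{-2})$, $$\bar T^-(l)\le C_-e^{\alpha\mu}\left(\|P_\alpha\|_{L^\infty((-\infty,L])}+\varepsilon_V|L|^{-1}\right)\frac{|L-\mu|^{\gamma^--1}e^{-(a+\alpha)|L-\mu|}}{(a+\alpha)-\frac{\gamma^--1}{|L-\mu|}}+\varepsilon_D\left(\|P_\alpha\|_{L^1((-\infty,L])}+\varepsilon_V\right)\max\left\{|L|^{-1},|L-\mu|^{-1}\right\}.$$ In particular, the truncation error of the damped SWIFT method exhibits two different decay regimes: under the first one, the bound is $\lesssim U^{\gamma^+-1}e^{-(b-\alpha)U}$ (respectively $|L|^{\gamma^--1}e^{-(a+\alpha)|L|}$ for the left tail), whose decay is exponential, while under the second regime it is $\lesssim U^{-1}$ (respectively $|L|^{-1}$).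
   Context: Fourier transform: $\hat h(z)=\int_{\mathbb{R}}h(y)e^{-\mathrm{i}zy}\,dy$. Damped functions: $P_\alpha(y)=e^{-\alpha y}P(y)$, $f_\alpha(y)=e^{\alpha y}f(y)$; $\delta_P=\{\alpha\in\mathbb{R}:P_\alpha\in L^1(\mathbb{R})\}$, $\delta_f=\{\alpha\in\mathbb{R}:f_\alpha\in L^1(\mathbb{R})\}$, $\delta_V=\delta_P\cap\delta_f$. With $\phi_{m,k}(y)=2^{m/2}\operatorname{sinc}(2^my-k)$, $\operatorname{sinc}(x)=\frac{\sin\pi x}{\pi x}$, put $D^\alpha_{m,k}=\int f_\alpha\phi_{m,k}\,dy$, $V^\alpha_{m,k}=\int P_\alpha\phi_{m,k}\,dy$, and for integers $u,l$ $$\bar T^+(u)=\sum_{k>u}|D^\alpha_{m,k}V^\alpha_{m,k}|,\qquad \bar T^-(l)=\sum_{k<l}|D^\alpha_{m,k}V^\alpha_{m,k}|.$$ The damped SWIFT method approximates the (undiscounted) option value by $\sum_{k=l}^{u}D^\alpha_{m,k}V^\alpha_{m,k}$ in place of the sum over all $k\in\mathbb{Z}$; its truncation error is the modulus of the difference of these two sums, which is at most $\bar T^-(l)+\bar T^+(u)$. Density-coefficient bound: the number $\mu$ plays the role of a centering parameter for $f$ (that is, $f(y)=f_0(y-\mu)$), and $C_\pm>0$ are constants such that, with $y_{k,\mu}=k/2^m-\mu$ and up to $O(y_{k,\mu}^{-2})$, $|D^\alpha_{m,k}|\le2^{-m/2}\big(C_+e^{\alpha\mu}y_{k,\mu}^{\gamma^+-1}e^{-(b-\alpha)y_{k,\mu}}+\varepsilon_Dy_{k,\mu}^{-1}\big)$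 for $y_{k,\mu}>1$ and $|D^\alpha_{m,k}|\le2^{-m/2}\big(C_-e^{\alpha\mu}|y_{k,\mu}|^{\gamma^--1}e^{-(a+\alpha)|y_{k,\mu}|}+\varepsilon_D|y_{k,\mu}|^{-1}\big)$ for $y_{k,\mu}<-1$. If a grid point $k/2^m$ is a jump point of $P$, the larger of the two one-sided limits of the payoff is used there. (S) Standing assumptions: $f$ and $P$ are piecewise $C^1$ (finite partition of $\mathbb{R}$ into intervals) with finitely many critical points; $P$ is defined on all of $\mathbb{R}$ and may jump, with uniformly bounded jump sizes; $\delta_V\ne\varnothing$, $\alpha\in\delta_V$, and $f_\alpha,P_\alpha\in L^2(\mathbb{R})$. (B) for $h$: with $r=2^m\pi$ and some integer $M\ge0$, $\hat h\in C^{M+1}(\{|u|>r\})$, $\hat h^{(j)}(u)\to0$ as $|u|\to\infty$ for $0\le j\le M$, and $\hat h^{(M+1)}\in L^1(\{|u|>r\})$. (A) for $h$: $h\in L^1(\mathbb{R})$ is real-valued and piecewise $C^1$, and $\hat h$ can be extended to $\mathbb{C}\setminus(\gamma_{u_1}\cup\dots\cup\gamma_{u_{N'}})$ as $\hat h=Z+H$ with $H$ entire and $Z$ having algebraic or logarithmic branch points $u_1,\dots,u_{N'}\in\mathbb{C}\setminus\mathbb{R}$ of orders $\rho_n\in\mathbb{C}\setminus\{0\}$, and: (i) $|\hat h(u)|\le C(1+|u|^q)$ for some $C,q>0$; (ii) for some $\theta\in(0,\frac\pi2)$, $\sup_{u\in\gamma(R,\theta)}(|\hat h(u)|+|\hat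 h(-u)|)$ and $\sup_{u\in\gamma(-R,\pi-\theta)}(|\hat h(u)|+|\hat h(-u)|)$ tend to $0$ as $R\to+\infty$; (iii) there are $a_h,b_h,\gamma^+,\gamma^->0$ such that $\operatorname{Im}u_n>0$ implies $\operatorname{Im}u_n\ge b_h$, with $\operatorname{Re}\rho_n\le\gamma^+$ if $\operatorname{Im}u_n=b_h$; and $\operatorname{Im}u_n<0$ implies $\operatorname{Im}u_n\le-a_h$, with $\operatorname{Re}\rho_n\le\gamma^-$ if $\operatorname{Im}u_n=-a_h$. Here $\operatorname{sgn}(t)=1$ for $t\ge0$ and $-1$ for $t<0$; $\gamma(u_0,\theta)=\{u_0+\operatorname{sgn}(\operatorname{Im}u_0)e^{\mathrm{i}\theta}t:t>0\}$ and $\gamma_{u_0}=\gamma(u_0,\frac\pi2)$ (branch cut). On the plane slit along the cut a branch of $\log(u-u_0)$ is fixed, so that $(u-u_0)^{-\rho}$ is well defined. $Z$ has algebraic branch points $u_n$ of orders $\rho_n$ if $Z(u)=g(u)\prod_n(u-u_n)^{-\rho_n}$ with $g$ entire. If close to some $u_n$ one has instead $Z(u)=(u-u_n)^{-\rho}\log(u-u_n)g(u)$ with $-\rho\in\mathbb{N}$ and $g$ analytic there, then $u_n$ is a logarithmic branch point of order $\rho$. *)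

theory Defs
  imports "HOL-Complex_Analysis.Complex_Analysis" "HOL-Probability.Probability"
begin

section \<open>Fourier transform, damping and SWIFT coefficients\<close>

definition fourier :: "(real \<Rightarrow> real) \<Rightarrow> complex \<Rightarrow> complex" where
  "fourier h z = (LINT y|lborel. complex_of_real (h y) * exp (- \<i> * z * complex_of_real y))"

definition damp_payoff :: "real \<Rightarrow> (real \<Rightarrow> real) \<Rightarrow> real \<Rightarrow> real" where
  "damp_payoff \<alpha> P = (\<lambda>y. exp (- \<alpha> * y) * P y)"

definition damp_density :: "real \<Rightarrow> (real \<Rightarrow> real) \<Rightarrow> real \<Rightarrow> real" where
  "damp_density \<alpha> f = (\<lambda>y. exp (\<alpha> * y) * f y)"

definition delta_P :: "(real \<Rightarrow> real) \<Rightarrow> real set" where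
  "delta_P P = {\<alpha>. integrable lborel (damp_payoff \<alpha> P)}"

definition delta_f :: "(real \<Rightarrow> real) \<Rightarrow> real set" where
  "delta_f f = {\<alpha>. integrable lborel (damp_density \<alpha> f)}"

definition delta_V :: "(real \<Rightarrow> real) \<Rightarrow> (real \<Rightarrow> real) \<Rightarrow> real set" where
  "delta_V f P = delta_P P \<inter> delta_f f"

text \<open>The normalised sinc function; the \<open>sinc\<close> of HOL-Probability is \<open>sin x / x\<close>.\<close>

definition nsinc :: "real \<Rightarrow> real" where
  "nsinc x = (if x = 0 then 1 else sin (pi * x) / (pi * x))"

definition shannon :: "int \<Rightarrow> int \<Rightarrow> real \<Rightarrow> real" where
  "shannon m k y = 2 powr (real_of_int m / 2) * nsinc (2 powi m * y - real_of_int k)"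

definition coeff_D :: "int \<Rightarrow> real \<Rightarrow> (real \<Rightarrow> real) \<Rightarrow> int \<Rightarrow> real" where
  "coeff_D m \<alpha> f k = (LINT y|lborel. damp_density \<alpha> f y * shannon m k y)"

definition coeff_V :: "int \<Rightarrow> real \<Rightarrow> (real \<Rightarrow> real) \<Rightarrow> int \<Rightarrow> real" where
  "coeff_V m \<alpha> P k = (LINT y|lborel. damp_payoff \<alpha> P y * shannon m k y)"

definition grid :: "int \<Rightarrow> int \<Rightarrow> real" where
  "grid m k = real_of_int k / 2 powi m"

text \<open>The tail sums take values in \<^typ>\<open>ennreal\<close>, so that a finite upper bound on them
  includes the convergence of the series.\<close>

definition tail_plus :: "int \<Rightarrow> real \<Rightarrow> (real \<Rightarrow> real) \<Rightarrow> (real \<Rightarrow> real) \<Rightarrow> int \<Rightarrow> ennreal" where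
  "tail_plus m \<alpha> f P u = (\<Sum>\<^sub>\<infinity>k\<in>{u<..}. ennreal \<bar>coeff_D m \<alpha> f k * coeff_V m \<alpha> P k\<bar>)"

definition tail_minus :: "int \<Rightarrow> real \<Rightarrow> (real \<Rightarrow> real) \<Rightarrow> (real \<Rightarrow> real) \<Rightarrow> int \<Rightarrow> ennreal" where
  "tail_minus m \<alpha> f P l = (\<Sum>\<^sub>\<infinity>k\<in>{..<l}. ennreal \<bar>coeff_D m \<alpha> f k * coeff_V m \<alpha> P k\<bar>)"

definition truncation_error ::
    "int \<Rightarrow> real \<Rightarrow> (real \<Rightarrow> real) \<Rightarrow> (real \<Rightarrow> real) \<Rightarrow> int \<Rightarrow> int \<Rightarrow> real" where
  "truncation_error m \<alpha> f P l u =
     \<bar>(\<Sum>\<^sub>\<infinity>k\<in>UNIV. coeff_D m \<alpha> f k * coeff_V m \<alpha> P k)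
      - (\<Sum>k=l..u. coeff_D m \<alpha> f k * coeff_V m \<alpha> P k)\<bar>"

section \<open>Standing assumptions\<close>

definition prob_density :: "(real \<Rightarrow> real) \<Rightarrow> bool" where
  "prob_density f \<longleftrightarrow> (\<forall>y. 0 \<le> f y) \<and> has_bochner_integral lborel f 1"

text \<open>Jumps are allowed at the finitely many breakpoints; the library's
  \<open>piecewise_C1_differentiable_on\<close> would require continuity.\<close>

definition piecewise_C1 :: "(real \<Rightarrow> real) \<Rightarrow> bool" where
  "piecewise_C1 g \<longleftrightarrow> (\<exists>X. finite X \<and> g C1_differentiable_on (UNIV - X))"

definition flat_at :: "(real \<Rightarrow> real) \<Rightarrow> real \<Rightarrow> bool" where
  "flat_at g y \<longleftrightarrow> (\<forall>\<^sub>F z in nhds y. g z = g y)"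

text \<open>Points inside an interval of constancy are not counted as critical points: call and put
  payoffs vanish on a half-line.\<close>

definition critical_points :: "(real \<Rightarrow> real) \<Rightarrow> real set" where
  "critical_points g = {y. (g has_real_derivative 0) (at y) \<and> \<not> flat_at g y}"

definition bounded_jumps :: "(real \<Rightarrow> real) \<Rightarrow> bool" where
  "bounded_jumps g \<longleftrightarrow> (\<exists>J. \<forall>y. \<exists>gl gr.
     (g \<longlongrightarrow> gl) (at_left y) \<and> (g \<longlongrightarrow> gr) (at_right y) \<and> \<bar>gr - gl\<bar> \<le> J)"

definition square_integrable :: "(real \<Rightarrow> real) \<Rightarrow> bool" where
  "square_integrable g \<longleftrightarrow> g \<in> borel_measurable lborel \<and> integrable lborel (\<lambda>y. (g y)\<^sup>2)"

definition standing_assumptions :: "(real \<Rightarrow> real) \<Rightarrow> (real \<Rightarrow> real) \<Rightarrow> real \<Rightarrow> bool" where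
  "standing_assumptions f P \<alpha> \<longleftrightarrow>
     piecewise_C1 f \<and> finite (critical_points f) \<and>
     piecewise_C1 P \<and> finite (critical_points P) \<and> bounded_jumps P \<and>
     \<alpha> \<in> delta_V f P \<and>
     square_integrable (damp_density \<alpha> f) \<and> square_integrable (damp_payoff \<alpha> P)"

section \<open>Smoothness of the transform off the band\<close>

text \<open>\<open>d j\<close> is the \<open>j\<close>-th derivative of the transform, a function of a real variable on
  \<open>\<bar>u\<bar> > r\<close>.\<close>

definition assumption_B :: "int \<Rightarrow> (real \<Rightarrow> real) \<Rightarrow> bool" where
  "assumption_B m h \<longleftrightarrow> (\<exists>(M::nat) (d :: nat \<Rightarrow> real \<Rightarrow> complex).
     let S = {u. 2 powi m * pi < \<bar>u\<bar>} in
       (\<forall>u\<in>S. d 0 u = fourier h (complex_of_real u)) \<and>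
       (\<forall>j\<le>M. \<forall>u\<in>S. (d j has_vector_derivative d (Suc j) u) (at u)) \<and>
       continuous_on S (d (Suc M)) \<and>
       (\<forall>j\<le>M. (d j \<longlongrightarrow> 0) at_infinity) \<and>
       set_integrable lborel S (d (Suc M)))"

section \<open>Analytic continuation with branch points\<close>

text \<open>In contrast to the library's \<open>sgn\<close>, the sign of 0 is 1 here.\<close>

definition sgn1 :: "real \<Rightarrow> real" where
  "sgn1 t = (if 0 \<le> t then 1 else - 1)"

definition ray :: "complex \<Rightarrow> real \<Rightarrow> complex set" where
  "ray u0 \<theta> = {u0 + complex_of_real (sgn1 (Im u0)) * cis \<theta> * complex_of_real t | t. 0 < t}"

definition branch_cut :: "complex \<Rightarrow> complex set" where
  "branch_cut u0 = ray u0 (pi / 2)"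

text \<open>The cuts do not contain their branch points, which therefore have to be removed as well.\<close>

definition slit_plane :: "complex set \<Rightarrow> complex set" where
  "slit_plane W = UNIV - (\<Union>u0\<in>W. insert u0 (branch_cut u0))"

definition log_branch :: "complex \<Rightarrow> (complex \<Rightarrow> complex) \<Rightarrow> bool" where
  "log_branch u0 lg \<longleftrightarrow>
     lg holomorphic_on slit_plane {u0} \<and> (\<forall>u\<in>slit_plane {u0}. exp (lg u) = u - u0)"

text \<open>The indices in \<open>A\<close> belong to algebraic branch points, the other ones to logarithmic
  branch points. The term \<open>exp (- \<rho> n * lg n u)\<close> is the power of \<open>u - w n\<close> with exponent
  \<open>- \<rho> n\<close>. If all branch points are algebraic, then \<open>G\<close> is entire, as
  \<open>slit_plane {} = UNIV\<close>.\<close>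

definition has_branch_points ::
    "(complex \<Rightarrow> complex) \<Rightarrow> nat \<Rightarrow> (nat \<Rightarrow> complex) \<Rightarrow> (nat \<Rightarrow> complex) \<Rightarrow> bool" where
  "has_branch_points Z N w \<rho> \<longleftrightarrow>
     (\<exists>lg A G.
        (\<forall>n<N. log_branch (w n) (lg n)) \<and>
        A \<subseteq> {..<N} \<and>
        G holomorphic_on slit_plane (w ` ({..<N} - A)) \<and>
        (\<forall>u\<in>slit_plane (w ` {..<N}). Z u = G u * (\<Prod>n\<in>A. exp (- \<rho> n * lg n u))) \<and>
        (\<forall>n\<in>{..<N} - A.
           (\<exists>p::nat. - \<rho> n = of_nat p) \<and>
           (\<exists>g. g analytic_on {w n} \<and>
              (\<forall>\<^sub>F u in at (w n). u \<in> slit_plane (w ` {..<N}) \<longrightarrow>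
                 Z u = exp (- \<rho> n * lg n u) * lg n u * g u))))"

text \<open>The growth bound is a condition at infinity: an extension with a branch point of order
  \<open>\<rho>\<close>, \<open>Re \<rho> > 0\<close>, is unbounded near that branch point. The suprema are taken in
  \<^typ>\<open>ereal\<close>, where they always exist.\<close>

definition assumption_A ::
    "(real \<Rightarrow> real) \<Rightarrow> real \<Rightarrow> real \<Rightarrow> real \<Rightarrow> real \<Rightarrow> bool" where
  "assumption_A h a\<^sub>h b\<^sub>h \<gamma>\<^sub>m \<gamma>\<^sub>p \<longleftrightarrow>
     integrable lborel h \<and> piecewise_C1 h \<and>
     0 < a\<^sub>h \<and> 0 < b\<^sub>h \<and> 0 < \<gamma>\<^sub>m \<and> 0 < \<gamma>\<^sub>p \<and>
     (\<exists>N w \<rho> Z H E.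
        inj_on w {..<N} \<and> (\<forall>n<N. Im (w n) \<noteq> 0 \<and> \<rho> n \<noteq> 0) \<and>
        has_branch_points Z N w \<rho> \<and> H holomorphic_on UNIV \<and>
        (\<forall>u\<in>slit_plane (w ` {..<N}). E u = Z u + H u) \<and>
        (\<forall>x::real. E (complex_of_real x) = fourier h (complex_of_real x)) \<and>
        (\<exists>C>0. \<exists>q>0. \<exists>R\<^sub>0. \<forall>u\<in>slit_plane (w ` {..<N}).
           R\<^sub>0 \<le> norm u \<longrightarrow> norm (E u) \<le> C * (1 + norm u powr q)) \<and>
        (\<exists>\<theta>. 0 < \<theta> \<and> \<theta> < pi / 2 \<and>
           ((\<lambda>R. SUP u\<in>ray (complex_of_real R) \<theta>. ereal (norm (E u) + norm (E (- u))))
              \<longlongrightarrow> 0) at_top \<and>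
           ((\<lambda>R. SUP u\<in>ray (complex_of_real (- R)) (pi - \<theta>). ereal (norm (E u) + norm (E (- u))))
              \<longlongrightarrow> 0) at_top) \<and>
        (\<forall>n<N. (0 < Im (w n) \<longrightarrow> b\<^sub>h \<le> Im (w n) \<and> (Im (w n) = b\<^sub>h \<longrightarrow> Re (\<rho> n) \<le> \<gamma>\<^sub>p)) \<and>
                (Im (w n) < 0 \<longrightarrow> Im (w n) \<le> - a\<^sub>h \<and> (Im (w n) = - a\<^sub>h \<longrightarrow> Re (\<rho> n) \<le> \<gamma>\<^sub>m))))"

section \<open>The quantities in the bounds\<close>

definition jump_adjusted :: "int \<Rightarrow> (real \<Rightarrow> real) \<Rightarrow> real \<Rightarrow> real" where
  "jump_adjusted m P y =
     (if y \<in> range (grid m) \<and> \<not> isCont P y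
      then max (Lim (at_left y) P) (Lim (at_right y) P) else P y)"

text \<open>Bound on the density coefficients at the distance \<open>t = \<bar>y - \<mu>\<bar>\<close> from \<open>\<mu>\<close>, without the
  factor \<open>2 powr (- m / 2)\<close>; \<open>\<kappa>\<close> is \<open>b - \<alpha>\<close> for the right and \<open>a + \<alpha>\<close> for the left tail.\<close>

definition density_bound ::
    "real \<Rightarrow> real \<Rightarrow> real \<Rightarrow> real \<Rightarrow> real \<Rightarrow> real \<Rightarrow> real \<Rightarrow> real" where
  "density_bound C \<alpha> \<mu> \<kappa> \<gamma> \<epsilon>D t =
     C * exp (\<alpha> * \<mu>) * t powr (\<gamma> - 1) * exp (- \<kappa> * t) + \<epsilon>D / t"

definition G_fun ::
    "int \<Rightarrow> (real \<Rightarrow> real) \<Rightarrow> real \<Rightarrow> real \<Rightarrow> real \<Rightarrow> real \<Rightarrow> real \<Rightarrow> real \<Rightarrow> real \<Rightarrow> real \<Rightarrow> real" where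
  "G_fun m P C \<alpha> \<mu> \<kappa> \<gamma> \<epsilon>D \<epsilon>V y =
     density_bound C \<alpha> \<mu> \<kappa> \<gamma> \<epsilon>D \<bar>y - \<mu>\<bar>
       * (\<bar>damp_payoff \<alpha> (jump_adjusted m P) y\<bar> + \<epsilon>V / \<bar>y\<bar>)"

text \<open>As with the critical points, the interior of an interval of constancy is disregarded.\<close>

definition local_maxima :: "(real \<Rightarrow> real) \<Rightarrow> real set \<Rightarrow> real set" where
  "local_maxima g S = {y\<in>S. (\<forall>\<^sub>F z in nhds y. g z \<le> g y) \<and> \<not> flat_at g y}"

definition L1_norm_on :: "real set \<Rightarrow> (real \<Rightarrow> real) \<Rightarrow> real" where
  "L1_norm_on S g = (LINT y:S|lborel. \<bar>g y\<bar>)"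

definition Linf_norm_on :: "real set \<Rightarrow> (real \<Rightarrow> real) \<Rightarrow> real" where
  "Linf_norm_on S g = real_of_ereal (esssup (restrict_space lborel S) (\<lambda>y. ereal \<bar>g y\<bar>))"

text \<open>The two summands of the bound on a tail, at the truncation point \<open>x\<close>, for the tail
  interval \<open>S\<close>: \<open>x = U\<close>, \<open>S = {U..}\<close> on the right and \<open>x = L\<close>, \<open>S = {..L}\<close> on the left.\<close>

definition exp_term ::
    "(real \<Rightarrow> real) \<Rightarrow> real \<Rightarrow> real \<Rightarrow> real \<Rightarrow> real \<Rightarrow> real \<Rightarrow> real \<Rightarrow> real set \<Rightarrow> real \<Rightarrow> real" where
  "exp_term P C \<alpha> \<mu> \<kappa> \<gamma> \<epsilon>V S x =
     C * exp (\<alpha> * \<mu>) * (Linf_norm_on S (damp_payoff \<alpha> P) + \<epsilon>V / \<bar>x\<bar>)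
       * (\<bar>x - \<mu>\<bar> powr (\<gamma> - 1) * exp (- \<kappa> * \<bar>x - \<mu>\<bar>) / (\<kappa> - (\<gamma> - 1) / \<bar>x - \<mu>\<bar>))"

definition alg_term ::
    "(real \<Rightarrow> real) \<Rightarrow> real \<Rightarrow> real \<Rightarrow> real \<Rightarrow> real \<Rightarrow> real set \<Rightarrow> real \<Rightarrow> real" where
  "alg_term P \<alpha> \<mu> \<epsilon>D \<epsilon>V S x =
     \<epsilon>D * (L1_norm_on S (damp_payoff \<alpha> P) + \<epsilon>V) * max (1 / \<bar>x\<bar>) (1 / \<bar>x - \<mu>\<bar>)"

end

theory Submission
  imports Defs "HOL-Real_Asymp.Real_Asymp"
begin

text \<open>
  Since the constants in the error terms may depend on all data, finitely many truncation points
  can be absorbed into them, and only the limit of a far truncation point matters; there the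
  exponential part of the density bound is itself of order \<open>1 / U\<^sup>2\<close>.
  The payoff coefficient is the band-limited part of the Fourier inversion integral of the damped
  payoff, so its distance to the payoff is a one-sided Fourier integral starting at the band edge.
  Rotating the contour of the latter onto vertical half-lines, where the growth condition on the
  analytic extension suffices, and expanding at the band edge gives the term with \<open>\<epsilon>V\<close> up to
  a quadratically decaying error; Abel summation justifies the inversion.
  A function with finitely many local maxima that tends to 0 is eventually decreasing, hence the tail sum of
  \<open>G\<close> is bounded by its integral. The quadratic error terms are summed against the payoff,
  whose grid values are summable because the undamped payoff is eventually monotone.
  The left tail is the right tail of the reflected functions.
\<close>

section \<open>Fourier integrals and the Poisson kernel\<close>

text \<open>The transform of the damped payoff need not be integrable: a jump leaves only decay of
  order 1/u, so the inversion integral has no absolutely convergent form. The factor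
  \<open>exp (- \<epsilon> * u)\<close> repairs this; its cosine transform is the Poisson kernel, an
  approximate identity at continuity points. It also amounts to replacing y by y + i \<epsilon>, so
  that one exponential carries both oscillation and damping. The delicate point is uniformity: the
  constant in front of \<open>1 / y\<^sup>2\<close> must not depend on \<epsilon>, whereas the term
  that vanishes as the right end X of the integral grows may, because X tends to infinity before
  \<epsilon> tends to 0. The contour can be rotated only to the right of all branch cuts, which may
  stand above the band edge; from the band edge to that abscissa integration by parts on the real
  axis is used, and the boundary terms at the junction cancel. Among the products of errors, payoff
  times \<open>1 / y\<^sup>2\<close> is the critical one: mere boundedness of the payoff would give
  1/U after summation, so its grid values have to be summable.\<close>

lemma fourier_fubini:
  fixes h g :: "real \<Rightarrow> real"
  assumes h: "integrable lborel h" and g: "integrable lborel g"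
  shows "integrable lborel (\<lambda>u. g u * Re (fourier h (of_real u) * cis (u * y)))"
    and "(LINT u|lborel. g u * Re (fourier h (of_real u) * cis (u * y)))
         = (LINT t|lborel. h t * (LINT u|lborel. g u * cos (u * (y - t))))"
proof -
  \<comment> \<open>Because h is real, negative frequencies only contribute complex conjugates.
    Taking the real part therefore allows weights g supported on u >= 0, and g acts on h through its
    cosine transform.\<close>
  have 0: "Re (fourier h (of_real u) * cis (u * y)) = (LINT t|lborel. h t * cos (u * (y - t)))" for u
  proof -
    have "fourier h (of_real u) * cis (u * y)
        = (LINT t|lborel. complex_of_real (h t) * exp (- \<i> * of_real u * of_real t) * cis (u * y))"
      unfolding fourier_def by simp
    also have "\<dots> = (LINT t|lborel. complex_of_real (h t) * cis (u * (y - t)))"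
      by (intro Bochner_Integration.integral_cong)
         (auto simp: cis_conv_exp mult.assoc simp flip: exp_add, simp add: algebra_simps)
    finally have *: "fourier h (of_real u) * cis (u * y) = \<dots>" .
    have int: "integrable lborel (\<lambda>t. complex_of_real (h t) * cis (u * (y - t)))"
    proof (rule Bochner_Integration.integrable_bound[OF h])
      have [measurable]: "h \<in> borel_measurable lborel" using h by auto
      show "(\<lambda>t. complex_of_real (h t) * cis (u * (y - t))) \<in> borel_measurable lborel"
        unfolding cis_conv_exp by measurable
    qed (auto simp: norm_mult)
    show ?thesis unfolding * using integral_Re[OF int] by simp
  qed
  have [measurable]: "h \<in> borel_measurable lborel" "g \<in> borel_measurable lborel" using h g by auto
  have pr: "integrable (lborel \<Otimes>\<^sub>M lborel) (\<lambda>(u, t). g u * (h t * cos (u * (y - t))))"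
  proof (rule Bochner_Integration.integrable_bound)
    show "integrable (lborel \<Otimes>\<^sub>M lborel) (\<lambda>x. g (fst x) * h (snd x))"
      using lborel_pair.integrable_product_swap
      by (auto intro!: lborel_pair.Fubini_integrable g h simp: abs_mult)
    show "AE x in lborel \<Otimes>\<^sub>M lborel. norm (case x of (u, t) \<Rightarrow> g u * (h t * cos (u * (y - t))))
       \<le> norm (g (fst x) * h (snd x))"
      by (auto simp: abs_mult intro!: AE_I2 mult_left_mono mult_left_le)
  qed measurable
  have 1: "(\<lambda>u. g u * Re (fourier h (of_real u) * cis (u * y)))
         = (\<lambda>u. LINT t|lborel. g u * (h t * cos (u * (y - t))))"
    unfolding 0 by simp
  show "integrable lborel (\<lambda>u. g u * Re (fourier h (of_real u) * cis (u * y)))"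
    unfolding 1 using lborel_pair.integrable_fst'[OF pr] by simp
  have "(LINT u|lborel. LINT t|lborel. g u * (h t * cos (u * (y - t))))
      = (LINT t|lborel. LINT u|lborel. g u * (h t * cos (u * (y - t))))"
    using lborel_pair.Fubini_integral[of "\<lambda>u t. g u * (h t * cos (u * (y - t)))"] pr by simp
  also have "\<dots> = (LINT t|lborel. h t * (LINT u|lborel. g u * cos (u * (y - t))))"
    by (simp add: algebra_simps flip: integral_mult_right_zero)
  finally show "(LINT u|lborel. g u * Re (fourier h (of_real u) * cis (u * y)))
         = (LINT t|lborel. h t * (LINT u|lborel. g u * cos (u * (y - t))))"
    unfolding 1 .
qed

text \<open>The kernel belonging to the frequency band. With \<open>r = 2 powi m * pi\<close> and y
  a grid point it is a multiple of the Shannon function, so the band part of the inversion integral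
  is the coefficient.\<close>

lemma integral_cos_band:
  assumes "0 \<le> (r::real)"
  shows "(LINT u|lborel. indicator {0..r} u * cos (u * s)) = (if s = 0 then r else sin (r * s) / s)"
proof (cases "s = 0")
  case True
  then show ?thesis using assms by simp
next
  case False
  have "(LINT u|lborel. indicator {0..r} u *\<^sub>R cos (u * s)) = sin (r * s) / s - sin (0 * s) / s"
    using assms False
    by (intro integral_FTC_atLeastAtMost)
       (auto simp flip: has_real_derivative_iff_has_vector_derivative
             intro!: derivative_eq_intros continuous_intros)
  then show ?thesis using False by simp
qed

lemma integral_cos_exp:
  fixes \<epsilon> s :: real
  assumes e: "0 < \<epsilon>"
  shows "integrable lborel (\<lambda>u. indicator {0<..} u * exp (- \<epsilon> * u))"
    and "(LINT u|lborel. (indicator {0<..} u * exp (- \<epsilon> * u)) * cos (u * s)) = \<epsilon> / (\<epsilon>\<^sup>2 + s\<^sup>2)"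
proof -
  show int: "integrable lborel (\<lambda>u. indicator {0<..} u * exp (- \<epsilon> * u))"
    using integrable_I0i_exp_mscale[OF e] unfolding set_integrable_def
    by (simp add: mult.commute)
  have pos: "0 < \<epsilon>\<^sup>2 + s\<^sup>2" using e by (simp add: sum_power2_gt_zero_iff)
  \<comment> \<open>The real part of exp(c u) / c for c = - \<epsilon> + i s.\<close>
  define F where "F = (\<lambda>u. exp (- \<epsilon> * u) * (s * sin (u * s) - \<epsilon> * cos (u * s)) / (\<epsilon>\<^sup>2 + s\<^sup>2))"
  have "integrable lborel (\<lambda>u. (indicator {0<..} u * exp (- \<epsilon> * u)) * cos (u * s))"
    by (rule Bochner_Integration.integrable_bound[OF int])
       (auto simp: abs_mult intro!: AE_I2 mult_left_le)
  hence si: "set_integrable lborel (einterval (ereal 0) \<infinity>) (\<lambda>u. exp (- \<epsilon> * u) * cos (u * s))"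
    by (simp add: set_integrable_def einterval_def greaterThan_def[symmetric] mult.assoc)
  have "(LBINT u=ereal 0..\<infinity>. exp (- \<epsilon> * u) * cos (u * s)) = 0 - F 0"
  proof (rule interval_integral_FTC_integrable)
    fix u :: real
    have "(F has_real_derivative
        (exp (- \<epsilon> * u) * (- \<epsilon>) * (s * sin (u * s) - \<epsilon> * cos (u * s))
         + exp (- \<epsilon> * u) * (s * (cos (u * s) * s) + \<epsilon> * (sin (u * s) * s))) / (\<epsilon>\<^sup>2 + s\<^sup>2)) (at u)"
      unfolding F_def using pos by (auto intro!: derivative_eq_intros)
    also have "exp (- \<epsilon> * u) * (- \<epsilon>) * (s * sin (u * s) - \<epsilon> * cos (u * s))
         + exp (- \<epsilon> * u) * (s * (cos (u * s) * s) + \<epsilon> * (sin (u * s) * s))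
         = exp (- \<epsilon> * u) * cos (u * s) * (\<epsilon>\<^sup>2 + s\<^sup>2)"
      by (simp add: algebra_simps power2_eq_square)
    finally show "(F has_vector_derivative exp (- \<epsilon> * u) * cos (u * s)) (at u)"
      using e by (simp flip: has_real_derivative_iff_has_vector_derivative)
    show "isCont (\<lambda>u. exp (- \<epsilon> * u) * cos (u * s)) u"
      by (intro continuous_intros)
  next
    have "(F \<longlongrightarrow> F 0) (at 0)"
      unfolding F_def using pos by (intro tendsto_intros) auto
    hence "(F \<longlongrightarrow> F 0) (at_right 0)" by (rule filterlim_at_split[THEN iffD1, THEN conjunct2])
    thus "((F \<circ> real_of_ereal) \<longlongrightarrow> F 0) (at_right (ereal 0))"
      by (simp add: ereal_tendsto_simps)
    have "(F \<longlongrightarrow> 0) at_top"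
    proof (rule Lim_null_comparison)
      show "\<forall>\<^sub>F u in at_top. norm (F u) \<le> exp (- \<epsilon> * u) * ((\<bar>s\<bar> + \<epsilon>) / (\<epsilon>\<^sup>2 + s\<^sup>2))"
      proof (rule always_eventually, rule allI)
        fix u
        have "\<bar>s * sin (u * s) - \<epsilon> * cos (u * s)\<bar> \<le> \<bar>s * sin (u * s)\<bar> + \<bar>\<epsilon> * cos (u * s)\<bar>" by simp
        also have "\<dots> \<le> \<bar>s\<bar> + \<epsilon>"
          using e by (auto simp: abs_mult intro!: add_mono mult_left_le)
        finally show "norm (F u) \<le> exp (- \<epsilon> * u) * ((\<bar>s\<bar> + \<epsilon>) / (\<epsilon>\<^sup>2 + s\<^sup>2))"
          unfolding F_def using pos by (simp add: abs_mult divide_right_mono)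
      qed
      show "((\<lambda>u. exp (- \<epsilon> * u) * ((\<bar>s\<bar> + \<epsilon>) / (\<epsilon>\<^sup>2 + s\<^sup>2))) \<longlongrightarrow> 0) at_top"
        using e by real_asymp
    qed
    thus "((F \<circ> real_of_ereal) \<longlongrightarrow> 0) (at_left \<infinity>)"
      by (simp add: ereal_tendsto_simps)
  qed (use si in auto)
  moreover have "(LBINT u=ereal 0..\<infinity>. exp (- \<epsilon> * u) * cos (u * s))
      = (LINT u|lborel. (indicator {0<..} u * exp (- \<epsilon> * u)) * cos (u * s))"
    by (simp add: interval_lebesgue_integral_def set_lebesgue_integral_def einterval_def
          greaterThan_def[symmetric] mult.assoc)
  ultimately show "(LINT u|lborel. (indicator {0<..} u * exp (- \<epsilon> * u)) * cos (u * s)) = \<epsilon> / (\<epsilon>\<^sup>2 + s\<^sup>2)"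
    by (simp add: F_def)
qed

lemma poisson_kernel_integral:
  fixes \<epsilon> y :: real
  assumes e: "0 < \<epsilon>"
  shows "has_bochner_integral lborel (\<lambda>t. \<epsilon> / (\<epsilon>\<^sup>2 + (y - t)\<^sup>2)) pi"
proof -
  have "has_bochner_integral lborel (\<lambda>x::real. inverse (1 + x\<^sup>2)) pi"
    using integrable_inverse_1_plus_square LBINT_inverse_1_plus_square
    by (simp add: has_bochner_integral_iff set_integrable_def interval_lebesgue_integral_def set_lebesgue_integral_def einterval_def)
  hence "has_bochner_integral lborel (\<lambda>t. inverse (1 + (y/\<epsilon> + (-1/\<epsilon>) * t)\<^sup>2)) (pi /\<^sub>R \<bar>-1/\<epsilon>\<bar>)"
    using e by (subst (asm) lborel_has_bochner_integral_real_affine_iff[of "-1/\<epsilon>" _ _ "y/\<epsilon>"]) auto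
  from has_bochner_integral_mult_right[OF this, of "1/\<epsilon>"]
  have "has_bochner_integral lborel (\<lambda>t. 1/\<epsilon> * inverse (1 + (y/\<epsilon> + (-1/\<epsilon>) * t)\<^sup>2)) pi"
    using e by simp
  also have "(\<lambda>t. 1/\<epsilon> * inverse (1 + (y/\<epsilon> + (-1/\<epsilon>) * t)\<^sup>2)) = (\<lambda>t. \<epsilon> / (\<epsilon>\<^sup>2 + (y - t)\<^sup>2))"
  proof
    fix t
    have "1 + (y/\<epsilon> + (-1/\<epsilon>) * t)\<^sup>2 = (\<epsilon>\<^sup>2 + (y - t)\<^sup>2) / \<epsilon>\<^sup>2"
      using e by (simp add: field_simps power2_eq_square)
    thus "1/\<epsilon> * inverse (1 + (y/\<epsilon> + (-1/\<epsilon>) * t)\<^sup>2) = \<epsilon> / (\<epsilon>\<^sup>2 + (y - t)\<^sup>2)"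
      using e by (simp add: power2_eq_square)
  qed
  finally show ?thesis .
qed

lemma poisson_kernel_tendsto:
  fixes h :: "real \<Rightarrow> real"
  assumes h: "integrable lborel h" and c: "isCont h y"
  shows "((\<lambda>\<epsilon>. LINT t|lborel. h t * (\<epsilon> / (\<epsilon>\<^sup>2 + (y - t)\<^sup>2))) \<longlongrightarrow> pi * h y) (at_right 0)"
proof (rule tendstoI)
  fix e :: real assume e: "0 < e"
  define \<eta> where "\<eta> = e / (2 * pi)"
  have \<eta>: "0 < \<eta>" using e by (simp add: \<eta>_def)
  obtain d where d: "0 < d" "\<And>t. \<bar>t - y\<bar> < d \<Longrightarrow> \<bar>h t - h y\<bar> < \<eta>"
    using c \<eta> unfolding continuous_at_eps_delta dist_real_def by blast
  \<comment> \<open>B collects everything that carries a factor \<epsilon>. Away from y the kernel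
    is at most \<open>\<epsilon> / d\<^sup>2\<close>, which suffices against the integrable h; the
    constant h y is not integrable and needs the kernel dominated by \<epsilon> times the kernel
    \<open>k1\<close> of width 1. The choice of \<eta> makes the part near y contribute \<eta> * pi
    = e / 2.\<close>
  define B where "B = (LINT t|lborel. \<bar>h t\<bar>) / d\<^sup>2 + (1 + 1 / d\<^sup>2) * \<bar>h y\<bar> * pi"
  have meas [measurable]: "h \<in> borel_measurable lborel" using h by auto
  have main: "\<bar>(LINT t|lborel. h t * (\<epsilon> / (\<epsilon>\<^sup>2 + (y - t)\<^sup>2))) - pi * h y\<bar> \<le> e / 2 + \<epsilon> * B" if \<epsilon>: "0 < \<epsilon>" for \<epsilon>
  proof -
    define k where "k = (\<lambda>t. \<epsilon> / (\<epsilon>\<^sup>2 + (y - t)\<^sup>2))"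
    define k1 where "k1 = (\<lambda>t. 1 / (1\<^sup>2 + (y - t)\<^sup>2))"
    have den: "0 < \<epsilon>\<^sup>2 + (y - t)\<^sup>2" for t using \<epsilon> by (simp add: sum_power2_gt_zero_iff)
    have k0: "0 \<le> k t" for t using \<epsilon> den[of t] by (simp add: k_def)
    have k: "integrable lborel k" "(LINT t|lborel. k t) = pi"
      using poisson_kernel_integral[OF \<epsilon>, of y] by (auto simp: k_def has_bochner_integral_iff)
    have k1: "integrable lborel k1" "(LINT t|lborel. k1 t) = pi"
      using poisson_kernel_integral[of 1 y] by (auto simp: k1_def has_bochner_integral_iff)
    have kle: "k t \<le> 1 / \<epsilon>" for t
    proof -
      have "\<epsilon> * \<epsilon> \<le> 1 * (\<epsilon>\<^sup>2 + (y - t)\<^sup>2)" by (simp add: power2_eq_square)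
      thus ?thesis unfolding k_def using \<epsilon> den[of t] by (subst frac_le_eq) (auto simp: divide_le_0_iff)
    qed
    have hk: "integrable lborel (\<lambda>t. h t * k t)"
    proof (rule Bochner_Integration.integrable_bound[OF integrable_mult_right[OF h, of "1/\<epsilon>"]])
      show "(\<lambda>t. h t * k t) \<in> borel_measurable lborel" unfolding k_def by measurable
      show "AE t in lborel. norm (h t * k t) \<le> norm (1/\<epsilon> * h t)"
        using mult_left_mono[OF kle abs_ge_zero] k0 \<epsilon> by (auto intro!: AE_I2 simp: abs_mult)
    qed
    have bd: "\<bar>(h t - h y) * k t\<bar> \<le> \<eta> * k t + \<epsilon> / d\<^sup>2 * \<bar>h t\<bar> + \<epsilon> * (1 + 1/d\<^sup>2) * \<bar>h y\<bar> * k1 t" for t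
    proof (cases "\<bar>t - y\<bar> < d")
      case True
      have "\<bar>(h t - h y) * k t\<bar> \<le> \<eta> * k t"
        using d(2)[OF True] k0[of t] by (simp add: abs_mult mult_right_mono)
      moreover have "0 \<le> \<epsilon> / d\<^sup>2 * \<bar>h t\<bar>" "0 \<le> \<epsilon> * (1 + 1/d\<^sup>2) * \<bar>h y\<bar> * k1 t"
        using \<epsilon> by (auto simp: k1_def)
      ultimately show ?thesis by linarith
    next
      case False
      hence sq: "d\<^sup>2 \<le> (y - t)\<^sup>2" using d(1) by (metis abs_le_square_iff abs_minus_commute abs_of_pos not_less)
      have d2: "0 < d\<^sup>2" using d(1) by simp
      have a: "k t \<le> \<epsilon> / d\<^sup>2"
        unfolding k_def using \<epsilon> sq d2 by (intro divide_left_mono) (auto intro: add_increasing mult_pos_pos den)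
      have "d\<^sup>2 * (1\<^sup>2 + (y - t)\<^sup>2) \<le> (d\<^sup>2 + 1) * (\<epsilon>\<^sup>2 + (y - t)\<^sup>2)"
      proof -
        have "d\<^sup>2 * (1\<^sup>2 + (y - t)\<^sup>2) \<le> (d\<^sup>2 + 1) * (y - t)\<^sup>2" using sq by (simp add: algebra_simps)
        also have "\<dots> \<le> (d\<^sup>2 + 1) * (\<epsilon>\<^sup>2 + (y - t)\<^sup>2)" by (intro mult_left_mono) auto
        finally show ?thesis .
      qed
      hence "1 / (\<epsilon>\<^sup>2 + (y - t)\<^sup>2) \<le> (1 + 1/d\<^sup>2) * k1 t"
        unfolding k1_def using d2 den[of t] sum_power2_gt_zero_iff[of 1 "y - t"]
        by (simp add: divide_simps)
      hence b: "k t \<le> \<epsilon> * (1 + 1/d\<^sup>2) * k1 t"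
        unfolding k_def using mult_left_mono[of _ _ \<epsilon>] \<epsilon> by (fastforce simp: mult.assoc)
      have "\<bar>(h t - h y) * k t\<bar> \<le> (\<bar>h t\<bar> + \<bar>h y\<bar>) * k t"
        using k0[of t] by (simp add: abs_mult mult_right_mono)
      also have "\<dots> \<le> \<bar>h t\<bar> * (\<epsilon> / d\<^sup>2) + \<bar>h y\<bar> * (\<epsilon> * (1 + 1/d\<^sup>2) * k1 t)"
        unfolding distrib_right using a b by (intro add_mono mult_left_mono) auto
      finally show ?thesis using mult_nonneg_nonneg[of \<eta> "k t", OF less_imp_le[OF \<eta>] k0] by (simp add: algebra_simps)
    qed
    have "(LINT t|lborel. h t * k t) - pi * h y = (LINT t|lborel. (h t - h y) * k t)"
      using hk k by (simp add: algebra_simps)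
    also have "\<bar>\<dots>\<bar> \<le> (LINT t|lborel. \<bar>(h t - h y) * k t\<bar>)"
      using integral_norm_bound[of lborel "\<lambda>t. (h t - h y) * k t"] by simp
    also have "\<dots> \<le> (LINT t|lborel. \<eta> * k t + \<epsilon> / d\<^sup>2 * \<bar>h t\<bar> + \<epsilon> * (1 + 1/d\<^sup>2) * \<bar>h y\<bar> * k1 t)"
    proof (rule integral_mono)
      have "integrable lborel (\<lambda>t. (h t - h y) * k t)" 
        using hk k by (simp add: algebra_simps)
      thus "integrable lborel (\<lambda>t. \<bar>(h t - h y) * k t\<bar>)" by (rule integrable_abs)
    qed (use bd h k k1 in \<open>auto intro!: Bochner_Integration.integrable_add integrable_mult_right integrable_abs\<close>)
    also have "\<dots> = \<eta> * pi + \<epsilon> / d\<^sup>2 * (LINT t|lborel. \<bar>h t\<bar>) + \<epsilon> * (1 + 1/d\<^sup>2) * \<bar>h y\<bar> * pi"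
      using h k k1 by (simp add: integrable_abs)
    also have "\<dots> = e / 2 + \<epsilon> * B" by (simp add: \<eta>_def B_def algebra_simps)
    finally show ?thesis by (simp add: k_def)
  qed
  have "((\<lambda>\<epsilon>. e / 2 + \<epsilon> * B) \<longlongrightarrow> e / 2 + 0 * B) (at_right 0)" by (intro tendsto_intros)
  hence "\<forall>\<^sub>F \<epsilon> in at_right 0. e / 2 + \<epsilon> * B < e" using e by (intro order_tendstoD(2)[of _ "e / 2"]) auto
  moreover have "\<forall>\<^sub>F \<epsilon>::real in at_right 0. 0 < \<epsilon>" by (simp add: eventually_at_right_less)
  ultimately show "\<forall>\<^sub>F \<epsilon> in at_right 0. dist (LINT t|lborel. h t * (\<epsilon> / (\<epsilon>\<^sup>2 + (y - t)\<^sup>2))) (pi * h y) < e"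
    by eventually_elim (use main in \<open>force simp: dist_real_def\<close>)
qed

section \<open>Oscillatory integrals of analytic functions\<close>

text \<open>The rate \<eta> is free, so polynomial growth can be charged to an arbitrarily small
  part of an exponential decay. Below the threshold X the power is at most its value at the modulus
  of X.\<close>

lemma powr_le_exp:
  fixes q \<eta> :: real
  assumes "0 < q" "0 < \<eta>"
  obtains C where "0 < C" "\<And>x. 0 \<le> x \<Longrightarrow> 1 + x powr q \<le> C * exp (\<eta> * x)"
proof -
  have "((\<lambda>x. (1 + x powr q) * exp (- \<eta> * x)) \<longlongrightarrow> 0) at_top"
    using assms by real_asymp
  hence "\<forall>\<^sub>F x in at_top. (1 + x powr q) * exp (- \<eta> * x) < 1"
    by (rule order_tendstoD) simp
  then obtain X where X: "\<And>x. X \<le> x \<Longrightarrow> (1 + x powr q) * exp (- \<eta> * x) < 1"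
    unfolding eventually_at_top_linorder by blast
  define C where "C = 1 + \<bar>X\<bar> powr q"
  have "1 + x powr q \<le> C * exp (\<eta> * x)" if x: "0 \<le> x" for x
  proof (cases "X \<le> x")
    case True
    have "1 + x powr q \<le> 1 * exp (\<eta> * x)"
      using X[OF True] by (simp add: exp_minus field_simps)
    also have "\<dots> \<le> C * exp (\<eta> * x)" by (intro mult_right_mono) (auto simp: C_def)
    finally show ?thesis .
  next
    case False
    have "1 + x powr q \<le> C * 1" using False x assms by (simp add: C_def powr_mono2)
    also have "\<dots> \<le> C * exp (\<eta> * x)" using x assms by (intro mult_left_mono) (auto simp: C_def)
    finally show ?thesis .
  qed
  moreover have "0 < C" by (simp add: C_def add_pos_nonneg)
  ultimately show ?thesis using that by blast
qed

lemma has_vector_derivative_Complex: "(Complex X has_vector_derivative \<i>) (at t within T)"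
proof -
  have "((\<lambda>t. of_real X + t *\<^sub>R \<i>) has_vector_derivative \<i>) (at t within T)"
    by (auto intro!: derivative_eq_intros)
  also have "(\<lambda>t. of_real X + t *\<^sub>R \<i>) = Complex X" by (auto simp: complex_eq_iff)
  finally show ?thesis .
qed

lemma norm_exp_i_Complex: "norm (exp (\<i> * Complex y \<epsilon> * u)) = exp (- (y * Im u + \<epsilon> * Re u))"
  by (simp add: norm_exp_eq_Re)

text \<open>Rotating the contour to vertical half-lines, on which the exponential decays.\<close>

lemma oscillatory_tail_bound:
  fixes E :: "complex \<Rightarrow> complex" and q C r R :: real
  assumes holo: "E holomorphic_on {u. r < Re u}" and r: "0 \<le> r" "r < R" and q: "0 < q" and C: "0 \<le> C"
    and growth: "\<And>u. r < Re u \<Longrightarrow> norm (E u) \<le> C * (1 + norm u powr q)"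
  shows "\<exists>K. \<forall>y \<epsilon>. 1 \<le> y \<and> 0 < \<epsilon> \<and> \<epsilon> \<le> 1 \<longrightarrow>
    (\<exists>D. \<forall>X\<ge>R. norm (integral {R..X} (\<lambda>x. E (of_real x) * exp (\<i> * Complex y \<epsilon> * of_real x))
        - \<i> * E (of_real R) * exp (\<i> * Complex y \<epsilon> * of_real R) / Complex y \<epsilon>)
      \<le> K / y\<^sup>2 + D * exp (- (\<epsilon> / 2) * X))"
proof -
  let ?S = "{u. r < Re u}"
  have S: "open ?S" "convex ?S" by (simp_all add: open_halfspace_Re_gt convex_halfspace_Re_gt)
  \<comment> \<open>Used with rate 1/2, which gives constants free of y and \<epsilon>, and with
    rate \<epsilon> / 2, which leaves half of the damping for the decay in Re u.\<close>
  have exp_growth: "\<exists>B>0. \<forall>u\<in>?S. norm (E u) \<le> B * exp (\<eta> * (Re u + \<bar>Im u\<bar>))" if \<eta>: "0 < \<eta>" for \<eta>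
  proof -
    obtain B where B: "0 < B" "\<And>x. 0 \<le> x \<Longrightarrow> 1 + x powr q \<le> B * exp (\<eta> * x)"
      using powr_le_exp[OF q \<eta>] by blast
    have "norm (E u) \<le> (C + 1) * B * exp (\<eta> * (Re u + \<bar>Im u\<bar>))" if u: "u \<in> ?S" for u
    proof -
      have "norm (E u) \<le> C * (1 + norm u powr q)" using growth u by simp
      also have "\<dots> \<le> (C + 1) * (B * exp (\<eta> * norm u))"
        using C B by (intro mult_mono) auto
      also have "\<dots> \<le> (C + 1) * (B * exp (\<eta> * (Re u + \<bar>Im u\<bar>)))"
        using C B \<eta> u r cmod_le[of u] by (intro mult_left_mono) auto
      finally show ?thesis by (simp add: mult.assoc)
    qed
    thus ?thesis using B C by (intro exI[of _ "(C + 1) * B"]) auto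
  qed
  \<comment> \<open>The factor t produces the quadratic order: integrated against exp(- y t) it
    gives \<open>1 / y\<^sup>2\<close>. It comes from a bound on the derivative for t <= 1 and is
    harmless for larger t. K depends on neither y nor \<epsilon>.\<close>
  have line: "\<exists>K\<ge>0. \<forall>t\<ge>0. norm (E (Complex R t) - E (of_real R)) \<le> K * t * exp (t / 2)"
  proof -
    obtain B where B: "0 < B" "\<And>u. u \<in> ?S \<Longrightarrow> norm (E u) \<le> B * exp (1/2 * (Re u + \<bar>Im u\<bar>))"
      using exp_growth[of "1/2"] by auto
    have sub: "cbox (Complex R 0) (Complex R 1) \<subseteq> ?S" using r by (auto simp: in_cbox_complex_iff)
    have "continuous_on (cbox (Complex R 0) (Complex R 1)) (deriv E)"
      using holomorphic_on_subset[OF holomorphic_deriv[OF holo S(1)] sub] 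
      by (rule holomorphic_on_imp_continuous_on)
    hence "bounded (deriv E ` cbox (Complex R 0) (Complex R 1))"
      by (intro compact_imp_bounded compact_continuous_image compact_cbox)
    then obtain M where M: "0 < M" "\<And>u. u \<in> cbox (Complex R 0) (Complex R 1) \<Longrightarrow> norm (deriv E u) \<le> M"
      unfolding bounded_pos by auto
    define K where "K = M + 2 * B * exp (R / 2)"
    have "norm (E (Complex R t) - E (of_real R)) \<le> K * t * exp (t / 2)" if t: "0 \<le> t" for t
    proof (cases "t \<le> 1")
      case True
      have "norm (E (Complex R t) - E (Complex R 0)) \<le> M * norm (Complex R t - Complex R 0)"
      proof (rule field_differentiable_bound)
        show "convex (cbox (Complex R 0) (Complex R 1))" by (rule convex_box)
        show "(E has_field_derivative deriv E u) (at u within cbox (Complex R 0) (Complex R 1))"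
          if "u \<in> cbox (Complex R 0) (Complex R 1)" for u
          using holomorphic_derivI[OF holo S(1)] that sub by (blast intro: has_field_derivative_at_within)
      qed (use M True t in \<open>auto simp: in_cbox_complex_iff\<close>)
      also have "\<dots> = M * t * 1" using t by (simp add: cmod_def)
      also have "\<dots> \<le> K * t * exp (t / 2)"
        using t M B by (intro mult_mono) (auto simp: K_def)
      finally show ?thesis by (simp add: complex_of_real_def)
    next
      case False
      have "norm (E (Complex R t) - E (of_real R)) \<le> norm (E (Complex R t)) + norm (E (of_real R))"
        by (rule norm_triangle_ineq4)
      also have "\<dots> \<le> B * exp (1/2 * (R + t)) + B * exp (1/2 * R)"
        using B(2)[of "Complex R t"] B(2)[of "of_real R"] r t by auto
      also have "\<dots> \<le> B * exp (1/2 * (R + t)) + B * exp (1/2 * (R + t))"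
        using B t by simp
      also have "\<dots> = 2 * B * exp (R / 2) * 1 * exp (t / 2)" by (simp add: exp_add add_divide_distrib)
      also have "\<dots> \<le> K * t * exp (t / 2)"
        using B M False by (intro mult_mono) (auto simp: K_def)
      finally show ?thesis .
    qed
    moreover have "0 \<le> K" using M B by (simp add: K_def)
    ultimately show ?thesis by blast
  qed
  then obtain K where K: "0 \<le> K" "\<And>t. 0 \<le> t \<Longrightarrow> norm (E (Complex R t) - E (of_real R)) \<le> K * t * exp (t / 2)"
    by blast
  show ?thesis
  proof (rule exI[of _ "4 * K"], intro allI impI, elim conjE)
    fix y \<epsilon> :: real assume y: "1 \<le> y" and \<epsilon>: "0 < \<epsilon>" "\<epsilon> \<le> 1"
    define z where "z = Complex y \<epsilon>"
    have z0: "z \<noteq> 0" using y by (auto simp: z_def complex_eq_iff)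
    define e where "e = (\<lambda>u. exp (\<i> * z * u))"
    have ne: "norm (e u) = exp (- (y * Im u + \<epsilon> * Re u))" for u
      unfolding e_def z_def by (rule norm_exp_i_Complex)
    \<comment> \<open>A primitive on the convex half-plane takes the place of Cauchy's theorem: the
      integrals over all edges of the rectangle are differences of values of F.\<close>
    have "(\<lambda>u. E u * e u) holomorphic_on ?S"
      unfolding e_def by (intro holomorphic_intros holo)
    then obtain F where "\<And>u. u \<in> ?S \<Longrightarrow> (F has_field_derivative E u * e u) (at u within ?S)"
      using holomorphic_convex_primitive'[OF S(2,1)] by blast
    hence F: "(F has_field_derivative E u * e u) (at u)" if "r < Re u" for u
      using that S(1) by (metis at_within_open mem_Collect_eq)
    obtain B where B: "0 < B" "\<And>u. u \<in> ?S \<Longrightarrow> norm (E u) \<le> B * exp (\<epsilon> / 2 * (Re u + \<bar>Im u\<bar>))"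
      using exp_growth[of "\<epsilon> / 2"] \<epsilon> by auto
    \<comment> \<open>Horizontally the growth uses up half of the damping exp(- \<epsilon> X).
      Vertically the exponent is \<epsilon> / 2 - y <= - 1/2, as y >= 1 >= \<epsilon>.\<close>
    have decay: "norm (E (Complex X t) * e (Complex X t)) \<le> B * exp (- (\<epsilon> / 2) * X) * exp (- t / 2)"
      if "R \<le> X" "0 \<le> t" for X t
    proof -
      have "norm (E (Complex X t) * e (Complex X t))
          \<le> B * exp (\<epsilon> / 2 * (X + t)) * exp (- (y * t + \<epsilon> * X))"
        unfolding norm_mult ne using B(1) B(2)[of "Complex X t"] that r by (intro mult_mono) auto
      also have "\<dots> = B * exp (- (\<epsilon> / 2) * X + (\<epsilon> / 2 - y) * t)"
        by (simp add: mult.assoc flip: exp_add) (simp add: algebra_simps)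
      also have "\<dots> \<le> B * exp (- (\<epsilon> / 2) * X + (- (1 / 2)) * t)"
        using B(1) y \<epsilon> that mult_right_mono[of "\<epsilon> / 2 - y" "- (1 / 2)" t] by (intro mult_left_mono) auto
      finally show ?thesis by (simp add: mult.assoc flip: exp_add)
    qed
    have vline: "((\<lambda>t. F (Complex X t)) has_vector_derivative \<i> * (E (Complex X t) * e (Complex X t))) (at t within T)"
      if "R \<le> X" for X t T
    proof -
      have "((F \<circ> (\<lambda>t. Complex X t)) has_vector_derivative \<i> * (E (Complex X t) * e (Complex X t))) (at t within T)"
      proof (rule field_vector_diff_chain_within)
        show "((\<lambda>t. Complex X t) has_vector_derivative \<i>) (at t within T)"
          by (rule has_vector_derivative_Complex)
        show "(F has_field_derivative E (Complex X t) * e (Complex X t)) (at (Complex X t) within (\<lambda>t. Complex X t) ` T)"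
          using F[of "Complex X t"] that r by (auto intro: has_field_derivative_at_within)
      qed
      thus ?thesis by (simp add: o_def)
    qed
    have right: "norm (F (Complex X T) - F (Complex X 0)) \<le> 2 * B * exp (- (\<epsilon> / 2) * X)"
      if X: "R \<le> X" and T: "0 < T" for X T
    proof -
      define \<phi> where "\<phi> = (\<lambda>t::real. - 2 * B * exp (- (\<epsilon> / 2) * X) * exp (- t / 2))"
      have "norm (F (Complex X T) - F (Complex X 0)) \<le> \<phi> T - \<phi> 0"
      proof (rule differentiable_bound_general[OF T])
        show "continuous_on {0..T} (\<lambda>t. F (Complex X t))"
          using vline[OF X] by (intro continuous_on_vector_derivative) blast
        show "continuous_on {0..T} \<phi>" unfolding \<phi>_def by (intro continuous_intros) auto
        show "(\<phi> has_vector_derivative B * exp (- (\<epsilon> / 2) * X) * exp (- t / 2)) (at t)" for t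
          unfolding \<phi>_def by (auto simp flip: has_real_derivative_iff_has_vector_derivative
             intro!: derivative_eq_intros)
        show "norm (\<i> * (E (Complex X t) * e (Complex X t))) \<le> B * exp (- (\<epsilon> / 2) * X) * exp (- t / 2)"
          if "0 < t" "t < T" for t
          using decay[OF X, of t] that by (simp add: norm_mult)
      qed (rule vline[OF X])
      also have "\<dots> \<le> 2 * B * exp (- (\<epsilon> / 2) * X)"
        using B(1) by (simp add: \<phi>_def)
      finally show ?thesis .
    qed
    define Q where "Q = (\<lambda>t. F (Complex R t) - E (of_real R) * e (Complex R t) / (\<i> * z))"
    have Q': "(Q has_vector_derivative \<i> * ((E (Complex R t) - E (of_real R)) * e (Complex R t))) (at t within T)" for t T
    proof -
      have "((\<lambda>t. e (Complex R t)) has_vector_derivative \<i> * (\<i> * z * e (Complex R t))) (at t within T)"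
      proof -
        have "((e \<circ> (\<lambda>t. Complex R t)) has_vector_derivative \<i> * (\<i> * z * e (Complex R t))) (at t within T)"
        proof (rule field_vector_diff_chain_within)
          show "((\<lambda>t. Complex R t) has_vector_derivative \<i>) (at t within T)"
            by (rule has_vector_derivative_Complex)
          show "(e has_field_derivative \<i> * z * e (Complex R t)) (at (Complex R t) within (\<lambda>t. Complex R t) ` T)"
            unfolding e_def by (auto intro!: derivative_eq_intros)
        qed
        thus ?thesis by (simp add: o_def)
      qed
      hence "((\<lambda>t. (E (of_real R) / (\<i> * z)) * e (Complex R t)) has_vector_derivative
          (E (of_real R) / (\<i> * z)) * (\<i> * (\<i> * z * e (Complex R t)))) (at t within T)"
        by (rule has_vector_derivative_mult_right)
      moreover have "(E (of_real R) / (\<i> * z)) * (\<i> * (\<i> * z * e (Complex R t)))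
          = \<i> * (E (of_real R) * e (Complex R t))"
        using z0 by simp
      ultimately have "((\<lambda>t. (E (of_real R) / (\<i> * z)) * e (Complex R t)) has_vector_derivative
          \<i> * (E (of_real R) * e (Complex R t))) (at t within T)"
        by metis
      from has_vector_derivative_diff[OF vline[of R] this] show ?thesis
        by (simp add: Q_def left_diff_distrib right_diff_distrib)
    qed
    have left: "norm (Q T - Q 0) \<le> 4 * K / y\<^sup>2" if T: "0 < T" for T
    proof -
      \<comment> \<open>A primitive of K t exp(- y t / 2) that is nonpositive for t >= 0 and has the
        value \<open>- 4 * K / y\<^sup>2\<close> at 0, so its increments from 0 are at most
        \<open>4 * K / y\<^sup>2\<close>.\<close>
      define \<phi> where "\<phi> = (\<lambda>t::real. - K * (exp (- y * t / 2) * (2 * t / y + 4 / y\<^sup>2)))"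
      have "norm (Q T - Q 0) \<le> \<phi> T - \<phi> 0"
      proof (rule differentiable_bound_general[OF T])
        show "continuous_on {0..T} Q"
          using Q' by (intro continuous_on_vector_derivative) blast
        show "continuous_on {0..T} \<phi>" unfolding \<phi>_def using y by (intro continuous_intros) auto
        show "(\<phi> has_vector_derivative K * (t * exp (- y * t / 2))) (at t)" for t
        proof -
          have "(\<phi> has_real_derivative - K * (exp (- y * t / 2) * (- y / 2) * (2 * t / y + 4 / y\<^sup>2)
              + exp (- y * t / 2) * (2 / y))) (at t)"
            unfolding \<phi>_def using y by (auto intro!: derivative_eq_intros)
          moreover have "- y / 2 * (2 * t / y + 4 / y\<^sup>2) = - t - 2 / y"
            using y by (simp add: field_simps power2_eq_square)
          hence "exp (- y * t / 2) * (- y / 2) * (2 * t / y + 4 / y\<^sup>2) = exp (- y * t / 2) * (- t - 2 / y)"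
            by (simp only: mult.assoc)
          moreover have "- K * (exp (- y * t / 2) * (- t - 2 / y) + exp (- y * t / 2) * (2 / y))
              = K * (t * exp (- y * t / 2))"
            by (simp add: algebra_simps)
          ultimately show ?thesis
            unfolding has_real_derivative_iff_has_vector_derivative[symmetric] by metis
        qed
        show "norm (\<i> * ((E (Complex R t) - E (of_real R)) * e (Complex R t))) \<le> K * (t * exp (- y * t / 2))"
          if t: "0 < t" "t < T" for t
        proof -
          have "norm (\<i> * ((E (Complex R t) - E (of_real R)) * e (Complex R t)))
             \<le> (K * t * exp (t / 2)) * exp (- (y * t + \<epsilon> * R))"
            unfolding norm_mult ne using K(2)[of t] t by (auto intro!: mult_right_mono)
          also have "\<dots> \<le> (K * t * exp (t / 2)) * exp (- (y * t))"
            using K t r \<epsilon> by (intro mult_left_mono) auto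
          also have "\<dots> = K * t * exp (t / 2 - y * t)" by (simp add: mult.assoc flip: exp_add)
          also have "\<dots> \<le> K * t * exp (- y * t / 2)"
          proof -
            have "1 * t \<le> y * t" using y t by (intro mult_right_mono) auto
            hence "t / 2 - y * t \<le> - y * t / 2" by (simp only: mult_minus_left)
            hence "exp (t / 2 - y * t) \<le> exp (- y * t / 2)" by (simp only: exp_le_cancel_iff)
            thus ?thesis using K t by (intro mult_left_mono) auto
          qed
          finally show ?thesis by (simp add: mult.assoc)
        qed
      qed (rule Q')
      also have "\<dots> \<le> 4 * K / y\<^sup>2"
      proof -
        have "\<phi> T \<le> 0"
          using K(1) y T by (auto simp: \<phi>_def intro!: mult_nonneg_nonneg add_nonneg_nonneg)
        moreover have "\<phi> 0 = - (4 * K / y\<^sup>2)" by (simp add: \<phi>_def)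
        ultimately show ?thesis by linarith
      qed
      finally show ?thesis .
    qed
    have main: "norm (integral {R..X} (\<lambda>x. E (of_real x) * e (of_real x)) - \<i> * E (of_real R) * e (of_real R) / z)
       \<le> 4 * K / y\<^sup>2 + 2 * B * exp (- (\<epsilon> / 2) * X)" if X: "R \<le> X" for X
    proof -
      have FTC: "integral {R..X} (\<lambda>x. E (of_real x) * e (of_real x)) = F (of_real X) - F (of_real R)"
      proof (rule integral_unique, rule fundamental_theorem_of_calculus[OF X])
        fix x assume x: "x \<in> {R..X}"
        have "((F \<circ> of_real) has_vector_derivative 1 * (E (of_real x) * e (of_real x))) (at x within {R..X})"
          using x r by (intro field_vector_diff_chain_within has_field_derivative_at_within[OF F])
             (auto intro!: derivative_eq_intros)
        thus "((\<lambda>x. F (of_real x)) has_vector_derivative E (of_real x) * e (of_real x)) (at x within {R..X})"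
          by (simp add: o_def)
      qed
      \<comment> \<open>The upper edge of the rectangle, which disappears as its height T
        grows.\<close>
      define top where "top = (\<lambda>T. F (Complex X T) - F (Complex R T))"
      have top: "(top \<longlongrightarrow> 0) at_top"
      proof (rule Lim_null_comparison)
        show "\<forall>\<^sub>F T in at_top. norm (top T) \<le> B * exp (- T / 2) * (X - R)"
          using eventually_ge_at_top[of 0]
        proof eventually_elim
          case (elim T)
          have "norm (F (Complex X T) - F (Complex R T)) \<le> B * exp (- T / 2) * norm (Complex X T - Complex R T)"
          proof (rule field_differentiable_bound)
            show "convex (cbox (Complex R T) (Complex X T))" by (rule convex_box)
            show "(F has_field_derivative E u * e u) (at u within cbox (Complex R T) (Complex X T))"
              if "u \<in> cbox (Complex R T) (Complex X T)" for u
              using F[of u] that r by (auto intro: has_field_derivative_at_within simp: in_cbox_complex_iff)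
            show "norm (E u * e u) \<le> B * exp (- T / 2)" if "u \<in> cbox (Complex R T) (Complex X T)" for u
            proof -
              have u: "R \<le> Re u" "u = Complex (Re u) T" using that by (auto simp: in_cbox_complex_iff complex_eq_iff)
              have "norm (E u * e u) \<le> B * exp (- (\<epsilon> / 2) * Re u) * exp (- T / 2)"
                using decay[OF u(1) elim] u(2) by metis
              also have "\<dots> \<le> B * 1 * exp (- T / 2)"
                using B(1) \<epsilon> u r by (intro mult_mono) auto
              finally show ?thesis by simp
            qed
          qed (use X in \<open>auto simp: in_cbox_complex_iff\<close>)
          thus ?case using X by (simp add: top_def cmod_def)
        qed
        show "((\<lambda>T. B * exp (- T / 2) * (X - R)) \<longlongrightarrow> 0) at_top" by real_asymp
      qed
      have etop: "((\<lambda>T. E (of_real R) * e (Complex R T) / (\<i> * z)) \<longlongrightarrow> 0) at_top"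
      proof (rule Lim_null_comparison)
        show "\<forall>\<^sub>F T in at_top. norm (E (of_real R) * e (Complex R T) / (\<i> * z))
            \<le> norm (E (of_real R) / (\<i> * z)) * exp (- (y * T + \<epsilon> * R))"
          by (simp add: norm_mult norm_divide ne)
        show "((\<lambda>T. norm (E (of_real R) / (\<i> * z)) * exp (- (y * T + \<epsilon> * R))) \<longlongrightarrow> 0) at_top"
          using y by real_asymp
      qed
      have "((\<lambda>T. (F (of_real X) - F (of_real R)) - \<i> * E (of_real R) * e (of_real R) / z
           - top T - E (of_real R) * e (Complex R T) / (\<i> * z)) \<longlongrightarrow>
           (F (of_real X) - F (of_real R)) - \<i> * E (of_real R) * e (of_real R) / z - 0 - 0) at_top"
        by (intro tendsto_intros top etop)
      moreover have "\<forall>\<^sub>F T in at_top. norm ((F (of_real X) - F (of_real R)) - \<i> * E (of_real R) * e (of_real R) / z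
           - top T - E (of_real R) * e (Complex R T) / (\<i> * z)) \<le> 4 * K / y\<^sup>2 + 2 * B * exp (- (\<epsilon> / 2) * X)"
        using eventually_gt_at_top[of 0]
      proof eventually_elim
        case (elim T)
        have "(F (of_real X) - F (of_real R)) - \<i> * E (of_real R) * e (of_real R) / z
           - top T - E (of_real R) * e (Complex R T) / (\<i> * z)
           = (Q T - Q 0) - (F (Complex X T) - F (Complex X 0))"
        proof -
          have "\<i> * E (of_real R) * e (of_real R) / z = - (E (of_real R) * e (Complex R 0) / (\<i> * z))"
            by (simp add: complex_of_real_def divide_inverse)
          thus ?thesis by (simp add: Q_def top_def complex_of_real_def)
        qed
        also have "norm \<dots> \<le> norm (Q T - Q 0) + norm (F (Complex X T) - F (Complex X 0))"
          by (rule norm_triangle_ineq4)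
        also have "\<dots> \<le> 4 * K / y\<^sup>2 + 2 * B * exp (- (\<epsilon> / 2) * X)"
          by (intro add_mono left right elim X)
        finally show ?case .
      qed
      ultimately have "norm ((F (of_real X) - F (of_real R)) - \<i> * E (of_real R) * e (of_real R) / z - 0 - 0)
          \<le> 4 * K / y\<^sup>2 + 2 * B * exp (- (\<epsilon> / 2) * X)"
        by (rule Lim_norm_ubound[OF trivial_limit_at_top_linorder])
      thus ?thesis unfolding FTC by simp
    qed
    \<comment> \<open>B comes from the growth bound with rate \<epsilon> / 2 and so depends on
      \<epsilon>; this is why D is chosen after \<epsilon>.\<close>
    show "\<exists>D. \<forall>X\<ge>R. norm (integral {R..X} (\<lambda>x. E (of_real x) * exp (\<i> * Complex y \<epsilon> * of_real x))
        - \<i> * E (of_real R) * exp (\<i> * Complex y \<epsilon> * of_real R) / Complex y \<epsilon>)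
      \<le> 4 * K / y\<^sup>2 + D * exp (- (\<epsilon> / 2) * X)"
      using main unfolding e_def z_def by (intro exI[of _ "2 * B"]) auto
  qed
qed

text \<open>Two integrations by parts on a compact real segment, where the derivatives of E are
  bounded. This covers the stretch between the band edge and an abscissa to the right of all cuts,
  over which the contour cannot be lifted. The boundary term at R is the one of
  \<open>oscillatory_tail_bound\<close> with opposite sign.\<close>

lemma oscillatory_segment_bound:
  fixes E :: "complex \<Rightarrow> complex" and r R :: real
  assumes holo: "E holomorphic_on A" and A: "open A" "of_real ` {r..R} \<subseteq> A" and r: "0 \<le> r" "r \<le> R"
  shows "\<exists>K. \<forall>y \<epsilon>. 1 \<le> y \<and> 0 < \<epsilon> \<and> \<epsilon> \<le> 1 \<longrightarrow>
    norm (integral {r..R} (\<lambda>x. E (of_real x) * exp (\<i> * Complex y \<epsilon> * of_real x))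
        - (\<i> * E (of_real r) * exp (\<i> * Complex y \<epsilon> * of_real r) / Complex y \<epsilon>
           - \<i> * E (of_real R) * exp (\<i> * Complex y \<epsilon> * of_real R) / Complex y \<epsilon>)) \<le> K / y\<^sup>2"
proof -
  define E1 where "E1 = deriv E"
  define E2 where "E2 = deriv E1"
  have h1: "E1 holomorphic_on A" unfolding E1_def by (rule holomorphic_deriv[OF holo A(1)])
  have h2: "E2 holomorphic_on A" unfolding E2_def by (rule holomorphic_deriv[OF h1 A(1)])
  have DE: "(E has_field_derivative E1 (of_real x)) (at (of_real x))" 
    and DE1: "(E1 has_field_derivative E2 (of_real x)) (at (of_real x))" if "x \<in> {r..R}" for x
  proof -
    have "of_real x \<in> A" using A(2) that by blast
    thus "(E has_field_derivative E1 (of_real x)) (at (of_real x))"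
      "(E1 has_field_derivative E2 (of_real x)) (at (of_real x))"
      unfolding E1_def E2_def
      by (auto intro: holomorphic_derivI[OF holo A(1)] holomorphic_derivI[OF h1[unfolded E1_def] A(1)])
  qed
  have cont: "continuous_on {r..R} (\<lambda>x. H (of_real x))" if "H holomorphic_on A" for H :: "complex \<Rightarrow> complex"
  proof -
    have "continuous_on (of_real ` {r..R}) H"
      using holomorphic_on_imp_continuous_on[OF that] A(2) by (rule continuous_on_subset)
    thus ?thesis by (rule continuous_on_compose2) (auto intro!: continuous_intros)
  qed
  have bdd: "\<exists>M>0. \<forall>x\<in>{r..R}. norm (H (of_real x)) \<le> M" if "H holomorphic_on A" for H :: "complex \<Rightarrow> complex"
  proof -
    have "bounded ((\<lambda>x. H (of_real x)) ` {r..R})"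
      using cont[OF that] by (intro compact_imp_bounded compact_continuous_image) auto
    thus ?thesis unfolding bounded_pos by auto
  qed
  obtain M1 where M1: "0 < M1" "\<And>x. x \<in> {r..R} \<Longrightarrow> norm (E1 (of_real x)) \<le> M1" using bdd[OF h1] by blast
  obtain M2 where M2: "0 < M2" "\<And>x. x \<in> {r..R} \<Longrightarrow> norm (E2 (of_real x)) \<le> M2" using bdd[OF h2] by blast
  show ?thesis
  proof (intro exI[of _ "2 * M1 + M2 * (R - r)"] allI impI, elim conjE)
    fix y \<epsilon> :: real assume y: "1 \<le> y" and \<epsilon>: "0 < \<epsilon>" "\<epsilon> \<le> 1"
    define z where "z = Complex y \<epsilon>"
    have z0: "z \<noteq> 0" using y by (auto simp: z_def complex_eq_iff)
    have zy: "y\<^sup>2 \<le> norm (z\<^sup>2)"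
      using y abs_Re_le_cmod[of z] unfolding norm_power by (intro power_mono) (auto simp: z_def)
    define e where "e = (\<lambda>x::real. exp (\<i> * z * of_real x))"
    have ne: "norm (e x) \<le> 1" if "x \<in> {r..R}" for x
      unfolding e_def z_def norm_exp_i_Complex using that r \<epsilon> by simp
    \<comment> \<open>Determined by i z c1 = 1 and c1 + i z c2 = 0: then the derivative of G is the
      integrand plus a remainder with E'' and the factor \<open>1 / z\<^sup>2\<close>.\<close>
    define c1 c2 where "c1 = - \<i> / z" and "c2 = 1 / z\<^sup>2"
    define G where "G = (\<lambda>u. (c1 * E u + c2 * E1 u) * exp (\<i> * z * u))"
    have DG: "(G has_field_derivative (E (of_real x) * e x + E2 (of_real x) * e x / z\<^sup>2)) (at (of_real x))"
      if "x \<in> {r..R}" for x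
    proof -
      have "(G has_field_derivative (c1 * E1 (of_real x) + c2 * E2 (of_real x)) * e x
          + (\<i> * z * e x) * (c1 * E (of_real x) + c2 * E1 (of_real x))) (at (of_real x))"
        unfolding G_def e_def
        by (auto intro!: derivative_eq_intros DE[OF that] DE1[OF that])
      also have "(c1 * E1 (of_real x) + c2 * E2 (of_real x)) * e x
          + (\<i> * z * e x) * (c1 * E (of_real x) + c2 * E1 (of_real x))
          = E (of_real x) * e x * (\<i> * (z * c1)) + E1 (of_real x) * e x * (c1 + \<i> * (z * c2))
            + E2 (of_real x) * e x * c2"
        by (simp add: algebra_simps)
      also have "z * c1 = - \<i>" using z0 by (simp add: c1_def)
      also have "c1 + \<i> * (z * c2) = 0" using z0 by (simp add: c1_def c2_def power2_eq_square)
      also have "E (of_real x) * e x * (\<i> * (- \<i>)) + E1 (of_real x) * e x * 0 + E2 (of_real x) * e x * c2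
          = E (of_real x) * e x + E2 (of_real x) * e x / z\<^sup>2"
        by (simp add: c2_def)
      finally show ?thesis .
    qed
    have "((\<lambda>x. E (of_real x) * e x + E2 (of_real x) * e x / z\<^sup>2) has_integral G (of_real R) - G (of_real r)) {r..R}"
    proof (rule fundamental_theorem_of_calculus[OF r(2)])
      fix x assume x: "x \<in> {r..R}"
      have "((G \<circ> of_real) has_vector_derivative 1 * (E (of_real x) * e x + E2 (of_real x) * e x / z\<^sup>2)) (at x within {r..R})"
        using x by (intro field_vector_diff_chain_within has_field_derivative_at_within[OF DG])
             (auto intro!: derivative_eq_intros)
      thus "((\<lambda>x. G (of_real x)) has_vector_derivative E (of_real x) * e x + E2 (of_real x) * e x / z\<^sup>2) (at x within {r..R})"
        by (simp add: o_def)
    qed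
    moreover have i2: "(\<lambda>x. E2 (of_real x) * e x / z\<^sup>2) integrable_on {r..R}"
      unfolding e_def using z0 by (intro integrable_continuous_interval continuous_intros cont h2) auto
    ultimately have "((\<lambda>x. E (of_real x) * e x + E2 (of_real x) * e x / z\<^sup>2 - E2 (of_real x) * e x / z\<^sup>2)
        has_integral G (of_real R) - G (of_real r) - integral {r..R} (\<lambda>x. E2 (of_real x) * e x / z\<^sup>2)) {r..R}"
      by (intro has_integral_diff integrable_integral) auto
    hence int: "integral {r..R} (\<lambda>x. E (of_real x) * e x)
        = G (of_real R) - G (of_real r) - integral {r..R} (\<lambda>x. E2 (of_real x) * e x / z\<^sup>2)"
      by (simp add: integral_unique)
    have n2: "norm (c / z\<^sup>2) \<le> M / y\<^sup>2" if "norm c \<le> M" for c M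
      unfolding norm_divide using that zy y by (intro frac_le) (auto intro: order_trans[OF norm_ge_zero])
    have I2: "norm (integral {r..R} (\<lambda>x. E2 (of_real x) * e x / z\<^sup>2)) \<le> M2 / y\<^sup>2 * (R - r)"
    proof (rule integral_bound[OF r(2)])
      show "continuous_on {r..R} (\<lambda>x. E2 (of_real x) * e x / z\<^sup>2)"
        unfolding e_def using z0 by (intro continuous_intros cont h2) auto
      show "norm (E2 (of_real x) * e x / z\<^sup>2) \<le> M2 / y\<^sup>2" if "x \<in> {r..R}" for x
        using mult_mono[OF M2(2)[OF that] ne[OF that]] M2(1) by (intro n2) (simp add: norm_mult)
    qed
    have b: "norm (E1 (of_real x) * e x / z\<^sup>2) \<le> M1 / y\<^sup>2" if "x \<in> {r..R}" for x
      using mult_mono[OF M1(2)[OF that] ne[OF that]] M1(1) by (intro n2) (simp add: norm_mult)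
    have "integral {r..R} (\<lambda>x. E (of_real x) * e x) - (\<i> * E (of_real r) * e r / z - \<i> * E (of_real R) * e R / z)
      = E1 (of_real R) * e R / z\<^sup>2 - E1 (of_real r) * e r / z\<^sup>2 - integral {r..R} (\<lambda>x. E2 (of_real x) * e x / z\<^sup>2)"
      unfolding int by (simp add: G_def e_def c1_def c2_def distrib_right left_diff_distrib)
    also have "norm \<dots> \<le> norm (E1 (of_real R) * e R / z\<^sup>2) + norm (E1 (of_real r) * e r / z\<^sup>2)
         + norm (integral {r..R} (\<lambda>x. E2 (of_real x) * e x / z\<^sup>2))"
      by (intro order_trans[OF norm_triangle_ineq4] add_mono norm_triangle_ineq4 order_refl)
    also have "\<dots> \<le> M1 / y\<^sup>2 + M1 / y\<^sup>2 + M2 / y\<^sup>2 * (R - r)"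
      using r by (intro add_mono b I2) auto
    also have "\<dots> = (2 * M1 + M2 * (R - r)) / y\<^sup>2" by (simp add: add_divide_distrib)
    finally show "norm (integral {r..R} (\<lambda>x. E (of_real x) * exp (\<i> * Complex y \<epsilon> * of_real x))
        - (\<i> * E (of_real r) * exp (\<i> * Complex y \<epsilon> * of_real r) / Complex y \<epsilon>
           - \<i> * E (of_real R) * exp (\<i> * Complex y \<epsilon> * of_real R) / Complex y \<epsilon>)) \<le> (2 * M1 + M2 * (R - r)) / y\<^sup>2"
      by (simp add: e_def z_def)
  qed
qed

text \<open>In the Abel sense, pi * h y is the real part of the integral of the transform times
  cis(u y) over u >= 0. The part up to r is the sine-kernel integral of h; the two oscillatory
  bounds evaluate the rest by its boundary term at r.\<close>

lemma band_limited_inversion: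
  fixes h :: "real \<Rightarrow> real" and r s q C :: real
  assumes h: "integrable lborel h"
    and ext: "\<And>x::real. E (of_real x) = fourier h (of_real x)"
    and holo: "E holomorphic_on A" and A: "open A" "range of_real \<subseteq> A" "{u. s < Re u} \<subseteq> A"
    and s: "0 \<le> s" and r: "0 \<le> r" and q: "0 < q" and C: "0 \<le> C"
    and growth: "\<And>u. s < Re u \<Longrightarrow> norm (E u) \<le> C * (1 + norm u powr q)"
  shows "\<exists>K. \<forall>y\<ge>1. isCont h y \<longrightarrow>
    \<bar>pi * h y - (LINT t|lborel. h t * (if y - t = 0 then r else sin (r * (y - t)) / (y - t)))
      - Re (\<i> * fourier h (of_real r) * cis (r * y) / of_real y)\<bar> \<le> K / y\<^sup>2"
proof -
  \<comment> \<open>Strictly to the right both of the band edge and of s, so that the half-plane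
    needed for the rotation is available from R on.\<close>
  define R where "R = max r s + 1"
  have R: "r < R" "s < R" "r \<le> R" by (auto simp: R_def)
  obtain K1 where K1: "\<And>y \<epsilon>. 1 \<le> y \<Longrightarrow> 0 < \<epsilon> \<Longrightarrow> \<epsilon> \<le> 1 \<Longrightarrow>
    norm (integral {r..R} (\<lambda>x. E (of_real x) * exp (\<i> * Complex y \<epsilon> * of_real x))
        - (\<i> * E (of_real r) * exp (\<i> * Complex y \<epsilon> * of_real r) / Complex y \<epsilon>
           - \<i> * E (of_real R) * exp (\<i> * Complex y \<epsilon> * of_real R) / Complex y \<epsilon>)) \<le> K1 / y\<^sup>2"
    using oscillatory_segment_bound[OF holo A(1) _ r R(3)] A(2) by blast
  obtain K2 where K2: "\<And>y \<epsilon>. 1 \<le> y \<Longrightarrow> 0 < \<epsilon> \<Longrightarrow> \<epsilon> \<le> 1 \<Longrightarrow>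
    \<exists>D. \<forall>X\<ge>R. norm (integral {R..X} (\<lambda>x. E (of_real x) * exp (\<i> * Complex y \<epsilon> * of_real x))
        - \<i> * E (of_real R) * exp (\<i> * Complex y \<epsilon> * of_real R) / Complex y \<epsilon>)
      \<le> K2 / y\<^sup>2 + D * exp (- (\<epsilon> / 2) * X)"
    using oscillatory_tail_bound[OF holomorphic_on_subset[OF holo A(3)] s R(2) q C growth] by blast
  show ?thesis
  proof (intro exI[of _ "K1 + K2"] allI impI)
    fix y :: real assume y: "1 \<le> y" and cont: "isCont h y"
    define qf where "qf = (\<lambda>u. Re (fourier h (of_real u) * cis (u * y)))"
    define e where "e = (\<lambda>\<epsilon> u. exp (\<i> * Complex y \<epsilon> * complex_of_real u))"
    define S0 where "S0 = (LINT t|lborel. h t * (if y - t = 0 then r else sin (r * (y - t)) / (y - t)))"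
    have band: "integrable lborel (indicator {0..r} :: real \<Rightarrow> real)"
      using r by (intro integrable_real_indicator) (auto simp: emeasure_lborel_Icc_eq)
    have S0: "(LINT u|lborel. indicator {0..r} u * qf u) = S0"
      unfolding qf_def fourier_fubini(2)[OF h band] S0_def integral_cos_band[OF r] ..
    have qint: "integrable lborel (\<lambda>u. indicator {0..r} u * qf u)"
      unfolding qf_def by (rule fourier_fubini(1)[OF h band])
    define Q where "Q = (LINT u|lborel. \<bar>indicator {0..r} u * qf u\<bar>)"
    have qE: "exp (- \<epsilon> * u) * qf u = Re (E (of_real u) * e \<epsilon> u)" for \<epsilon> u
    proof -
      have "e \<epsilon> u = of_real (exp (- \<epsilon> * u)) * cis (u * y)"
      proof -
        have "\<i> * Complex y \<epsilon> * of_real u = of_real (- \<epsilon> * u) + \<i> * of_real (u * y)"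
          by (simp add: complex_eq_iff)
        thus ?thesis by (simp only: e_def cis_conv_exp exp_of_real exp_add)
      qed
      thus ?thesis by (simp add: qf_def ext algebra_simps)
    qed
    have main: "\<bar>(LINT t|lborel. h t * (\<epsilon> / (\<epsilon>\<^sup>2 + (y - t)\<^sup>2))) - S0
        - Re (\<i> * E (of_real r) * e \<epsilon> r / Complex y \<epsilon>)\<bar> \<le> (K1 + K2) / y\<^sup>2 + \<epsilon> * (r * Q)"
      if \<epsilon>: "0 < \<epsilon>" "\<epsilon> \<le> 1" for \<epsilon>
    proof -
      let ?g = "\<lambda>u::real. indicator {0<..} u * exp (- \<epsilon> * u)"
      have gint: "integrable lborel ?g" by (rule integral_cos_exp(1)[OF \<epsilon>(1)])
      have gq: "integrable lborel (\<lambda>u. ?g u * qf u)"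
        unfolding qf_def by (rule fourier_fubini(1)[OF h gint])
      have tot: "(LINT u|lborel. ?g u * qf u) = (LINT t|lborel. h t * (\<epsilon> / (\<epsilon>\<^sup>2 + (y - t)\<^sup>2)))"
        unfolding qf_def fourier_fubini(2)[OF h gint] integral_cos_exp(2)[OF \<epsilon>(1)] ..
      have si: "set_integrable lborel {0<..} (\<lambda>u. exp (- \<epsilon> * u) * qf u)"
        using gq by (simp add: set_integrable_def mult.assoc)
      hence si_r: "set_integrable lborel {r<..} (\<lambda>u. exp (- \<epsilon> * u) * qf u)"
        and si_0: "set_integrable lborel {0<..r} (\<lambda>u. exp (- \<epsilon> * u) * qf u)"
        using r by (auto intro: set_integrable_subset)
      have un: "{0<..r} \<union> {r<..} = {0<..}" using r by auto
      have dj: "{0<..r} \<inter> {r<..} = {}" by auto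
      have split: "(LINT u|lborel. ?g u * qf u) = (LINT u:{0<..r}|lborel. exp (- \<epsilon> * u) * qf u)
           + (LINT u:{r<..}|lborel. exp (- \<epsilon> * u) * qf u)"
        using set_integral_Un[OF dj si_0 si_r] unfolding un
        by (simp add: set_lebesgue_integral_def mult.assoc)
      \<comment> \<open>On the band the damping factor differs from 1 by at most \<epsilon> r, an
        error that disappears with \<epsilon>.\<close>
      have first: "\<bar>(LINT u:{0<..r}|lborel. exp (- \<epsilon> * u) * qf u) - S0\<bar> \<le> \<epsilon> * (r * Q)"
      proof -
        have "(LINT u:{0<..r}|lborel. exp (- \<epsilon> * u) * qf u) = (LINT u|lborel. indicator {0..r} u * (exp (- \<epsilon> * u) * qf u))"
          unfolding set_lebesgue_integral_def
          by (intro integral_discrete_difference[where X = "{0}"]) (auto simp: indicator_def)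
        moreover have i: "integrable lborel (\<lambda>u. indicator {0..r} u * (exp (- \<epsilon> * u) * qf u))"
          using si_0 unfolding set_integrable_def
          by (rule integrable_discrete_difference[where X = "{0}", THEN iffD1, rotated -1]) (auto simp: indicator_def)
        ultimately have eq: "(LINT u:{0<..r}|lborel. exp (- \<epsilon> * u) * qf u) - S0
           = (LINT u|lborel. indicator {0..r} u * (exp (- \<epsilon> * u) * qf u) - indicator {0..r} u * qf u)"
          using qint S0 by simp
        have "\<bar>(LINT u:{0<..r}|lborel. exp (- \<epsilon> * u) * qf u) - S0\<bar>
            \<le> (LINT u|lborel. \<bar>indicator {0..r} u * (exp (- \<epsilon> * u) * qf u) - indicator {0..r} u * qf u\<bar>)"
          unfolding eq by (rule integral_abs_bound)
        also have "\<dots> \<le> (LINT u|lborel. \<epsilon> * r * \<bar>indicator {0..r} u * qf u\<bar>)"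
        proof (rule integral_mono)
          show "integrable lborel (\<lambda>u. \<bar>indicator {0..r} u * (exp (- \<epsilon> * u) * qf u) - indicator {0..r} u * qf u\<bar>)"
            by (rule integrable_abs[OF Bochner_Integration.integrable_diff[OF i qint]])
          show "integrable lborel (\<lambda>u. \<epsilon> * r * \<bar>indicator {0..r} u * qf u\<bar>)"
            by (rule integrable_mult_right[OF integrable_abs[OF qint]])
          fix u :: real
          show "\<bar>indicator {0..r} u * (exp (- \<epsilon> * u) * qf u) - indicator {0..r} u * qf u\<bar>
            \<le> \<epsilon> * r * \<bar>indicator {0..r} u * qf u\<bar>"
          proof (cases "u \<in> {0..r}")
            case True
            have "exp (- \<epsilon> * u) \<le> 1" using True \<epsilon> by simp
            moreover have "1 - \<epsilon> * u \<le> exp (- \<epsilon> * u)" using exp_ge_add_one_self[of "- \<epsilon> * u"] by simp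
            moreover have "\<epsilon> * u \<le> \<epsilon> * r" using True \<epsilon> by simp
            ultimately have "\<bar>exp (- \<epsilon> * u) - 1\<bar> \<le> \<epsilon> * r" by linarith
            hence "\<bar>exp (- \<epsilon> * u) - 1\<bar> * \<bar>qf u\<bar> \<le> \<epsilon> * r * \<bar>qf u\<bar>"
              by (rule mult_right_mono) simp
            hence "\<bar>exp (- \<epsilon> * u) * qf u - qf u\<bar> \<le> \<epsilon> * r * \<bar>qf u\<bar>"
              by (simp only: abs_mult[symmetric] left_diff_distrib mult_1_left)
            thus ?thesis using True by simp
          qed simp
        qed
        also have "\<dots> = \<epsilon> * (r * Q)" by (simp add: Q_def)
        finally show ?thesis .
      qed
      have second: "\<bar>(LINT u:{r<..}|lborel. exp (- \<epsilon> * u) * qf u) - Re (\<i> * E (of_real r) * e \<epsilon> r / Complex y \<epsilon>)\<bar>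
          \<le> (K1 + K2) / y\<^sup>2"
      proof -
        have ae: "(LINT u:{r<..}|lborel. exp (- \<epsilon> * u) * qf u) = (LINT u:{r..}|lborel. exp (- \<epsilon> * u) * qf u)"
          unfolding set_lebesgue_integral_def
          by (intro integral_discrete_difference[where X = "{r}"]) (auto simp: indicator_def)
        have si_r': "set_integrable lborel {r..} (\<lambda>u. exp (- \<epsilon> * u) * qf u)"
          using si_r unfolding set_integrable_def
          by (rule integrable_discrete_difference[where X = "{r}", THEN iffD1, rotated -1]) (auto simp: indicator_def)
        obtain D where D: "\<And>X. R \<le> X \<Longrightarrow> norm (integral {R..X} (\<lambda>x. E (of_real x) * e \<epsilon> x)
            - \<i> * E (of_real R) * e \<epsilon> R / Complex y \<epsilon>) \<le> K2 / y\<^sup>2 + D * exp (- (\<epsilon> / 2) * X)"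
          using K2[OF y \<epsilon>] unfolding e_def by blast
        have bdX: "\<bar>(LINT u:{r..X}|lborel. exp (- \<epsilon> * u) * qf u) - Re (\<i> * E (of_real r) * e \<epsilon> r / Complex y \<epsilon>)\<bar>
           \<le> (K1 + K2) / y\<^sup>2 + D * exp (- (\<epsilon> / 2) * X)" if X: "R \<le> X" for X
        proof -
          have "continuous_on UNIV (\<lambda>x. E (complex_of_real x))"
            using continuous_on_compose2[OF holomorphic_on_imp_continuous_on[OF holo], of UNIV complex_of_real] A(2)
            by (auto intro: continuous_intros)
          hence io: "(\<lambda>x. E (of_real x) * e \<epsilon> x) integrable_on {c..d}" for c d
            unfolding e_def
            by (intro integrable_continuous_interval continuous_intros) (auto intro: continuous_on_subset)
          have "set_integrable lborel {r..X} (\<lambda>u. exp (- \<epsilon> * u) * qf u)"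
            using si_r' by (rule set_integrable_subset) auto
          from set_borel_integral_eq_integral(2)[OF this]
          have "(LINT u:{r..X}|lborel. exp (- \<epsilon> * u) * qf u) = integral {r..X} (\<lambda>u. Re (E (of_real u) * e \<epsilon> u))"
            unfolding qE by simp
          also have "\<dots> = Re (integral {r..X} (\<lambda>u. E (of_real u) * e \<epsilon> u))"
            using integral_linear[OF io bounded_linear_Re] by (simp add: o_def)
          also have "integral {r..X} (\<lambda>u. E (of_real u) * e \<epsilon> u)
              = integral {r..R} (\<lambda>u. E (of_real u) * e \<epsilon> u) + integral {R..X} (\<lambda>u. E (of_real u) * e \<epsilon> u)"
            using Henstock_Kurzweil_Integration.integral_combine[OF R(3) X io] by simp
          finally have eq: "(LINT u:{r..X}|lborel. exp (- \<epsilon> * u) * qf u) = Re \<dots>" .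
          let ?b = "\<lambda>x. \<i> * E (of_real x) * e \<epsilon> x / Complex y \<epsilon>"
          have eq2: "(LINT u:{r..X}|lborel. exp (- \<epsilon> * u) * qf u) - Re (?b r)
             = Re ((integral {r..R} (\<lambda>u. E (of_real u) * e \<epsilon> u) - (?b r - ?b R))
                  + (integral {R..X} (\<lambda>u. E (of_real u) * e \<epsilon> u) - ?b R))"
            unfolding eq by simp
          have "\<bar>(LINT u:{r..X}|lborel. exp (- \<epsilon> * u) * qf u) - Re (?b r)\<bar> \<le> norm (integral {r..R} (\<lambda>u. E (of_real u) * e \<epsilon> u) - (?b r - ?b R))
                  + norm (integral {R..X} (\<lambda>u. E (of_real u) * e \<epsilon> u) - ?b R)"
            unfolding eq2 by (rule order_trans[OF abs_Re_le_cmod norm_triangle_ineq])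
          also have "\<dots> \<le> K1 / y\<^sup>2 + (K2 / y\<^sup>2 + D * exp (- (\<epsilon> / 2) * X))"
            using K1[OF y \<epsilon>] D[OF X] by (intro add_mono) (auto simp: e_def)
          finally show ?thesis by (simp add: add_divide_distrib)
        qed
        \<comment> \<open>X tends to infinity at fixed \<epsilon>, which removes the term with D
          however D depends on \<epsilon>.\<close>
        have lim1: "((\<lambda>X. \<bar>(LINT u:{r..X}|lborel. exp (- \<epsilon> * u) * qf u) - Re (\<i> * E (of_real r) * e \<epsilon> r / Complex y \<epsilon>)\<bar>)
          \<longlongrightarrow> \<bar>(LINT u:{r..}|lborel. exp (- \<epsilon> * u) * qf u) - Re (\<i> * E (of_real r) * e \<epsilon> r / Complex y \<epsilon>)\<bar>) at_top"
          by (intro tendsto_intros tendsto_set_lebesgue_integral_at_top si_r') auto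
        have "((\<lambda>X. exp (- (\<epsilon> / 2) * X)) \<longlongrightarrow> 0) at_top" using \<epsilon> by real_asymp
        hence "((\<lambda>X. (K1 + K2) / y\<^sup>2 + D * exp (- (\<epsilon> / 2) * X)) \<longlongrightarrow> (K1 + K2) / y\<^sup>2 + D * 0) at_top"
          by (intro tendsto_intros)
        moreover have "\<forall>\<^sub>F X in at_top. \<bar>(LINT u:{r..X}|lborel. exp (- \<epsilon> * u) * qf u)
            - Re (\<i> * E (of_real r) * e \<epsilon> r / Complex y \<epsilon>)\<bar> \<le> (K1 + K2) / y\<^sup>2 + D * exp (- (\<epsilon> / 2) * X)"
          using eventually_ge_at_top[of R] by eventually_elim (rule bdX)
        ultimately show ?thesis
          unfolding ae using tendsto_le[OF trivial_limit_at_top_linorder _ lim1] by fastforce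
      qed
      show ?thesis using first second unfolding tot[symmetric] split by linarith
    qed
    \<comment> \<open>Now \<epsilon> tends to 0: the Poisson integral tends to pi * h y by
      continuity at y, and K1 + K2 is unaffected.\<close>
    have "((\<lambda>\<epsilon>. Re (\<i> * E (of_real r) * e \<epsilon> r / Complex y \<epsilon>))
        \<longlongrightarrow> Re (\<i> * E (of_real r) * e 0 r / Complex y 0)) (at_right 0)"
      unfolding e_def using y by (intro tendsto_intros) (auto simp: complex_eq_iff)
    hence lim: "((\<lambda>\<epsilon>. \<bar>(LINT t|lborel. h t * (\<epsilon> / (\<epsilon>\<^sup>2 + (y - t)\<^sup>2))) - S0
        - Re (\<i> * E (of_real r) * e \<epsilon> r / Complex y \<epsilon>)\<bar>)
        \<longlongrightarrow> \<bar>pi * h y - S0 - Re (\<i> * E (of_real r) * e 0 r / Complex y 0)\<bar>) (at_right 0)"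
      by (intro tendsto_rabs tendsto_diff tendsto_const poisson_kernel_tendsto[OF h cont])
    have "((\<lambda>\<epsilon>. (K1 + K2) / y\<^sup>2 + \<epsilon> * (r * Q)) \<longlongrightarrow> (K1 + K2) / y\<^sup>2 + 0 * (r * Q)) (at_right 0)"
      by (intro tendsto_intros)
    moreover have "\<forall>\<^sub>F \<epsilon> in at_right 0. \<bar>(LINT t|lborel. h t * (\<epsilon> / (\<epsilon>\<^sup>2 + (y - t)\<^sup>2))) - S0
        - Re (\<i> * E (of_real r) * e \<epsilon> r / Complex y \<epsilon>)\<bar> \<le> (K1 + K2) / y\<^sup>2 + \<epsilon> * (r * Q)"
      using eventually_at_right_real[OF zero_less_one] by eventually_elim (intro main, auto)
    ultimately have "\<bar>pi * h y - S0 - Re (\<i> * E (of_real r) * e 0 r / Complex y 0)\<bar> \<le> (K1 + K2) / y\<^sup>2 + 0 * (r * Q)"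
      using lim by (intro tendsto_le[OF trivial_limit_at_right_real])
    moreover have "e 0 r = cis (r * y)" "Complex y 0 = of_real y"
      by (simp_all add: e_def cis_conv_exp complex_of_real_def[symmetric] mult_ac)
    ultimately show "\<bar>pi * h y - (LINT t|lborel. h t * (if y - t = 0 then r else sin (r * (y - t)) / (y - t)))
      - Re (\<i> * fourier h (of_real r) * cis (r * y) / of_real y)\<bar> \<le> (K1 + K2) / y\<^sup>2"
      by (simp add: S0_def ext)
  qed
qed

section \<open>Payoff coefficients\<close>

text \<open>Brings the Shannon function into the form of the kernel of
  \<open>integral_cos_band\<close>, centred at the grid point; nsinc is even, so the order of the
  difference does not matter.\<close>

lemma shannon_eq:
  "shannon m k t = 2 powr (- real_of_int m / 2) / pi *
    (if grid m k - t = 0 then 2 powi m * pi else sin (2 powi m * pi * (grid m k - t)) / (grid m k - t))"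
proof -
  define w where "w = (2::real) powi m"
  have w: "0 < w" by (simp add: w_def)
  have "2 powr (real_of_int m / 2) = 2 powr (- real_of_int m / 2) * 2 powr real_of_int m"
    by (simp flip: powr_add)
  also have "2 powr real_of_int m = w" by (subst powr_real_of_int') (auto simp: w_def)
  finally have s: "2 powr (real_of_int m / 2) = 2 powr (- real_of_int m / 2) * w" .
  have a: "w * t - real_of_int k = - w * (grid m k - t)"
    using w by (simp add: grid_def w_def[symmetric] field_simps)
  show ?thesis
  proof (cases "grid m k - t = 0")
    case True
    thus ?thesis unfolding shannon_def nsinc_def w_def[symmetric] a s by simp
  next
    case False
    hence nz: "- w * (grid m k - t) \<noteq> 0" using w by simp
    have "sin (pi * (- w * (grid m k - t))) = - sin (w * pi * (grid m k - t))"
      by (simp add: mult_ac)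
    thus ?thesis using nz False w unfolding shannon_def nsinc_def w_def[symmetric] a s
      by (simp add: field_simps)
  qed
qed

text \<open>At a grid point y the product of the band edge \<open>2 powi m * pi\<close> and y is k *
  pi, so the oscillating factor of the boundary term is 1 or -1. Multiplied by i, only the imaginary
  part of the transform survives in the real part; this is the origin of \<epsilon>V.\<close>

lemma shannon_coeff_bound:
  fixes h :: "real \<Rightarrow> real"
  assumes h: "integrable lborel h"
    and ext: "\<And>x::real. E (of_real x) = fourier h (of_real x)"
    and holo: "E holomorphic_on A" and A: "open A" "range of_real \<subseteq> A" "{u. s < Re u} \<subseteq> A"
    and s: "0 \<le> s" and q: "0 < q" and C: "0 \<le> C"
    and growth: "\<And>u. s < Re u \<Longrightarrow> norm (E u) \<le> C * (1 + norm u powr q)"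
  shows "\<exists>K. \<forall>k. 1 \<le> grid m k \<longrightarrow> isCont h (grid m k) \<longrightarrow>
    \<bar>LINT t|lborel. h t * shannon m k t\<bar> \<le> 2 powr (- real_of_int m / 2) *
      (\<bar>h (grid m k)\<bar> + \<bar>Im (fourier h (of_real (2 powi m * pi)))\<bar> / pi / grid m k + K / (grid m k)\<^sup>2)"
proof -
  define r where "r = (2::real) powi m * pi"
  have r: "0 \<le> r" by (simp add: r_def)
  obtain K where K: "\<And>y. 1 \<le> y \<Longrightarrow> isCont h y \<Longrightarrow>
    \<bar>pi * h y - (LINT t|lborel. h t * (if y - t = 0 then r else sin (r * (y - t)) / (y - t)))
      - Re (\<i> * fourier h (of_real r) * cis (r * y) / of_real y)\<bar> \<le> K / y\<^sup>2"
    using band_limited_inversion[OF h ext holo A s r q C growth] by blast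
  show ?thesis
  proof (intro exI[of _ "K / pi"] allI impI)
    fix k assume y1: "1 \<le> grid m k" and c: "isCont h (grid m k)"
    define y where "y = grid m k"
    have y: "1 \<le> y" using y1 by (simp add: y_def)
    define S where "S = (LINT t|lborel. h t * (if y - t = 0 then r else sin (r * (y - t)) / (y - t)))"
    have int: "(LINT t|lborel. h t * shannon m k t) = 2 powr (- real_of_int m / 2) / pi * S"
      unfolding S_def y_def r_def shannon_eq
      by (subst integral_mult_right_zero[symmetric]) (simp add: mult_ac)
    have ry: "r * y = of_int k * pi" by (simp add: r_def y_def grid_def)
    define X where "X = Re (\<i> * fourier h (of_real r) * cis (r * y) / of_real y)"
    have "X = - Im (fourier h (of_real r)) * cos (of_int k * pi) / y"
    proof -
      have "sin (of_int k * pi) = 0" unfolding sin_zero_iff_int2 by blast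
      thus ?thesis unfolding X_def ry by (simp add: Re_divide_of_real)
    qed
    hence "\<bar>X\<bar> \<le> \<bar>Im (fourier h (of_real r))\<bar> / y"
      using y by (auto simp: abs_mult intro!: divide_right_mono mult_left_le)
    hence "\<bar>S\<bar> \<le> pi * \<bar>h y\<bar> + \<bar>Im (fourier h (of_real r))\<bar> / y + K / y\<^sup>2"
      using K[OF y] c abs_mult[of pi "h y"] unfolding S_def[symmetric] y_def[symmetric] X_def[symmetric] by simp
    hence "\<bar>S\<bar> / pi \<le> (pi * \<bar>h y\<bar> + \<bar>Im (fourier h (of_real r))\<bar> / y + K / y\<^sup>2) / pi"
      by (rule divide_right_mono) simp
    hence "\<bar>S\<bar> / pi \<le> \<bar>h y\<bar> + \<bar>Im (fourier h (of_real r))\<bar> / pi / y + K / pi / y\<^sup>2"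
      by (simp add: add_divide_distrib mult.commute)
    from mult_left_mono[OF this, of "2 powr (- real_of_int m / 2)"]
    show "\<bar>LINT t|lborel. h t * shannon m k t\<bar> \<le> 2 powr (- real_of_int m / 2) *
      (\<bar>h (grid m k)\<bar> + \<bar>Im (fourier h (of_real (2 powi m * pi)))\<bar> / pi / grid m k + K / pi / (grid m k)\<^sup>2)"
      unfolding int by (simp add: abs_mult y_def r_def)
  qed
qed

text \<open>A cut together with its branch point is a closed vertical half-line, directed away from
  the real axis if the branch point is not real. In this form closedness, and disjointness from the
  real axis and from far half-planes, can be read off.\<close>

lemma insert_branch_cut:
  "insert u0 (branch_cut u0) = {u. Re u = Re u0 \<and> 0 \<le> sgn1 (Im u0) * (Im u - Im u0)}"
proof -
  have sg: "sgn1 x * sgn1 x = 1" for x by (simp add: sgn1_def)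
  have "u \<in> insert u0 (branch_cut u0)" if "Re u = Re u0" "0 \<le> sgn1 (Im u0) * (Im u - Im u0)" for u
  proof (cases "u = u0")
    case False
    define t where "t = sgn1 (Im u0) * (Im u - Im u0)"
    have "t \<noteq> 0" using False that(1) by (auto simp: t_def sgn1_def complex_eq_iff split: if_splits)
    moreover have "0 \<le> t" using that(2) by (simp only: t_def)
    ultimately have "0 < t" by simp
    moreover have "u = u0 + of_real (sgn1 (Im u0)) * cis (pi / 2) * of_real t"
      using that(1) sg[of "Im u0"] by (simp add: complex_eq_iff t_def flip: mult.assoc)
    ultimately show ?thesis unfolding branch_cut_def ray_def by blast
  qed simp
  moreover have "Re u = Re u0 \<and> 0 \<le> sgn1 (Im u0) * (Im u - Im u0)" if "u \<in> insert u0 (branch_cut u0)" for u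
    using that sg[of "Im u0"] by (auto simp: branch_cut_def ray_def simp flip: mult.assoc)
  ultimately show ?thesis by blast
qed

lemma open_slit_plane: "finite W \<Longrightarrow> open (slit_plane W)"
proof -
  assume W: "finite W"
  have "closed (insert u0 (branch_cut u0))" for u0
    unfolding insert_branch_cut
    by (intro closed_Collect_conj closed_Collect_eq closed_Collect_le continuous_intros)
  thus ?thesis unfolding slit_plane_def using W by (intro open_Diff closed_UN) auto
qed

lemma slit_plane_antimono: "V \<subseteq> W \<Longrightarrow> slit_plane W \<subseteq> slit_plane V"
  unfolding slit_plane_def by blast

lemma holomorphic_branch_points:
  assumes "has_branch_points Z N w \<rho>"
  shows "Z holomorphic_on slit_plane (w ` {..<N})"
proof -
  obtain lg A G where lg: "\<And>n. n < N \<Longrightarrow> log_branch (w n) (lg n)" and A: "A \<subseteq> {..<N}"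
    and G: "G holomorphic_on slit_plane (w ` ({..<N} - A))"
    and Z: "\<And>u. u \<in> slit_plane (w ` {..<N}) \<Longrightarrow> Z u = G u * (\<Prod>n\<in>A. exp (- \<rho> n * lg n u))"
    using assms unfolding has_branch_points_def by blast
  have "G holomorphic_on slit_plane (w ` {..<N})"
    by (rule holomorphic_on_subset[OF G]) (intro slit_plane_antimono, auto)
  moreover have "lg n holomorphic_on slit_plane (w ` {..<N})" if "n \<in> A" for n
  proof (rule holomorphic_on_subset)
    show "lg n holomorphic_on slit_plane {w n}" using lg[of n] that A by (auto simp: log_branch_def)
  qed (intro slit_plane_antimono, use that A in auto)
  ultimately have "(\<lambda>u. G u * (\<Prod>n\<in>A. exp (- \<rho> n * lg n u))) holomorphic_on slit_plane (w ` {..<N})"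
    by (intro holomorphic_intros) auto
  thus ?thesis by (rule holomorphic_transform) (use Z in auto)
qed

text \<open>There are finitely many branch points and their cuts are vertical, so all cuts lie in a
  strip around the imaginary axis. Its half-width s is also at least the threshold R0 of the growth
  bound, and the modulus of u is at least that of Re u.\<close>

lemma assumption_A_extension:
  assumes "assumption_A h a b g g'"
  obtains E A s q C where "E holomorphic_on A" "open A" "range of_real \<subseteq> A"
    "{u. s < Re u} \<subseteq> A" "{u. Re u < - s} \<subseteq> A" "0 \<le> s" "0 < q" "0 \<le> (C::real)"
    "\<And>x::real. E (of_real x) = fourier h (of_real x)"
    "\<And>u. s < \<bar>Re u\<bar> \<Longrightarrow> norm (E u) \<le> C * (1 + norm u powr q)"
proof -
  have "\<exists>N w \<rho> Z H E. (\<forall>n<N. Im (w n) \<noteq> 0 \<and> \<rho> n \<noteq> 0) \<and> has_branch_points Z N w \<rho> \<and>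
      H holomorphic_on UNIV \<and> (\<forall>u\<in>slit_plane (w ` {..<N}). E u = Z u + H u) \<and>
      (\<forall>x::real. E (of_real x) = fourier h (of_real x)) \<and>
      (\<exists>C>0. \<exists>q>0. \<exists>R\<^sub>0. \<forall>u\<in>slit_plane (w ` {..<N}).
           R\<^sub>0 \<le> norm u \<longrightarrow> norm (E u) \<le> C * (1 + norm u powr q))"
    using assms unfolding assumption_A_def
    by (elim conjE, elim ex_forward) (elim conjE, intro conjI; assumption)
  then obtain N w Z H E C q R0 and \<rho> :: "nat \<Rightarrow> complex" where im: "\<And>n. n < N \<Longrightarrow> Im (w n) \<noteq> 0"
    and bp: "has_branch_points Z N w \<rho>" and H: "H holomorphic_on UNIV"
    and E: "\<And>u. u \<in> slit_plane (w ` {..<N}) \<Longrightarrow> E u = Z u + H u"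
    and four: "\<And>x::real. E (of_real x) = fourier h (of_real x)"
    and C: "0 < C" "0 < q" and gr: "\<And>u. u \<in> slit_plane (w ` {..<N}) \<Longrightarrow> R0 \<le> norm u \<Longrightarrow>
        norm (E u) \<le> C * (1 + norm u powr q)"
    by (elim exE conjE) metis
  let ?A = "slit_plane (w ` {..<N})"
  define s where "s = Max (insert 0 (insert R0 ((\<lambda>n. \<bar>Re (w n)\<bar>) ` {..<N})))"
  have s: "0 \<le> s" "R0 \<le> s" "\<And>n. n < N \<Longrightarrow> \<bar>Re (w n)\<bar> \<le> s"
    unfolding s_def by (intro Max_ge; simp)+
  have out: "u \<in> ?A" if u: "s < \<bar>Re u\<bar>" for u
  proof -
    have "Re u \<noteq> Re (w n)" if "n < N" for n using s(3)[OF that] u by auto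
    thus ?thesis unfolding slit_plane_def insert_branch_cut by auto
  qed
  show ?thesis
  proof (rule that[of E ?A s q C])
    have "(\<lambda>u. Z u + H u) holomorphic_on ?A"
      by (intro holomorphic_on_add holomorphic_branch_points[OF bp] holomorphic_on_subset[OF H]) auto
    thus "E holomorphic_on ?A" by (rule holomorphic_transform) (use E in auto)
    show "open ?A" by (rule open_slit_plane) simp
    show "range of_real \<subseteq> ?A"
    proof -
      \<comment> \<open>For real u the quantity that is nonnegative on the cut equals minus this
        product.\<close>
      have "0 < sgn1 (Im (w n)) * Im (w n)" if "n < N" for n using im[OF that] by (auto simp: sgn1_def)
      thus ?thesis unfolding slit_plane_def insert_branch_cut by (fastforce simp: right_diff_distrib)
    qed
    show "norm (E u) \<le> C * (1 + norm u powr q)" if "s < \<bar>Re u\<bar>" for u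
      using gr[OF out[OF that]] that s(2) abs_Re_le_cmod[of u] by linarith
  qed (use out s C four in auto)
qed

section \<open>Reflection of the real line\<close>

lemma integral_minus_real:
  fixes f :: "real \<Rightarrow> 'a :: {banach, second_countable_topology}"
  shows "(LINT t|lborel. f (- t)) = (LINT t|lborel. f t)"
  using lborel_integral_real_affine[of "-1" f 0] by simp

lemma integrable_minus_real:
  fixes f :: "real \<Rightarrow> 'a :: {banach, second_countable_topology}"
  shows "integrable lborel f \<Longrightarrow> integrable lborel (\<lambda>t. f (- t))"
  using lborel_integrable_real_affine[of f "-1" 0] by simp

lemma fourier_minus: "fourier (\<lambda>t. h (- t)) z = fourier h (- z)"
  unfolding fourier_def
  by (subst integral_minus_real[symmetric]) simp

lemma Im_fourier_minus: "Im (fourier h (- of_real x)) = - Im (fourier h (of_real x))"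
proof -
  have "cnj (fourier h (of_real x)) = fourier h (- of_real x)"
    unfolding fourier_def
    by (subst Bochner_Integration.integral_cnj[symmetric]) (simp add: exp_cnj)
  thus ?thesis by (metis complex_cnj_cnj cnj.simps(2) minus_minus)
qed

lemma shannon_minus: "shannon m k (- t) = shannon m (- k) t"
proof -
  have "nsinc (- x) = nsinc x" for x by (simp add: nsinc_def)
  moreover have "2 powi m * (- t) - real_of_int k = - (2 powi m * t - real_of_int (- k))" by simp
  ultimately show ?thesis unfolding shannon_def by metis
qed

lemma grid_minus: "grid m (- k) = - grid m k"
  by (simp add: grid_def)

text \<open>Negative grid points are positive grid points for h(- t), whose transform is extended by
  E(- u); the growth of E in the left half-plane is what that requires. For real h the reflection
  merely changes the sign of the imaginary part at the band edge.\<close>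

lemma assumption_A_coeff_bound:
  assumes A: "assumption_A h a b g g'"
  shows "\<exists>K. \<forall>k. 1 \<le> \<bar>grid m k\<bar> \<longrightarrow> isCont h (grid m k) \<longrightarrow>
    \<bar>LINT t|lborel. h t * shannon m k t\<bar> \<le> 2 powr (- real_of_int m / 2) *
      (\<bar>h (grid m k)\<bar> + \<bar>Im (fourier h (of_real (2 powi m * pi)))\<bar> / pi / \<bar>grid m k\<bar> + K / (grid m k)\<^sup>2)"
proof -
  have h: "integrable lborel h" using A unfolding assumption_A_def by blast
  obtain E D s q C where E: "E holomorphic_on D" "open D" "range of_real \<subseteq> D"
    "{u. s < Re u} \<subseteq> D" "{u. Re u < - s} \<subseteq> D" "0 \<le> s" "0 < q" "0 \<le> (C::real)"
    "\<And>x::real. E (of_real x) = fourier h (of_real x)"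
    "\<And>u. s < \<bar>Re u\<bar> \<Longrightarrow> norm (E u) \<le> C * (1 + norm u powr q)"
    by (rule assumption_A_extension[OF A]) blast
  obtain K1 where K1: "\<And>k. 1 \<le> grid m k \<Longrightarrow> isCont h (grid m k) \<Longrightarrow>
    \<bar>LINT t|lborel. h t * shannon m k t\<bar> \<le> 2 powr (- real_of_int m / 2) *
      (\<bar>h (grid m k)\<bar> + \<bar>Im (fourier h (of_real (2 powi m * pi)))\<bar> / pi / grid m k + K1 / (grid m k)\<^sup>2)"
    using shannon_coeff_bound[OF h E(9,1,2,3,4,6,7,8), of m] E(10) by fastforce
  define h' where "h' = (\<lambda>t. h (- t))"
  have f': "fourier h' z = fourier h (- z)" for z unfolding h'_def by (rule fourier_minus)
  have "(\<lambda>u. E (- u)) holomorphic_on (uminus ` D)"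
    using holomorphic_on_compose_gen[of "\<lambda>u. - u" "uminus ` D" E D] E(1)
      holomorphic_on_minus[OF holomorphic_on_ident, of "uminus ` D"]
    by (auto simp: o_def image_image)
  moreover have "open (uminus ` D)" using E(2) by (rule open_negations)
  moreover have "range of_real \<subseteq> uminus ` D"
  proof
    fix z :: complex assume "z \<in> range of_real"
    then obtain x :: real where "z = of_real x" by blast
    hence "- z = of_real (- x)" by simp
    hence "- z \<in> D" using E(3) by blast
    thus "z \<in> uminus ` D" by (metis image_eqI minus_minus)
  qed
  moreover have "{u. s < Re u} \<subseteq> uminus ` D"
  proof
    fix z assume "z \<in> {u. s < Re u}"
    hence "- z \<in> D" using E(5) by auto
    thus "z \<in> uminus ` D" by (metis image_eqI minus_minus)
  qed
  moreover have "integrable lborel h'" unfolding h'_def using integrable_minus_real[of h] h by simp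
  moreover have "E (- of_real x) = fourier h' (of_real x)" for x
    using E(9)[of "- x"] by (simp add: f')
  moreover have "norm (E (- u)) \<le> C * (1 + norm u powr q)" if "s < Re u" for u
    using E(10)[of "- u"] that by auto
  ultimately obtain K2 where K2: "\<And>k. 1 \<le> grid m k \<Longrightarrow> isCont h' (grid m k) \<Longrightarrow>
    \<bar>LINT t|lborel. h' t * shannon m k t\<bar> \<le> 2 powr (- real_of_int m / 2) *
      (\<bar>h' (grid m k)\<bar> + \<bar>Im (fourier h' (of_real (2 powi m * pi)))\<bar> / pi / grid m k + K2 / (grid m k)\<^sup>2)"
    using shannon_coeff_bound[of h' "\<lambda>u. E (- u)" "uminus ` D" s q C m] E(6,7,8) by blast
  have mono: "2 powr (- real_of_int m / 2) * (x + K / y\<^sup>2) \<le> 2 powr (- real_of_int m / 2) * (x + max K1 K2 / y\<^sup>2)"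
    if "K \<le> max K1 K2" for K x y
    using that by (intro mult_left_mono add_left_mono divide_right_mono) auto
  show ?thesis
  proof (intro exI[of _ "max K1 K2"] allI impI)
    fix k assume k: "1 \<le> \<bar>grid m k\<bar>" "isCont h (grid m k)"
    show "\<bar>LINT t|lborel. h t * shannon m k t\<bar> \<le> 2 powr (- real_of_int m / 2) *
      (\<bar>h (grid m k)\<bar> + \<bar>Im (fourier h (of_real (2 powi m * pi)))\<bar> / pi / \<bar>grid m k\<bar> + max K1 K2 / (grid m k)\<^sup>2)"
    proof (cases "0 \<le> grid m k")
      case True
      thus ?thesis using order_trans[OF K1[of k] mono] k by auto
    next
      case False
      have c: "isCont h' (grid m (- k))"
      proof -
        have "isCont uminus (- grid m k)" by (intro continuous_intros)
        from isCont_o2[OF this, of h] show ?thesis using k(2) by (simp add: h'_def grid_minus)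
      qed
      have "(LINT t|lborel. h' t * shannon m (- k) t) = (LINT t|lborel. h t * shannon m k t)"
        using integral_minus_real[of "\<lambda>t. h t * shannon m k t"] by (simp add: h'_def shannon_minus)
      moreover have "\<bar>Im (fourier h' (of_real (2 powi m * pi)))\<bar> = \<bar>Im (fourier h (of_real (2 powi m * pi)))\<bar>"
        unfolding f' Im_fourier_minus by simp
      ultimately show ?thesis
        using order_trans[OF K2[of "- k"] mono] k c False by (auto simp: grid_minus h'_def)
    qed
  qed
qed

section \<open>Sums over the grid\<close>

lemma integral_inverse_power:
  fixes a c :: real
  assumes "c < a" "0 < n"
  shows "has_bochner_integral lborel (\<lambda>y. indicator {a..} y * (1 / (y - c) ^ Suc n)) (1 / (real n * (a - c) ^ n))"
proof -
  define F where "F = (\<lambda>y. - 1 / (real n * (y - c) ^ n))"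
  define f where "f = (\<lambda>y. indicator {a..} y * (1 / (y - c) ^ Suc n))"
  have "(\<integral>\<^sup>+y. ennreal (f y) * indicator {a..} y \<partial>lborel) = ennreal (0 - F a)"
  proof (rule nn_integral_FTC_atLeast)
    show "f \<in> borel_measurable borel" unfolding f_def by measurable
    show "(F has_real_derivative f y) (at y)" if "a \<le> y" for y
    proof -
      obtain n' where n: "n = Suc n'" using assms(2) by (cases n) auto
      have pos: "0 < y - c" using that assms by simp
      have "((\<lambda>y. y - c) has_real_derivative 1) (at y)" by (auto intro!: derivative_eq_intros)
      from DERIV_power[OF this, of n] n
      have "((\<lambda>y. (y - c) ^ n) has_real_derivative real n * (y - c) ^ n') (at y)" by simp
      from DERIV_cmult[OF DERIV_inverse'[OF this], of "- (1 / real n)"] pos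
      have "((\<lambda>y. - (1 / real n) * inverse ((y - c) ^ n)) has_real_derivative
         - (1 / real n) * (- (inverse ((y - c) ^ n) * (real n * (y - c) ^ n') * inverse ((y - c) ^ n)))) (at y)"
        by simp
      moreover have "- (1 / real n) * (- (inverse ((y - c) ^ n) * (real n * (y - c) ^ n') * inverse ((y - c) ^ n))) = f y"
      proof -
        define w where "w = y - c"
        have "w \<noteq> 0" using pos by (simp add: w_def)
        thus ?thesis using that unfolding f_def n w_def[symmetric] by (simp add: field_simps del: of_nat_Suc)
      qed
      moreover have "(\<lambda>y. - (1 / real n) * inverse ((y - c) ^ n)) = F"
        by (auto simp: F_def divide_inverse)
      ultimately show ?thesis by simp
    qed
    show "0 \<le> f y" if "a \<le> y" for y using that assms by (simp add: f_def)
    have "((\<lambda>y. inverse ((y - c) ^ n)) \<longlongrightarrow> 0) at_top"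
      using assms(2) by (intro tendsto_inverse_0_at_top filterlim_pow_at_top) (simp, real_asymp)
    from tendsto_mult_right_zero[OF this, of "- (1 / real n)"]
    show "(F \<longlongrightarrow> 0) at_top" by (simp add: F_def divide_inverse mult.commute)
  qed
  also have "(\<integral>\<^sup>+y. ennreal (f y) * indicator {a..} y \<partial>lborel) = (\<integral>\<^sup>+y. ennreal (f y) \<partial>lborel)"
    by (intro nn_integral_cong) (auto simp: f_def indicator_def)
  also have "0 - F a = 1 / (real n * (a - c) ^ n)" by (simp add: F_def)
  finally have "(\<integral>\<^sup>+y. ennreal (f y) \<partial>lborel) = ennreal (1 / (real n * (a - c) ^ n))" .
  moreover have "AE y in lborel. 0 \<le> f y" using assms by (auto simp: f_def indicator_def)
  moreover have "f \<in> borel_measurable lborel" unfolding f_def by measurable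
  ultimately have "has_bochner_integral lborel f (1 / (real n * (a - c) ^ n))"
    using assms by (intro has_bochner_integral_nn_integral) auto
  thus ?thesis by (simp add: f_def)
qed

lemma grid_step: "grid m (k + 1) = grid m k + 1 / 2 powi m" "grid m (k - 1) = grid m k - 1 / 2 powi m"
  by (simp_all add: grid_def add_divide_distrib diff_divide_distrib)

lemma grid_less_iff [simp]: "grid m k < grid m l \<longleftrightarrow> k < l"
proof -
  have "\<not> (2::real) powi m < 0" by (simp add: not_less)
  thus ?thesis by (auto simp: grid_def divide_less_cancel)
qed

lemma grid_le_iff [simp]: "grid m k \<le> grid m l \<longleftrightarrow> k \<le> l"
proof -
  have "\<not> (2::real) powi m < 0" by (simp add: not_less)
  thus ?thesis by (auto simp: grid_def divide_le_cancel)
qed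

lemma sum_grid_cells_le:
  fixes g :: "real \<Rightarrow> real"
  assumes g: "set_integrable lborel {grid m u..} g" and pos: "\<And>y. grid m u \<le> y \<Longrightarrow> 0 \<le> g y"
    and F: "finite F" "F \<subseteq> {u<..}"
  shows "(\<Sum>k\<in>F. LINT t:{grid m (k - 1)<..grid m k}|lborel. g t) \<le> (LINT t:{grid m u..}|lborel. g t)"
proof -
  let ?A = "\<lambda>k. {grid m (k - 1)<..grid m k}"
  have sub: "?A k \<subseteq> {grid m u..}" if "k \<in> F" for k
  proof -
    have "grid m u \<le> grid m (k - 1)" using F(2) that by auto
    thus ?thesis unfolding atLeast_def greaterThanAtMost_def by (auto simp del: grid_le_iff)
  qed
  have dis: "disjoint_family_on ?A F"
  proof (unfold disjoint_family_on_def, intro ballI impI)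
    fix i j assume "i \<in> F" "j \<in> F" "i \<noteq> j"
    hence "grid m i \<le> grid m (j - 1) \<or> grid m j \<le> grid m (i - 1)" by auto
    thus "?A i \<inter> ?A j = {}" by (auto simp: disjoint_iff)
  qed
  have si: "set_integrable lborel (?A k) g" if "k \<in> F" for k
    using g by (rule set_integrable_subset) (use sub[OF that] in auto)
  have un: "set_integrable lborel (\<Union>k\<in>F. ?A k) g"
    using g by (rule set_integrable_subset) (use sub F(1) in \<open>auto intro!: sets.finite_UN\<close>)
  have "(\<Sum>k\<in>F. LINT t:?A k|lborel. g t) = (LINT t:(\<Union>k\<in>F. ?A k)|lborel. g t)"
    using set_integral_finite_Union[OF F(1) dis si] by simp
  also have "\<dots> \<le> (LINT t:{grid m u..}|lborel. g t)"
    unfolding set_lebesgue_integral_def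
  proof (rule integral_mono)
    show "indicator (\<Union>k\<in>F. ?A k) t *\<^sub>R g t \<le> indicator {grid m u..} t *\<^sub>R g t" for t
    proof (cases "t \<in> (\<Union>k\<in>F. ?A k)")
      case True
      hence "t \<in> {grid m u..}" using sub by blast
      with True show ?thesis by simp
    next
      case False
      thus ?thesis using pos[of t] by (auto simp: indicator_def)
    qed
  qed (use un g in \<open>auto simp: set_integrable_def\<close>)
  finally show ?thesis .
qed

text \<open>A decreasing function is smallest at the right end of each cell. As the sum starts at k
  > u, the first cell used begins exactly at \<open>grid m u\<close>.\<close>

lemma sum_grid_le_integral:
  fixes g :: "real \<Rightarrow> real"
  assumes g: "set_integrable lborel {grid m u..} g" and pos: "\<And>y. grid m u \<le> y \<Longrightarrow> 0 \<le> g y"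
    and anti: "\<And>x y. grid m u \<le> x \<Longrightarrow> x \<le> y \<Longrightarrow> g y \<le> g x"
    and F: "finite F" "F \<subseteq> {u<..}"
  shows "(\<Sum>k\<in>F. 1 / 2 powi m * g (grid m k)) \<le> (LINT t:{grid m u..}|lborel. g t)"
proof -
  have "1 / 2 powi m * g (grid m k) \<le> (LINT t:{grid m (k - 1)<..grid m k}|lborel. g t)" if k: "k \<in> F" for k
  proof -
    let ?A = "{grid m (k - 1)<..grid m k}"
    have low: "grid m u \<le> grid m (k - 1)" using F(2) k by auto
    have "(LINT t:?A|lborel. g (grid m k)) \<le> (LINT t:?A|lborel. g t)"
    proof (rule set_integral_mono)
      show "set_integrable lborel ?A g" using g by (rule set_integrable_subset) (use low in \<open>auto simp del: grid_le_iff\<close>)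
      show "set_integrable lborel ?A (\<lambda>t. g (grid m k))"
        by (simp add: set_integrable_def)
      show "g (grid m k) \<le> g t" if "t \<in> ?A" for t using that low by (intro anti) (auto simp del: grid_le_iff)
    qed
    moreover have "(LINT t:?A|lborel. g (grid m k)) = 1 / 2 powi m * g (grid m k)"
      by (simp add: set_lebesgue_integral_def grid_step)
    ultimately show ?thesis by simp
  qed
  hence "(\<Sum>k\<in>F. 1 / 2 powi m * g (grid m k)) \<le> (\<Sum>k\<in>F. LINT t:{grid m (k - 1)<..grid m k}|lborel. g t)"
    by (rule sum_mono)
  also have "\<dots> \<le> (LINT t:{grid m u..}|lborel. g t)" by (rule sum_grid_cells_le[OF g pos F])
  finally show ?thesis .
qed

lemma sum_grid_inverse_power_le:
  assumes "c < grid m u" "0 < n" and F: "finite F" "F \<subseteq> {u<..}"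
  shows "(\<Sum>k\<in>F. 1 / 2 powi m * (1 / (grid m k - c) ^ Suc n)) \<le> 1 / (real n * (grid m u - c) ^ n)"
proof -
  note I = integral_inverse_power[OF assms(1,2)]
  have "(\<Sum>k\<in>F. 1 / 2 powi m * (1 / (grid m k - c) ^ Suc n)) \<le> (LINT t:{grid m u..}|lborel. 1 / (t - c) ^ Suc n)"
  proof (rule sum_grid_le_integral[OF _ _ _ F])
    show "set_integrable lborel {grid m u..} (\<lambda>t. 1 / (t - c) ^ Suc n)"
      using I by (simp add: set_integrable_def has_bochner_integral_iff)
    show "0 \<le> 1 / (y - c) ^ Suc n" if "grid m u \<le> y" for y using that assms by simp
    show "1 / (y - c) ^ Suc n \<le> 1 / (x - c) ^ Suc n" if "grid m u \<le> x" "x \<le> y" for x y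
      using that assms by (intro divide_left_mono power_mono mult_pos_pos zero_less_power) auto
  qed
  also have "\<dots> = 1 / (real n * (grid m u - c) ^ n)"
    using I by (simp add: set_lebesgue_integral_def has_bochner_integral_iff)
  finally show ?thesis .
qed

text \<open>A substitute for monotonicity: each grid value is charged to its two neighbouring cells,
  and each cell is charged at most twice.\<close>

lemma sum_grid_local_mass_le:
  fixes p :: "real \<Rightarrow> real"
  assumes p: "integrable lborel p" "\<And>y. 0 \<le> p y" and c: "0 \<le> c"
    and mass: "\<And>k. u < k \<Longrightarrow> p (grid m k) \<le> c * ((LINT t:{grid m (k - 1)<..grid m k}|lborel. p t)
        + (LINT t:{grid m k<..grid m (k + 1)}|lborel. p t))"
    and F: "finite F" "F \<subseteq> {u<..}"
  shows "(\<Sum>k\<in>F. p (grid m k)) \<le> 2 * c * (LINT t|lborel. p t)"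
proof -
  let ?I = "\<lambda>k. LINT t:{grid m (k - 1)<..grid m k}|lborel. p t"
  have si: "set_integrable lborel A p" if "A \<in> sets lborel" for A
    unfolding set_integrable_def using integrable_mult_indicator[OF that p(1)] .
  have tot: "sum ?I G \<le> (LINT t|lborel. p t)" if G: "finite G" "G \<subseteq> {u<..}" for G
  proof -
    have "sum ?I G \<le> (LINT t:{grid m u..}|lborel. p t)"
      by (rule sum_grid_cells_le) (use G p si in auto)
    also have "\<dots> \<le> (LINT t|lborel. p t)"
      unfolding set_lebesgue_integral_def using si[of "{grid m u..}"] p
      by (intro integral_mono) (auto simp: set_integrable_def indicator_def)
    finally show ?thesis .
  qed
  have "(\<Sum>k\<in>F. p (grid m k)) \<le> (\<Sum>k\<in>F. c * (?I k + ?I (k + 1)))"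
    using mass F(2) by (intro sum_mono) auto
  also have "\<dots> = c * (sum ?I F + sum ?I ((\<lambda>k. k + 1) ` F))"
    by (subst sum.reindex) (auto simp: sum_distrib_left sum.distrib distrib_left)
  also have "\<dots> \<le> c * ((LINT t|lborel. p t) + (LINT t|lborel. p t))"
    using F by (intro mult_left_mono add_mono tot c) auto
  finally show ?thesis by simp
qed

lemma density_bound_decay:
  fixes C \<alpha> \<mu> \<kappa> \<gamma> :: real
  assumes "0 < \<kappa>"
  shows "\<forall>\<^sub>F y in at_top. C * exp (\<alpha> * \<mu>) * (y - \<mu>) powr (\<gamma> - 1) * exp (- \<kappa> * (y - \<mu>)) \<le> 1 / y ^ 3"
proof -
  have "((\<lambda>y. C * exp (\<alpha> * \<mu>) * (y - \<mu>) powr (\<gamma> - 1) * exp (- \<kappa> * (y - \<mu>)) * y ^ 3) \<longlongrightarrow> 0) at_top"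
    using assms by real_asymp
  hence "\<forall>\<^sub>F y in at_top. C * exp (\<alpha> * \<mu>) * (y - \<mu>) powr (\<gamma> - 1) * exp (- \<kappa> * (y - \<mu>)) * y ^ 3 < 1"
    by (rule order_tendstoD) simp
  thus ?thesis using eventually_gt_at_top[of 0]
    by eventually_elim (simp add: field_simps)
qed

text \<open>The normalising factors of the two coefficients multiply to the width of a grid cell,
  which makes the tail a Riemann sum.\<close>

lemma powr_half_squared: "2 powr (- real_of_int m / 2) * 2 powr (- real_of_int m / 2) = 1 / (2::real) powi m"
proof -
  have "2 powr (- real_of_int m / 2) * 2 powr (- real_of_int m / 2) = (2::real) powr (real_of_int (- m))"
    by (simp flip: powr_add)
  also have "\<dots> = 1 / 2 powi m" by (subst powr_real_of_int') (auto simp: power_int_minus divide_inverse)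
  finally show ?thesis .
qed

text \<open>A right tail in abstract form, to be instantiated once with the data and once with their
  reflection. d and v are the two coefficient sequences, p is the modulus of the damped payoff, c
  the local mass constant and Y0 a point beyond which all bounds hold.\<close>

locale grid_tail =
  fixes m :: int and d v :: "int \<Rightarrow> real" and p :: "real \<Rightarrow> real"
    and C \<alpha> \<mu> \<kappa> \<gamma> \<epsilon>D \<epsilon>V Kd Kv c Y0 :: real
  assumes C: "0 < C" and \<kappa>: "0 < \<kappa>" and \<epsilon>: "0 \<le> \<epsilon>D" "0 \<le> \<epsilon>V"
    and p: "integrable lborel p" "\<And>y. 0 \<le> p y"
    and d_bound: "\<And>k. Y0 < grid m k \<Longrightarrow> \<bar>d k\<bar> \<le> 2 powr (- real_of_int m / 2) *
      (density_bound C \<alpha> \<mu> \<kappa> \<gamma> \<epsilon>D (grid m k - \<mu>) + Kd / (grid m k - \<mu>)\<^sup>2)"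
    and v_bound: "\<And>k. Y0 < grid m k \<Longrightarrow> \<bar>v k\<bar> \<le> 2 powr (- real_of_int m / 2) *
      (p (grid m k) + \<epsilon>V / grid m k + Kv / (grid m k)\<^sup>2)"
    and mass: "\<And>y. Y0 < y \<Longrightarrow> p y \<le> c * ((LINT t:{y - 1 / 2 powi m<..y}|lborel. p t)
        + (LINT t:{y<..y + 1 / 2 powi m}|lborel. p t))"
begin

definition G :: "real \<Rightarrow> real" where
  "G y = density_bound C \<alpha> \<mu> \<kappa> \<gamma> \<epsilon>D (y - \<mu>) * (p y + \<epsilon>V / y)"

definition I where "I = (LINT t|lborel. p t)"
text \<open>No sign of c is assumed; the maximum may be used as a factor in monotone
  estimates.\<close>

definition c' where "c' = max c 0"
text \<open>A bound for p beyond Y0: both neighbouring cells have mass at most I.\<close>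

definition B where "B = 2 * c' * I"
text \<open>A common constant for both quadratic errors. The factor 4 comes from y - \<mu> >= y / 2,
  which converts the error at distance y - \<mu> into one in y.\<close>

definition K where "K = 4 * \<bar>Kd\<bar> + \<bar>Kv\<bar>"

lemma p_set_integrable: "A \<in> sets lborel \<Longrightarrow> set_integrable lborel A p"
  unfolding set_integrable_def by (rule integrable_mult_indicator[OF _ p(1)])

lemma I_nonneg: "0 \<le> I" unfolding I_def using p(2) by simp

lemma set_p_le: "A \<in> sets lborel \<Longrightarrow> (LINT t:A|lborel. p t) \<le> I"
  unfolding I_def set_lebesgue_integral_def using p_set_integrable[of A] p
  by (intro integral_mono) (auto simp: set_integrable_def indicator_def)

lemma set_p_nonneg: "0 \<le> (LINT t:A|lborel. p t)"
  unfolding set_lebesgue_integral_def using p(2) by (intro Bochner_Integration.integral_nonneg) auto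

lemma mass': "Y0 < y \<Longrightarrow> p y \<le> c' * ((LINT t:{y - 1 / 2 powi m<..y}|lborel. p t)
        + (LINT t:{y<..y + 1 / 2 powi m}|lborel. p t))"
  by (rule order_trans[OF mass mult_right_mono]) (auto simp: c'_def intro!: add_nonneg_nonneg set_p_nonneg)

lemma p_le: "Y0 < y \<Longrightarrow> p y \<le> B"
proof -
  assume "Y0 < y"
  from mass'[OF this] have "p y \<le> c' * ((LINT t:{y - 1 / 2 powi m<..y}|lborel. p t)
        + (LINT t:{y<..y + 1 / 2 powi m}|lborel. p t))" .
  also have "\<dots> \<le> c' * (I + I)"
    by (intro mult_left_mono add_mono set_p_le) (auto simp: c'_def)
  finally show ?thesis by (simp add: B_def)
qed

lemma B_nonneg: "0 \<le> B" unfolding B_def c'_def using I_nonneg by simp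

text \<open>Beyond such a point all bounds are effective and the exponential part is negligible.\<close>

definition good :: "real \<Rightarrow> bool" where
  "good Y \<longleftrightarrow> Y0 \<le> Y \<and> 1 \<le> Y \<and> 2 * \<bar>\<mu>\<bar> + 1 \<le> Y \<and>
     (\<forall>y\<ge>Y. C * exp (\<alpha> * \<mu>) * (y - \<mu>) powr (\<gamma> - 1) * exp (- \<kappa> * (y - \<mu>)) \<le> 1 / y ^ 3)"

lemma good_exists: "\<exists>Y. good Y"
proof -
  obtain Y where "\<forall>y\<ge>Y. C * exp (\<alpha> * \<mu>) * (y - \<mu>) powr (\<gamma> - 1) * exp (- \<kappa> * (y - \<mu>)) \<le> 1 / y ^ 3"
    using density_bound_decay[OF \<kappa>, of C \<alpha> \<mu> \<gamma>] unfolding eventually_at_top_linorder by blast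
  hence "good (max (max Y0 1) (max (2 * \<bar>\<mu>\<bar> + 1) Y))" unfolding good_def by auto
  thus ?thesis ..
qed

lemma density_bound_le:
  assumes "good Y" "Y \<le> y"
  shows "0 \<le> density_bound C \<alpha> \<mu> \<kappa> \<gamma> \<epsilon>D (y - \<mu>)"
    and "density_bound C \<alpha> \<mu> \<kappa> \<gamma> \<epsilon>D (y - \<mu>) \<le> 1 / y ^ 3 + \<epsilon>D / (y - \<mu>)"
    and "density_bound C \<alpha> \<mu> \<kappa> \<gamma> \<epsilon>D (y - \<mu>) \<le> (1 + 2 * \<epsilon>D) / y"
    and "1 / (y - \<mu>)\<^sup>2 \<le> 4 / y\<^sup>2"
proof -
  have y: "1 \<le> y" "2 * \<bar>\<mu>\<bar> + 1 \<le> y" and e: "C * exp (\<alpha> * \<mu>) * (y - \<mu>) powr (\<gamma> - 1) * exp (- \<kappa> * (y - \<mu>)) \<le> 1 / y ^ 3"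
    using assms unfolding good_def by auto
  have t: "0 < y - \<mu>" "y / 2 \<le> y - \<mu>" using y by auto
  show "0 \<le> density_bound C \<alpha> \<mu> \<kappa> \<gamma> \<epsilon>D (y - \<mu>)" unfolding density_bound_def using C \<epsilon> t by simp
  show le: "density_bound C \<alpha> \<mu> \<kappa> \<gamma> \<epsilon>D (y - \<mu>) \<le> 1 / y ^ 3 + \<epsilon>D / (y - \<mu>)"
    unfolding density_bound_def using e by simp
  have "1 / y ^ 3 \<le> 1 / y ^ 1" using y by (intro divide_left_mono power_increasing) auto
  moreover have "\<epsilon>D / (y - \<mu>) \<le> \<epsilon>D / (y / 2)" using \<epsilon> t y by (intro divide_left_mono) auto
  ultimately show "density_bound C \<alpha> \<mu> \<kappa> \<gamma> \<epsilon>D (y - \<mu>) \<le> (1 + 2 * \<epsilon>D) / y"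
    using le by (simp add: add_divide_distrib mult.commute)
  have "1 / (y - \<mu>)\<^sup>2 \<le> 1 / (y / 2)\<^sup>2" using t y by (intro divide_left_mono power_mono) auto
  thus "1 / (y - \<mu>)\<^sup>2 \<le> 4 / y\<^sup>2" by (simp add: power_divide)
qed

text \<open>Coefficient of \<open>1 / y ^ 3\<close> in the product of the two coefficient bounds:
  payoff error terms times the quadratic density error, and the density bound, at most (1 + 2
  \<epsilon>D) / y, times the quadratic payoff error.\<close>

definition M where "M = K * (\<epsilon>V + K) + (1 + 2 * \<epsilon>D) * K"

lemma K_nonneg: "0 \<le> K" by (simp add: K_def)

lemma M_nonneg: "0 \<le> M" using \<epsilon> K_nonneg by (simp add: M_def)

text \<open>The term with p over \<open>y\<^sup>2\<close> is kept apart. Estimating p in it by B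
  would lose one order after summation, whereas the sum of the grid values of p is finite.\<close>

lemma product_le:
  assumes Y: "good Y" "Y < grid m k"
  shows "\<bar>d k * v k\<bar> \<le> 1 / 2 powi m * (G (grid m k) + K * (p (grid m k) / (grid m k)\<^sup>2) + M / grid m k ^ 3)"
proof -
  define y where "y = grid m k"
  define D where "D = density_bound C \<alpha> \<mu> \<kappa> \<gamma> \<epsilon>D (y - \<mu>)"
  define s where "s = 2 powr (- real_of_int m / 2)"
  have y: "1 \<le> y" "Y0 < y" using Y unfolding good_def y_def by auto
  have D: "0 \<le> D" "D \<le> (1 + 2 * \<epsilon>D) / y"
    using density_bound_le[OF Y(1), of y] Y(2) by (auto simp: D_def y_def)
  have q: "1 / (y - \<mu>)\<^sup>2 \<le> 4 / y\<^sup>2" using density_bound_le(4)[OF Y(1), of y] Y(2) by (auto simp: y_def)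
  have K1: "Kd / (y - \<mu>)\<^sup>2 \<le> K / y\<^sup>2"
  proof -
    have "Kd / (y - \<mu>)\<^sup>2 \<le> \<bar>Kd\<bar> * (1 / (y - \<mu>)\<^sup>2)" by (simp add: divide_right_mono)
    also have "\<dots> \<le> \<bar>Kd\<bar> * (4 / y\<^sup>2)" by (intro mult_left_mono q) auto
    also have "\<dots> \<le> K / y\<^sup>2" by (simp add: K_def divide_right_mono)
    finally show ?thesis .
  qed
  have K2: "Kv / y\<^sup>2 \<le> K / y\<^sup>2" by (intro divide_right_mono) (auto simp: K_def)
  have K0: "0 \<le> K / y\<^sup>2" using K_nonneg by simp
  have P: "0 \<le> p y + \<epsilon>V / y" using p(2) \<epsilon> y by simp
  have s: "0 \<le> s" "s * s = 1 / 2 powi m" using powr_half_squared by (auto simp: s_def)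
  have "\<bar>d k\<bar> \<le> s * (D + Kd / (y - \<mu>)\<^sup>2)" using d_bound[of k] y by (simp add: y_def s_def D_def)
  also have "\<dots> \<le> s * (D + K / y\<^sup>2)" using K1 s by (intro mult_left_mono) auto
  finally have dk: "\<bar>d k\<bar> \<le> s * (D + K / y\<^sup>2)" .
  have "\<bar>v k\<bar> \<le> s * (p y + \<epsilon>V / y + Kv / y\<^sup>2)" using v_bound[of k] y by (simp add: y_def s_def)
  also have "\<dots> \<le> s * (p y + \<epsilon>V / y + K / y\<^sup>2)" using K2 s by (intro mult_left_mono) auto
  finally have vk: "\<bar>v k\<bar> \<le> s * (p y + \<epsilon>V / y + K / y\<^sup>2)" .
  have "\<bar>d k * v k\<bar> \<le> (s * (D + K / y\<^sup>2)) * (s * (p y + \<epsilon>V / y + K / y\<^sup>2))"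
    unfolding abs_mult using dk vk s D K0 by (intro mult_mono) auto
  also have "\<dots> = (s * s) * (D * (p y + \<epsilon>V / y) + K * (p y / y\<^sup>2)
      + (K / y\<^sup>2 * (\<epsilon>V / y + K / y\<^sup>2) + D * (K / y\<^sup>2)))"
    by (simp add: algebra_simps)
  also have "\<dots> \<le> (s * s) * (D * (p y + \<epsilon>V / y) + K * (p y / y\<^sup>2) + M / y ^ 3)"
  proof (intro mult_left_mono add_left_mono)
    have "K / y\<^sup>2 * (\<epsilon>V / y + K / y\<^sup>2) \<le> K / y\<^sup>2 * ((\<epsilon>V + K) / y)"
    proof (intro mult_left_mono K0)
      have "K / y\<^sup>2 \<le> K / y ^ 1" using y K_nonneg by (intro divide_left_mono power_increasing) auto
      thus "\<epsilon>V / y + K / y\<^sup>2 \<le> (\<epsilon>V + K) / y" by (simp add: add_divide_distrib)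
    qed
    moreover have "D * (K / y\<^sup>2) \<le> (1 + 2 * \<epsilon>D) / y * (K / y\<^sup>2)" by (intro mult_right_mono D K0)
    moreover have "K / y\<^sup>2 * ((\<epsilon>V + K) / y) + (1 + 2 * \<epsilon>D) / y * (K / y\<^sup>2) = M / y ^ 3"
      by (simp add: M_def divide_inverse power2_eq_square power3_eq_cube algebra_simps)
    ultimately show "K / y\<^sup>2 * (\<epsilon>V / y + K / y\<^sup>2) + D * (K / y\<^sup>2) \<le> M / y ^ 3" by linarith
  qed (use s in auto)
  finally show ?thesis unfolding s(2) G_def D_def y_def .
qed

lemma sum_p_le:
  assumes "good Y" "Y < grid m u" and F: "finite F" "F \<subseteq> {u<..}"
  shows "(\<Sum>k\<in>F. p (grid m k)) \<le> 2 * c' * I"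
  unfolding I_def
proof (rule sum_grid_local_mass_le[OF p(1) p(2) _ _ F])
  show "0 \<le> c'" by (simp add: c'_def)
  fix k assume "u < k"
  hence "grid m u < grid m k" by simp
  hence "Y0 < grid m k" using assms(1,2) unfolding good_def by linarith
  from mass'[OF this] show "p (grid m k) \<le> c' * ((LINT t:{grid m (k - 1)<..grid m k}|lborel. p t)
        + (LINT t:{grid m k<..grid m (k + 1)}|lborel. p t))"
    by (simp add: grid_step)
qed

text \<open>A cruder majorant, summable over the grid without monotonicity of G. It yields
  convergence of the series independently of the local maxima.\<close>

lemma product_le_p:
  assumes Y: "good Y" "Y < grid m k"
  shows "\<bar>d k * v k\<bar> \<le> 1 / 2 powi m * ((1 + 2 * \<epsilon>D + K) * p (grid m k)
     + ((1 + 2 * \<epsilon>D) * \<epsilon>V + M) * (1 / grid m k ^ 2))"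
proof -
  define y where "y = grid m k"
  have y: "1 \<le> y" "Y0 < y" using Y unfolding good_def y_def by auto
  define D where "D = density_bound C \<alpha> \<mu> \<kappa> \<gamma> \<epsilon>D (y - \<mu>)"
  have D: "0 \<le> D" "D \<le> (1 + 2 * \<epsilon>D) / y"
    using density_bound_le[OF Y(1), of y] Y(2) by (auto simp: D_def y_def)
  have "(1 + 2 * \<epsilon>D) / y \<le> (1 + 2 * \<epsilon>D) / 1" using y \<epsilon> by (intro divide_left_mono) auto
  hence "D * p y \<le> (1 + 2 * \<epsilon>D) * p y" using D p(2)[of y] by (intro mult_right_mono) auto
  moreover have "D * (\<epsilon>V / y) \<le> (1 + 2 * \<epsilon>D) / y * (\<epsilon>V / y)"
    using y \<epsilon> by (intro mult_right_mono D) auto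
  ultimately have "G y \<le> (1 + 2 * \<epsilon>D) * p y + (1 + 2 * \<epsilon>D) * \<epsilon>V * (1 / y\<^sup>2)"
    unfolding G_def D_def[symmetric] by (simp add: distrib_left power2_eq_square)
  moreover have "K * (p y / y\<^sup>2) \<le> K * (p y / 1)"
    using y p(2)[of y] K_nonneg by (intro mult_left_mono divide_left_mono) auto
  moreover have "M / y ^ 3 \<le> M / y\<^sup>2"
    using y M_nonneg by (intro divide_left_mono power_increasing) auto
  ultimately have "G y + K * (p y / y\<^sup>2) + M / y ^ 3
      \<le> (1 + 2 * \<epsilon>D + K) * p y + ((1 + 2 * \<epsilon>D) * \<epsilon>V + M) * (1 / y\<^sup>2)"
    by (simp add: algebra_simps)
  from order_trans[OF product_le[OF Y] mult_left_mono[OF this[unfolded y_def]]]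
  show ?thesis by simp
qed

lemma product_summable: "\<exists>u. (\<lambda>k. \<bar>d k * v k\<bar>) summable_on {u<..}"
proof -
  obtain Y where Y: "good Y" using good_exists by blast
  define u where "u = \<lfloor>Y * 2 powi m\<rfloor> + 1"
  have "Y * 2 powi m < real_of_int u" unfolding u_def by linarith
  hence u: "Y < grid m u" by (simp add: grid_def field_simps)
  have y0: "0 < grid m u" using u Y unfolding good_def by linarith
  define b where "b = 1 / 2 powi m * ((1 + 2 * \<epsilon>D + K) * (2 * c' * I)) + ((1 + 2 * \<epsilon>D) * \<epsilon>V + M) * (1 / grid m u)"
  have bound: "(\<Sum>k\<in>F. \<bar>d k * v k\<bar>) \<le> b" if F: "finite F" "F \<subseteq> {u<..}" for F
  proof -
    have gt: "Y < grid m k" if "k \<in> F" for k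
    proof -
      have "grid m u < grid m k" using F(2) that by auto
      thus ?thesis using u by linarith
    qed
    have split: "(\<Sum>k\<in>F. w * (a * p (grid m k) + b * (1 / grid m k ^ 2)))
        = w * (a * (\<Sum>k\<in>F. p (grid m k))) + b * (\<Sum>k\<in>F. w * (1 / (grid m k - 0) ^ Suc 1))" for w a b :: real
      by (simp add: sum_distrib_left sum.distrib distrib_left mult_ac numeral_2_eq_2)
    have "(\<Sum>k\<in>F. \<bar>d k * v k\<bar>) \<le> (\<Sum>k\<in>F. 1 / 2 powi m * ((1 + 2 * \<epsilon>D + K) * p (grid m k)
     + ((1 + 2 * \<epsilon>D) * \<epsilon>V + M) * (1 / grid m k ^ 2)))"
      by (intro sum_mono product_le_p[OF Y] gt)
    also have "\<dots> = 1 / 2 powi m * ((1 + 2 * \<epsilon>D + K) * (\<Sum>k\<in>F. p (grid m k)))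
      + ((1 + 2 * \<epsilon>D) * \<epsilon>V + M) * (\<Sum>k\<in>F. 1 / 2 powi m * (1 / (grid m k - 0) ^ Suc 1))"
      by (rule split)
    also have "\<dots> \<le> 1 / 2 powi m * ((1 + 2 * \<epsilon>D + K) * (2 * c' * I))
      + ((1 + 2 * \<epsilon>D) * \<epsilon>V + M) * (1 / (real 1 * (grid m u - 0) ^ 1))"
      using \<epsilon> K_nonneg M_nonneg y0
      by (intro add_mono mult_left_mono sum_p_le[OF Y u F] sum_grid_inverse_power_le F) auto
    finally show ?thesis by (simp add: b_def)
  qed
  have "(\<lambda>k. \<bar>d k * v k\<bar>) summable_on {u<..}"
    by (rule nonneg_bdd_above_summable_on) (auto intro!: bdd_aboveI[of _ b] bound)
  thus ?thesis ..
qed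

text \<open>The exponential part of the density bound is below \<open>1 / y ^ 3\<close> and goes
  into the remainder; only \<epsilon>D / (y - \<mu>) contributes to the main term. Estimates over
  finite index sets give summability and the bound at once, the summands being nonnegative.\<close>

lemma tail_sum_le:
  assumes anti: "\<And>x y. Y1 < x \<Longrightarrow> x \<le> y \<Longrightarrow> G y \<le> G x"
  shows "\<exists>K' u0. \<forall>u\<ge>u0. (\<lambda>k. \<bar>d k * v k\<bar>) summable_on {u<..} \<and>
    (\<Sum>\<^sub>\<infinity>k\<in>{u<..}. \<bar>d k * v k\<bar>) \<le>
     \<epsilon>D * ((LINT t:{grid m u..}|lborel. p t) + \<epsilon>V) * max (1 / \<bar>grid m u\<bar>) (1 / \<bar>grid m u - \<mu>\<bar>) + K' / (grid m u)\<^sup>2"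
proof -
  obtain Y where Y: "good Y" using good_exists by blast
  define u0 where "u0 = \<lfloor>max Y Y1 * 2 powi m\<rfloor> + 1"
  have "max Y Y1 * 2 powi m < real_of_int u0" unfolding u0_def by linarith
  hence u0: "max Y Y1 < grid m u0" unfolding grid_def by (subst pos_less_divide_eq) auto
  \<comment> \<open>The summands stem, in this order, from the exponential part of G, from p over
    \<open>y\<^sup>2\<close> and from the cubic remainder; the halves are from the integral of
    \<open>1 / y ^ 3\<close>.\<close>
  define K' where "K' = (B + \<epsilon>V) / 2 + K * (1 / 2 powi m) * (2 * c' * I) + M / 2"
  have main: "(\<Sum>k\<in>F. \<bar>d k * v k\<bar>) \<le>
     \<epsilon>D * ((LINT t:{grid m u..}|lborel. p t) + \<epsilon>V) * max (1 / \<bar>grid m u\<bar>) (1 / \<bar>grid m u - \<mu>\<bar>) + K' / (grid m u)\<^sup>2"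
    if u: "u0 \<le> u" and F: "finite F" "F \<subseteq> {u<..}" for u F
  proof -
    define U where "U = grid m u"
    have "grid m u0 \<le> U" using u by (simp add: U_def)
    hence U: "Y < U" "Y1 < U" using u0 by auto
    have UY: "Y0 < U" "1 < U" "2 * \<bar>\<mu>\<bar> + 1 < U" using U Y unfolding good_def by auto
    have gt: "U < grid m k" if "k \<in> F" for k using F(2) that by (auto simp: U_def)
    define x where "x = max (1 / \<bar>U\<bar>) (1 / \<bar>U - \<mu>\<bar>)"
    have x0: "0 \<le> x" by (simp add: x_def le_max_iff_disj)
    \<comment> \<open>Dominates 1 / ((y - \<mu>) y) by the square of its larger factor. Which factor
      is larger depends on the sign of \<mu>, and the integral is 1 / (U - \<mu>) or 1 / U; hence
      the maximum in the algebraic term.\<close>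
    define w where "w = (\<lambda>y. if 0 \<le> \<mu> then 1 / (y - \<mu>) ^ Suc 1 else 1 / (y - 0) ^ Suc 1)"
    have w: "set_integrable lborel {U..} w" "(LINT y:{U..}|lborel. w y) \<le> x"
    proof -
      have "\<mu> < U" "0 < U" using UY by auto
      note I1 = integral_inverse_power[OF \<open>\<mu> < U\<close>, of 1] integral_inverse_power[OF \<open>0 < U\<close>, of 1]
      show "set_integrable lborel {U..} w"
        using I1 by (cases "0 \<le> \<mu>") (auto simp: set_integrable_def has_bochner_integral_iff w_def)
      show "(LINT y:{U..}|lborel. w y) \<le> x"
        using I1 UY
        by (cases "0 \<le> \<mu>") (auto simp: set_lebesgue_integral_def has_bochner_integral_iff w_def x_def)
    qed
    have cube: "set_integrable lborel {U..} (\<lambda>y. 1 / (y - 0) ^ Suc 2)"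
      "(LINT y:{U..}|lborel. 1 / (y - 0) ^ Suc 2) = 1 / (real 2 * (U - 0) ^ 2)"
      using integral_inverse_power[of 0 U 2] UY
      by (auto simp: set_integrable_def set_lebesgue_integral_def has_bochner_integral_iff)
    \<comment> \<open>In the product with p the factor 1 / (y - \<mu>) is replaced by x, its bound
      at U, which leaves the L1 norm of the payoff; the product with \<epsilon>V / y is integrated
      through w.\<close>
    define H where "H = (\<lambda>y. (B + \<epsilon>V) * (1 / (y - 0) ^ Suc 2) + (\<epsilon>D * x * p y + \<epsilon>D * \<epsilon>V * w y))"
    have G: "0 \<le> G y" "G y \<le> H y" if y: "U \<le> y" for y
    proof -
      define D where "D = density_bound C \<alpha> \<mu> \<kappa> \<gamma> \<epsilon>D (y - \<mu>)"
      have yY: "Y \<le> y" "Y0 < y" "1 < y" "2 * \<bar>\<mu>\<bar> + 1 < y" using y U UY by auto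
      have D: "0 \<le> D" "D \<le> 1 / y ^ 3 + \<epsilon>D / (y - \<mu>)"
        using density_bound_le[OF Y yY(1)] by (auto simp: D_def)
      have P: "0 \<le> p y + \<epsilon>V / y" using p(2) \<epsilon> yY by simp
      show "0 \<le> G y" unfolding G_def D_def[symmetric] using D P by simp
      have "G y \<le> (1 / y ^ 3 + \<epsilon>D / (y - \<mu>)) * (p y + \<epsilon>V / y)"
        unfolding G_def D_def[symmetric] by (intro mult_right_mono D P)
      also have "\<dots> = 1 / y ^ 3 * (p y + \<epsilon>V / y) + (\<epsilon>D * (1 / (y - \<mu>)) * p y + \<epsilon>D * \<epsilon>V * (1 / ((y - \<mu>) * y)))"
        by (simp add: algebra_simps)
      also have "\<dots> \<le> 1 / y ^ 3 * (B + \<epsilon>V) + (\<epsilon>D * x * p y + \<epsilon>D * \<epsilon>V * w y)"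
      proof (intro add_mono mult_left_mono mult_right_mono)
        show "p y \<le> B" by (rule p_le) (rule yY)
        have "\<epsilon>V / y \<le> \<epsilon>V / 1" using yY \<epsilon> by (intro divide_left_mono) auto
        thus "\<epsilon>V / y \<le> \<epsilon>V" by simp
        have "1 / (y - \<mu>) \<le> 1 / (U - \<mu>)" using y UY by (intro divide_left_mono) auto
        also have "\<dots> \<le> x" using UY by (simp add: x_def)
        finally show "1 / (y - \<mu>) \<le> x" .
        show "1 / ((y - \<mu>) * y) \<le> w y"
        proof (cases "0 \<le> \<mu>")
          case True
          thus ?thesis using yY by (auto simp: w_def intro!: divide_left_mono mult_left_mono)
        next
          case False
          thus ?thesis using yY by (auto simp: w_def intro!: divide_left_mono mult_right_mono)
        qed
      qed (use \<epsilon> p(2) yY in auto)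
      finally show "G y \<le> H y" by (simp add: H_def numeral_3_eq_3 numeral_2_eq_2)
    qed
    have Hint: "set_integrable lborel {U..} H"
      unfolding H_def by (intro set_integral_add set_integrable_mult_right cube w p_set_integrable) auto
    have Gint: "set_integrable lborel {U..} G"
    proof (rule set_integrable_bound[OF Hint])
      have [measurable]: "p \<in> borel_measurable lborel" using p(1) by auto
      show "set_borel_measurable lborel {U..} G"
        unfolding set_borel_measurable_def G_def density_bound_def by measurable
      show "AE y in lborel. y \<in> {U..} \<longrightarrow> norm (G y) \<le> norm (H y)"
        using G by (intro AE_I2) (fastforce simp: abs_of_nonneg)
    qed
    have "(\<Sum>k\<in>F. 1 / 2 powi m * G (grid m k)) \<le> (LINT t:{grid m u..}|lborel. G t)"
      using U by (intro sum_grid_le_integral F Gint[unfolded U_def] G[unfolded U_def] anti) (auto simp: U_def)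
    also have "\<dots> \<le> (LINT t:{U..}|lborel. H t)"
      unfolding U_def[symmetric] by (intro set_integral_mono Gint Hint G) auto
    also have "\<dots> = (B + \<epsilon>V) * (1 / (real 2 * (U - 0) ^ 2)) + (\<epsilon>D * x * (LINT t:{U..}|lborel. p t)
          + \<epsilon>D * \<epsilon>V * (LINT y:{U..}|lborel. w y))"
    proof -
      have i: "set_integrable lborel {U..} (\<lambda>y. (B + \<epsilon>V) * (1 / (y - 0) ^ Suc 2))"
        "set_integrable lborel {U..} (\<lambda>y. \<epsilon>D * x * p y)" "set_integrable lborel {U..} (\<lambda>y. \<epsilon>D * \<epsilon>V * w y)"
        by (rule set_integrable_mult_right, rule cube)
           (rule set_integrable_mult_right, rule p_set_integrable, simp,
            rule set_integrable_mult_right, rule w)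
      show ?thesis
        unfolding H_def set_integral_add(2)[OF i(1) set_integral_add(1)[OF i(2,3)]] set_integral_add(2)[OF i(2,3)]
          set_integral_mult_right cube(2) ..
    qed
    also have "\<dots> \<le> (B + \<epsilon>V) * (1 / (real 2 * (U - 0) ^ 2)) + (\<epsilon>D * x * (LINT t:{U..}|lborel. p t)
          + \<epsilon>D * \<epsilon>V * x)"
      using w \<epsilon> by (intro add_left_mono mult_left_mono) auto
    finally have sG: "(\<Sum>k\<in>F. 1 / 2 powi m * G (grid m k)) \<le> (B + \<epsilon>V) / 2 / U\<^sup>2 + \<epsilon>D * ((LINT t:{U..}|lborel. p t) + \<epsilon>V) * x"
      by (simp add: algebra_simps)
    \<comment> \<open>Here the decay sits entirely in \<open>1 / U\<^sup>2\<close>, and the grid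
      values of p are summed by local mass.\<close>
    have sp: "(\<Sum>k\<in>F. p (grid m k) / (grid m k)\<^sup>2) \<le> 2 * c' * I / U\<^sup>2"
    proof -
      have "(\<Sum>k\<in>F. p (grid m k) / (grid m k)\<^sup>2) \<le> (\<Sum>k\<in>F. p (grid m k) / U\<^sup>2)"
        using UY by (intro sum_mono divide_left_mono power_mono less_imp_le[OF gt] p(2))
          (auto dest!: gt intro!: mult_pos_pos)
      also have "\<dots> = (\<Sum>k\<in>F. p (grid m k)) / U\<^sup>2" by (simp add: sum_divide_distrib)
      also have "\<dots> \<le> 2 * c' * I / U\<^sup>2"
        by (intro divide_right_mono sum_p_le[OF Y _ F]) (use U in \<open>auto simp: U_def\<close>)
      finally show ?thesis .
    qed
    have sc: "(\<Sum>k\<in>F. 1 / 2 powi m * (1 / (grid m k - 0) ^ Suc 2)) \<le> 1 / (real 2 * (U - 0) ^ 2)"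
      unfolding U_def using UY by (intro sum_grid_inverse_power_le F) (auto simp: U_def)
    have split: "(\<Sum>k\<in>F. w * (G (grid m k) + a * (p (grid m k) / (grid m k)\<^sup>2) + b / grid m k ^ 3))
        = (\<Sum>k\<in>F. w * G (grid m k)) + a * w * (\<Sum>k\<in>F. p (grid m k) / (grid m k)\<^sup>2)
          + b * (\<Sum>k\<in>F. w * (1 / (grid m k - 0) ^ Suc 2))" for w a b :: real
      by (simp add: sum_distrib_left sum.distrib distrib_left mult_ac numeral_3_eq_3 numeral_2_eq_2)
    have "(\<Sum>k\<in>F. \<bar>d k * v k\<bar>) \<le> (\<Sum>k\<in>F. 1 / 2 powi m * (G (grid m k) + K * (p (grid m k) / (grid m k)\<^sup>2) + M / grid m k ^ 3))"
      using gt U by (intro sum_mono product_le[OF Y]) (auto intro: less_trans)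
    also have "\<dots> = (\<Sum>k\<in>F. 1 / 2 powi m * G (grid m k)) + K * (1 / 2 powi m) * (\<Sum>k\<in>F. p (grid m k) / (grid m k)\<^sup>2)
        + M * (\<Sum>k\<in>F. 1 / 2 powi m * (1 / (grid m k - 0) ^ Suc 2))"
      by (rule split)
    also have "\<dots> \<le> ((B + \<epsilon>V) / 2 / U\<^sup>2 + \<epsilon>D * ((LINT t:{U..}|lborel. p t) + \<epsilon>V) * x)
        + K * (1 / 2 powi m) * (2 * c' * I / U\<^sup>2) + M * (1 / (real 2 * (U - 0) ^ 2))"
      using K_nonneg M_nonneg by (intro add_mono mult_left_mono sG sp sc) auto
    also have "\<dots> = \<epsilon>D * ((LINT t:{U..}|lborel. p t) + \<epsilon>V) * x + K' / U\<^sup>2"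
      by (simp add: K'_def add_divide_distrib)
    finally show ?thesis by (simp add: x_def U_def)
  qed
  have sm: "(\<lambda>k. \<bar>d k * v k\<bar>) summable_on {u<..}" if "u0 \<le> u" for u
    by (rule nonneg_bdd_above_summable_on) (auto intro!: bdd_aboveI main[OF that])
  show ?thesis
  proof (intro exI[of _ K'] exI[of _ u0] allI impI conjI)
    fix u assume u: "u0 \<le> u"
    show "(\<lambda>k. \<bar>d k * v k\<bar>) summable_on {u<..}" by (rule sm[OF u])
    show "(\<Sum>\<^sub>\<infinity>k\<in>{u<..}. \<bar>d k * v k\<bar>) \<le>
     \<epsilon>D * ((LINT t:{grid m u..}|lborel. p t) + \<epsilon>V) * max (1 / \<bar>grid m u\<bar>) (1 / \<bar>grid m u - \<mu>\<bar>) + K' / (grid m u)\<^sup>2"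
      by (rule infsum_le_finite_sums[OF sm[OF u] main[OF u]])
  qed
qed

end

section \<open>Monotonicity beyond the last critical point\<close>

text \<open>Flat points do not count as critical, so the derivative may vanish. The points with
  nonzero derivative and the flat points form two disjoint open sets covering S; by connectedness
  one is empty. Thus the derivative is zero throughout or never, and in the latter case it has
  constant sign.\<close>

lemma no_critical_points_monotone:
  fixes P :: "real \<Rightarrow> real"
  assumes S: "open S" "convex S" and C1: "P C1_differentiable_on S" and crit: "S \<inter> critical_points P = {}"
  shows "mono_on S P \<or> antimono_on S P"
proof -
  obtain D where D: "\<And>x. x \<in> S \<Longrightarrow> (P has_real_derivative D x) (at x)" and cD: "continuous_on S D"
    using C1 unfolding C1_differentiable_on_def has_real_derivative_iff_has_vector_derivative by blast
  have seg: "z \<in> S" if "x \<in> S" "y \<in> S" "x \<le> z" "z \<le> y" for x y z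
    using that S(2) by (meson is_interval_convex_1 mem_is_interval_1_I)
  define A where "A = S \<inter> D -` (- {0})"
  define F where "F = S \<inter> {x. flat_at P x}"
  have "open A" unfolding A_def using cD S(1) by (intro continuous_open_preimage) auto
  have "open F"
  proof (subst open_subopen, intro ballI)
    fix x assume x: "x \<in> F"
    hence "\<forall>\<^sub>F y in nhds x. \<forall>\<^sub>F z in nhds y. P z = P x"
      unfolding F_def flat_at_def by (simp add: eventually_eventually)
    moreover have "\<forall>\<^sub>F y in nhds x. P y = P x" using x unfolding F_def flat_at_def by simp
    moreover have "\<forall>\<^sub>F y in nhds x. y \<in> S" using S(1) x by (intro eventually_nhds_in_open) (auto simp: F_def)
    ultimately have "\<forall>\<^sub>F y in nhds x. y \<in> F"
      by eventually_elim (auto simp: F_def flat_at_def)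
    thus "\<exists>T. open T \<and> x \<in> T \<and> T \<subseteq> F" unfolding eventually_nhds by blast
  qed
  have flat0: "D x = 0" if x: "x \<in> F" for x
  proof -
    obtain T where T: "open T" "x \<in> T" "\<And>t. t \<in> T \<Longrightarrow> P t = P x"
      using x unfolding F_def flat_at_def eventually_nhds by blast
    have "(P has_real_derivative 0) (at x)"
      by (rule has_field_derivative_transform_within_open[OF DERIV_const T(1,2) T(3)[symmetric]])
    thus ?thesis using D[of x] x by (auto simp: F_def intro: DERIV_unique)
  qed
  have cover: "S \<subseteq> A \<union> F"
  proof
    fix x assume x: "x \<in> S"
    show "x \<in> A \<union> F"
    proof (cases "D x = 0")
      case True
      hence "flat_at P x" using D[OF x] crit x by (auto simp: critical_points_def)
      thus ?thesis using x by (simp add: F_def)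
    qed (use x in \<open>simp add: A_def\<close>)
  qed
  have "connected S" using S(2) by (rule convex_connected)
  moreover have "A \<inter> F \<inter> S = {}" using flat0 by (auto simp: A_def)
  ultimately have "A \<inter> S = {} \<or> F \<inter> S = {}"
    using connectedD[OF _ \<open>open A\<close> \<open>open F\<close>] cover by blast
  hence "(\<forall>x\<in>S. D x = 0) \<or> (\<forall>x\<in>S. D x \<noteq> 0)"
    using cover flat0 by (auto simp: A_def)
  moreover have "(\<forall>x\<in>S. 0 \<le> D x) \<or> (\<forall>x\<in>S. D x \<le> 0)" if "\<forall>x\<in>S. D x \<noteq> 0"
  proof (rule ccontr)
    assume "\<not> ?thesis"
    then obtain x y where xy: "x \<in> S" "y \<in> S" "D x < 0" "0 < D y" by force
    have "connected (D ` S)" by (rule connected_continuous_image[OF cD \<open>connected S\<close>])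
    hence "0 \<in> D ` S" using xy connected_contains_Icc[of "D ` S" "D x" "D y"] by force
    thus False using that by auto
  qed
  ultimately consider "\<forall>x\<in>S. 0 \<le> D x" | "\<forall>x\<in>S. D x \<le> 0" by force
  thus ?thesis
  proof cases
    case 1
    have "P x \<le> P y" if "x \<in> S" "y \<in> S" "x \<le> y" for x y
      using 1 D seg[OF that(1,2)] by (intro DERIV_nonneg_imp_nondecreasing[OF that(3)]) blast
    thus ?thesis by (auto intro: mono_onI)
  next
    case 2
    have "P y \<le> P x" if "x \<in> S" "y \<in> S" "x \<le> y" for x y
      using 2 D seg[OF that(1,2)] by (intro DERIV_nonpos_imp_nonincreasing[OF that(3)]) blast
    thus ?thesis by (auto intro: monotone_onI)
  qed
qed

text \<open>A monotone P satisfies \<open>\<bar>P y\<bar> \<le> \<bar>P t\<bar>\<close> on one whole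
  side of y, determined by the direction of monotonicity and the sign of P y. Over a cell of width
  \<delta> the exponential varies by at most the factor
  exp(\<open>\<bar>\<alpha>\<bar> * \<delta>\<close>). Both cells appear because the side may change
  with y.\<close>

lemma monotone_local_mass:
  fixes P :: "real \<Rightarrow> real" and \<alpha> \<delta> y :: real
  assumes mono: "mono_on {y - \<delta>..y + \<delta>} P \<or> antimono_on {y - \<delta>..y + \<delta>} P" and \<delta>: "0 < \<delta>"
    and h: "integrable lborel (\<lambda>t. exp (- \<alpha> * t) * P t)"
  shows "\<bar>exp (- \<alpha> * y) * P y\<bar> \<le> exp (\<bar>\<alpha>\<bar> * \<delta>) / \<delta> *
    ((LINT t:{y - \<delta><..y}|lborel. \<bar>exp (- \<alpha> * t) * P t\<bar>) + (LINT t:{y<..y + \<delta>}|lborel. \<bar>exp (- \<alpha> * t) * P t\<bar>))"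
proof -
  define h where "h = (\<lambda>t. \<bar>exp (- \<alpha> * t) * P t\<bar>)"
  have hi: "integrable lborel h" unfolding h_def using assms(3) by (rule integrable_abs)
  have si: "set_integrable lborel A h" if "A \<in> sets lborel" for A
    unfolding set_integrable_def by (rule integrable_mult_indicator[OF that hi])
  have nn: "0 \<le> (LINT t:A|lborel. h t)" for A
    unfolding set_lebesgue_integral_def by (intro Bochner_Integration.integral_nonneg) (auto simp: h_def)
  have pt: "exp (- \<bar>\<alpha>\<bar> * \<delta>) * h y \<le> h t" if "\<bar>P y\<bar> \<le> \<bar>P t\<bar>" "\<bar>t - y\<bar> \<le> \<delta>" for t
  proof -
    have "\<alpha> * (t - y) \<le> \<bar>\<alpha>\<bar> * \<delta>"
      using that(2) mult_mono[of "\<bar>\<alpha>\<bar>" "\<bar>\<alpha>\<bar>" "\<bar>t - y\<bar>" \<delta>] by (auto simp: abs_mult[symmetric] intro: order_trans[OF abs_ge_self])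
    hence "exp (- \<bar>\<alpha>\<bar> * \<delta>) * exp (- \<alpha> * y) \<le> exp (- \<alpha> * t)"
      by (simp add: algebra_simps flip: exp_add)
    hence "exp (- \<bar>\<alpha>\<bar> * \<delta>) * exp (- \<alpha> * y) * \<bar>P y\<bar> \<le> exp (- \<alpha> * t) * \<bar>P t\<bar>"
      using that(1) by (intro mult_mono) auto
    thus ?thesis by (simp add: h_def abs_mult mult.assoc)
  qed
  have mass: "\<delta> * (exp (- \<bar>\<alpha>\<bar> * \<delta>) * h y) \<le> (LINT t:A|lborel. h t)"
    if A: "A = {y - \<delta><..y} \<or> A = {y<..y + \<delta>}" and le: "\<And>t. t \<in> A \<Longrightarrow> \<bar>P y\<bar> \<le> \<bar>P t\<bar>" for A
  proof -
    have As: "A \<in> sets lborel" using A by auto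
    have "(LINT t:A|lborel. exp (- \<bar>\<alpha>\<bar> * \<delta>) * h y) \<le> (LINT t:A|lborel. h t)"
    proof (rule set_integral_mono[OF _ si[OF As]])
      show "set_integrable lborel A (\<lambda>t. exp (- \<bar>\<alpha>\<bar> * \<delta>) * h y)"
        using A \<delta> by (auto simp: set_integrable_def)
      show "exp (- \<bar>\<alpha>\<bar> * \<delta>) * h y \<le> h t" if "t \<in> A" for t
        using le[OF that] that A by (intro pt) auto
    qed
    moreover have "(LINT t:A|lborel. exp (- \<bar>\<alpha>\<bar> * \<delta>) * h y) = \<delta> * (exp (- \<bar>\<alpha>\<bar> * \<delta>) * h y)"
      using A \<delta> by (auto simp: set_lebesgue_integral_def)
    ultimately show ?thesis by (simp only:)
  qed
  have dir: "(\<forall>t\<in>{y<..y + \<delta>}. \<bar>P y\<bar> \<le> \<bar>P t\<bar>) \<or> (\<forall>t\<in>{y - \<delta><..y}. \<bar>P y\<bar> \<le> \<bar>P t\<bar>)"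
    using mono
  proof
    assume m: "mono_on {y - \<delta>..y + \<delta>} P"
    have r: "P y \<le> P t" if "t \<in> {y<..y + \<delta>}" for t using mono_onD[OF m, of y t] that \<delta> by auto
    have l: "P t \<le> P y" if "t \<in> {y - \<delta><..y}" for t using mono_onD[OF m, of t y] that \<delta> by auto
    show ?thesis by (cases "0 \<le> P y") (use r l in fastforce)+
  next
    assume m: "antimono_on {y - \<delta>..y + \<delta>} P"
    have r: "P t \<le> P y" if "t \<in> {y<..y + \<delta>}" for t using monotone_onD[OF m, of y t] that \<delta> by auto
    have l: "P y \<le> P t" if "t \<in> {y - \<delta><..y}" for t using monotone_onD[OF m, of t y] that \<delta> by auto
    show ?thesis by (cases "0 \<le> P y") (use r l in fastforce)+
  qed
  have "\<delta> * (exp (- \<bar>\<alpha>\<bar> * \<delta>) * h y) \<le> (LINT t:{y - \<delta><..y}|lborel. h t) + (LINT t:{y<..y + \<delta>}|lborel. h t)"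
    using dir
  proof
    assume "\<forall>t\<in>{y<..y + \<delta>}. \<bar>P y\<bar> \<le> \<bar>P t\<bar>"
    thus ?thesis using mass[of "{y<..y + \<delta>}"] nn[of "{y - \<delta><..y}"] by auto
  next
    assume "\<forall>t\<in>{y - \<delta><..y}. \<bar>P y\<bar> \<le> \<bar>P t\<bar>"
    thus ?thesis using mass[of "{y - \<delta><..y}"] nn[of "{y<..y + \<delta>}"] by auto
  qed
  hence "exp (\<bar>\<alpha>\<bar> * \<delta>) / \<delta> * (\<delta> * (exp (- \<bar>\<alpha>\<bar> * \<delta>) * h y))
     \<le> exp (\<bar>\<alpha>\<bar> * \<delta>) / \<delta> * ((LINT t:{y - \<delta><..y}|lborel. h t) + (LINT t:{y<..y + \<delta>}|lborel. h t))"
    using \<delta> by (intro mult_left_mono) auto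
  moreover have "exp (\<bar>\<alpha>\<bar> * \<delta>) / \<delta> * (\<delta> * (exp (- \<bar>\<alpha>\<bar> * \<delta>) * h y)) = h y"
    using \<delta> by (simp add: exp_minus)
  ultimately show ?thesis by (simp add: h_def)
qed

text \<open>If \<open>g\<close> increased somewhere beyond all its local maxima, then the last maximum point on a
  sufficiently long interval would be a further one.\<close>

lemma antimono_beyond_local_maxima:
  fixes g :: "real \<Rightarrow> real"
  assumes fin: "finite (local_maxima g S)" and S: "{Y<..} \<subseteq> S"
    and cont: "continuous_on {Y<..} g" and nonneg: "\<And>y. Y < y \<Longrightarrow> 0 \<le> g y" and lim: "(g \<longlongrightarrow> 0) at_top"
  shows "\<exists>Y1. \<forall>x y. Y1 < x \<longrightarrow> x \<le> y \<longrightarrow> g y \<le> g x"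
proof -
  define Y1 where "Y1 = Max (insert Y (local_maxima g S))"
  have Y1: "Y \<le> Y1" "\<And>z. z \<in> local_maxima g S \<Longrightarrow> z \<le> Y1"
    using fin by (auto simp: Y1_def)
  have "g y \<le> g x" if x: "Y1 < x" "x \<le> y" for x y
  proof (rule ccontr)
    assume "\<not> g y \<le> g x"
    hence gt: "g x < g y" by simp
    have "0 < g y" using gt nonneg[of x] x Y1(1) by simp
    hence "\<forall>\<^sub>F s in at_top. g s < g y" by (rule order_tendstoD(2)[OF lim])
    from eventually_happens[OF eventually_conj[OF this eventually_gt_at_top[of y]]]
    obtain s where s: "g s < g y" "y < s" by auto
    \<comment> \<open>As g is smaller at x and at s than at y, no maximum point of g on this
      interval is an end point.\<close>
    have cI: "continuous_on {x..s} g" by (rule continuous_on_subset[OF cont]) (use x Y1 in auto)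
    obtain z0 where z0: "z0 \<in> {x..s}" "\<And>t. t \<in> {x..s} \<Longrightarrow> g t \<le> g z0"
      using continuous_attains_sup[OF compact_Icc _ cI] x s by force
    define Z where "Z = {x..s} \<inter> g -` {g z0}"
    have "closed Z" unfolding Z_def using cI by (intro continuous_closed_preimage) auto
    hence "compact Z" unfolding Z_def by (metis Int_absorb Int_assoc compact_Icc compact_Int_closed)
    moreover have "Z \<noteq> {}" using z0 by (auto simp: Z_def)
    ultimately obtain z where z: "z \<in> Z" "\<And>t. t \<in> Z \<Longrightarrow> t \<le> z"
      by (meson compact_attains_sup)
    have gz: "g z = g z0" "z \<in> {x..s}" using z by (auto simp: Z_def)
    have "g y \<le> g z" using z0(2)[of y] x s gz by auto
    hence zx: "x < z" "z < s" using gz gt s by (auto simp: less_le)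
    have "\<forall>\<^sub>F t in nhds z. t \<in> {x<..<s}" using zx by (intro eventually_nhds_in_open) auto
    hence "\<forall>\<^sub>F t in nhds z. g t \<le> g z" by eventually_elim (use z0(2) gz in auto)
    \<comment> \<open>z is the last maximum point, so g does not take the value g z anywhere between
      z and s.\<close>
    moreover have "\<not> flat_at g z"
    proof
      assume "flat_at g z"
      hence "\<forall>\<^sub>F t in at_right z. g t = g z" unfolding flat_at_def by (rule filter_leD[OF at_within_le_nhds])
      moreover have "\<forall>\<^sub>F t in at_right z. t \<in> {z<..<s}" by (rule eventually_at_right_real[OF zx(2)])
      ultimately have "\<forall>\<^sub>F t in at_right z. False"
      proof eventually_elim
        case (elim t)
        hence "t \<in> Z" using gz zx by (auto simp: Z_def)
        from z(2)[OF this] elim show False by auto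
      qed
      thus False by simp
    qed
    ultimately have "z \<in> local_maxima g S" using S x Y1 zx by (auto simp: local_maxima_def)
    from Y1(2)[OF this] x zx show False by simp
  qed
  thus ?thesis by blast
qed

lemma eventually_nhds_minus:
  "(\<forall>\<^sub>F z in nhds (y::real). Q (- z)) \<longleftrightarrow> (\<forall>\<^sub>F z in nhds (- y). Q z)"
  by (simp add: filtermap_nhds_minus[symmetric] eventually_filtermap)

lemma local_maxima_minus:
  "local_maxima (\<lambda>y. g (- y)) (uminus ` S) = uminus ` local_maxima g S"
proof -
  have "flat_at (\<lambda>y. g (- y)) y \<longleftrightarrow> flat_at g (- y)" for y
    unfolding flat_at_def using eventually_nhds_minus[of "\<lambda>z. g z = g (- y)" y] by simp
  moreover have "(\<forall>\<^sub>F z in nhds y. g (- z) \<le> g (- y)) \<longleftrightarrow> (\<forall>\<^sub>F z in nhds (- y). g z \<le> g (- y))" for y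
    using eventually_nhds_minus[of "\<lambda>z. g z \<le> g (- y)" y] by simp
  ultimately show ?thesis
    by (auto simp: local_maxima_def image_iff)
qed

context grid_tail
begin

lemma G_bound:
  assumes "good Y" "Y < y"
  shows "0 \<le> G y" "G y \<le> (1 + 2 * \<epsilon>D) * (B + \<epsilon>V) / y"
proof -
  have y: "Y0 < y" "1 < y" using assms unfolding good_def by auto
  note D = density_bound_le[OF assms(1), of y]
  have P: "0 \<le> p y + \<epsilon>V / y" using p(2) \<epsilon> y by simp
  show "0 \<le> G y" unfolding G_def using D P assms by simp
  have "\<epsilon>V / y \<le> \<epsilon>V / 1" using y \<epsilon> by (intro divide_left_mono) auto
  hence "G y \<le> (1 + 2 * \<epsilon>D) / y * (B + \<epsilon>V)"
    unfolding G_def using D P assms p_le[OF y(1)] \<epsilon> y by (intro mult_mono) auto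
  thus "G y \<le> (1 + 2 * \<epsilon>D) * (B + \<epsilon>V) / y" by simp
qed

text \<open>g stands for the function with the jump-adjusted payoff whose local maxima are known to
  be finite in number; it agrees with G only far out, which is enough for eventual
  monotonicity.\<close>

lemma G_eventually_antimono:
  assumes fin: "finite (local_maxima g ({0<..} \<inter> {1 + \<mu><..}))"
    and eq: "\<And>y. Y0 < y \<Longrightarrow> \<bar>\<mu>\<bar> < y \<Longrightarrow> g y = G y" and cont: "continuous_on {Y0<..} p"
  shows "\<exists>Y1. \<forall>x y. Y1 < x \<longrightarrow> x \<le> y \<longrightarrow> G y \<le> G x"
proof -
  obtain Y where Y: "good Y" using good_exists by blast
  have Y': "Y0 \<le> Y" "1 \<le> Y" "2 * \<bar>\<mu>\<bar> + 1 \<le> Y" using Y unfolding good_def by auto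
  have g: "g y = G y" if "Y < y" for y using that Y' by (intro eq) auto
  have "\<exists>Y1. \<forall>x y. Y1 < x \<longrightarrow> x \<le> y \<longrightarrow> g y \<le> g x"
  proof (rule antimono_beyond_local_maxima[OF fin])
    show "{Y<..} \<subseteq> {0<..} \<inter> {1 + \<mu><..}" using Y' by auto
    have "continuous_on {Y<..} p" by (rule continuous_on_subset[OF cont]) (use Y' in auto)
    hence "continuous_on {Y<..} G"
      unfolding G_def density_bound_def using Y' by (intro continuous_intros) auto
    thus "continuous_on {Y<..} g" by (rule continuous_on_cong[THEN iffD1, rotated -1]) (auto simp: g)
    show "0 \<le> g y" if "Y < y" for y using G_bound[OF Y that] g[OF that] by simp
    show "(g \<longlongrightarrow> 0) at_top"
    proof (rule Lim_null_comparison)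
      show "\<forall>\<^sub>F y in at_top. norm (g y) \<le> (1 + 2 * \<epsilon>D) * (B + \<epsilon>V) / y"
        using eventually_gt_at_top[of Y] by eventually_elim (use G_bound[OF Y] g in auto)
      show "((\<lambda>y. (1 + 2 * \<epsilon>D) * (B + \<epsilon>V) / y) \<longlongrightarrow> 0) at_top"
        by (intro tendsto_divide_0[OF tendsto_const] filterlim_at_top_imp_at_infinity filterlim_ident)
    qed
  qed
  then obtain Y1 where Y1: "\<And>x y. Y1 < x \<Longrightarrow> x \<le> y \<Longrightarrow> g y \<le> g x" by blast
  have "G y \<le> G x" if "max Y1 Y < x" "x \<le> y" for x y
    using Y1[of x y] that g[of x] g[of y] by auto
  thus ?thesis by blast
qed

end

text \<open>Divided by U^(\<gamma> - 1) exp(- \<kappa> U), the factor without the norm tends to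
  exp(\<kappa> \<mu>) / \<kappa>, which is positive. N is quantified inside because the supremum
  norm over the tail varies with U while staying in a fixed range. Nonnegativity allows the term to
  be added to a bound that holds without it.\<close>

lemma exp_part_bound:
  fixes \<kappa> \<mu> \<gamma> W B \<epsilon>V :: real
  assumes \<kappa>: "0 < \<kappa>" and W: "0 \<le> W" and B: "0 \<le> B" "0 \<le> \<epsilon>V"
  shows "\<exists>c. \<forall>\<^sub>F U in at_top. \<forall>N. 0 \<le> N \<and> N \<le> B \<longrightarrow>
    (let E = W * (N + \<epsilon>V / U) * ((U - \<mu>) powr (\<gamma> - 1) * exp (- \<kappa> * (U - \<mu>)) / (\<kappa> - (\<gamma> - 1) / (U - \<mu>)))
     in 0 \<le> E \<and> E \<le> c * (U powr (\<gamma> - 1) * exp (- \<kappa> * U)))"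
proof -
  define q where "q = (\<lambda>U. (U - \<mu>) powr (\<gamma> - 1) * exp (- \<kappa> * (U - \<mu>)) / (\<kappa> - (\<gamma> - 1) / (U - \<mu>)))"
  define r where "r = (\<lambda>U. U powr (\<gamma> - 1) * exp (- \<kappa> * U))"
  have l: "((\<lambda>U. q U / r U) \<longlongrightarrow> exp (\<kappa> * \<mu>) / \<kappa>) at_top"
  proof -
    have "((\<lambda>U. exp (\<kappa> * \<mu>) * ((U - \<mu>) powr (\<gamma> - 1) / U powr (\<gamma> - 1)) / (\<kappa> - (\<gamma> - 1) / (U - \<mu>)))
        \<longlongrightarrow> exp (\<kappa> * \<mu>) * 1 / (\<kappa> - 0)) at_top"
      using \<kappa> by (intro tendsto_intros) (real_asymp+, simp)
    moreover have "q U / r U = exp (\<kappa> * \<mu>) * ((U - \<mu>) powr (\<gamma> - 1) / U powr (\<gamma> - 1)) / (\<kappa> - (\<gamma> - 1) / (U - \<mu>))" for U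
    proof -
      have "exp (- \<kappa> * (U - \<mu>)) = exp (\<kappa> * \<mu>) * exp (- \<kappa> * U)"
        by (simp add: algebra_simps flip: exp_add)
      thus ?thesis by (simp add: q_def r_def mult_ac)
    qed
    ultimately show ?thesis by simp
  qed
  define c0 where "c0 = exp (\<kappa> * \<mu>) / \<kappa> + 1"
  have "\<forall>\<^sub>F U in at_top. q U / r U < c0" "\<forall>\<^sub>F U in at_top. 0 < q U / r U"
    by (rule order_tendstoD[OF l], use \<kappa> in \<open>simp add: c0_def\<close>)+
  moreover have "\<forall>\<^sub>F U::real in at_top. 1 < U" by (rule eventually_gt_at_top)
  ultimately have "\<forall>\<^sub>F U in at_top. \<forall>N. 0 \<le> N \<and> N \<le> B \<longrightarrow>
    0 \<le> W * (N + \<epsilon>V / U) * q U \<and> W * (N + \<epsilon>V / U) * q U \<le> (W * (B + \<epsilon>V) * c0) * r U"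
  proof eventually_elim
    case (elim U)
    have r: "0 < r U" using elim by (simp add: r_def)
    have q: "0 < q U" "q U \<le> c0 * r U" using elim r by (auto simp: zero_less_divide_iff divide_simps)
    show ?case
    proof (intro allI impI conjI; elim conjE)
      fix N assume N: "0 \<le> N" "N \<le> B"
      show "0 \<le> W * (N + \<epsilon>V / U) * q U" using W N B q elim by simp
      have "\<epsilon>V / U \<le> \<epsilon>V / 1" using elim B by (intro divide_left_mono) auto
      hence "W * (N + \<epsilon>V / U) * q U \<le> W * (B + \<epsilon>V) * (c0 * r U)"
        using W N B q elim by (intro mult_mono) auto
      thus "W * (N + \<epsilon>V / U) * q U \<le> (W * (B + \<epsilon>V) * c0) * r U" by (simp add: mult.assoc)
    qed
  qed
  thus ?thesis unfolding Let_def q_def r_def by blast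
qed

text \<open>Only finitely many integers lie strictly between 0 and u0, and w is positive there, so
  the largest quotient enlarges the constant.\<close>

lemma eventual_bound_patch:
  fixes \<Phi> w :: "int \<Rightarrow> real"
  assumes ev: "\<And>u. u0 \<le> u \<Longrightarrow> \<Phi> u \<le> K * w u" and w: "\<And>u. 0 < u \<Longrightarrow> 0 < w u"
  shows "\<exists>K. \<forall>u>0. \<Phi> u \<le> K * w u"
proof -
  \<comment> \<open>The inserted 0 keeps the maximum meaningful when there is no integer between 0
    and u0.\<close>
  define K' where "K' = max K (Max (insert 0 ((\<lambda>u. \<Phi> u / w u) ` {0<..<u0})))"
  have "\<Phi> u \<le> K' * w u" if u: "0 < u" for u
  proof (cases "u0 \<le> u")
    case True
    have "\<Phi> u \<le> K * w u" by (rule ev[OF True])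
    also have "\<dots> \<le> K' * w u" using w[OF u] by (intro mult_right_mono) (auto simp: K'_def)
    finally show ?thesis .
  next
    case False
    have "\<Phi> u / w u \<le> Max (insert 0 ((\<lambda>u. \<Phi> u / w u) ` {0<..<u0}))"
      using False u by (intro Max_ge) auto
    also have "\<dots> \<le> K'" by (simp add: K'_def)
    finally show ?thesis using w[OF u] by (simp add: divide_le_eq)
  qed
  thus ?thesis by blast
qed

text \<open>Two degenerate values have to be excluded: on a null set the essential supremum would be
  minus infinity, and an infinite supremum would be mapped to 0 by
  \<open>real_of_ereal\<close>.\<close>

lemma Linf_norm_bounds:
  fixes h :: "real \<Rightarrow> real"
  assumes h: "h \<in> borel_measurable lborel" and S: "S \<in> sets lborel" "emeasure lborel S \<noteq> 0"
    and B: "\<And>y. y \<in> S \<Longrightarrow> \<bar>h y\<bar> \<le> B"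
  shows "0 \<le> Linf_norm_on S h" "Linf_norm_on S h \<le> B"
proof -
  let ?M = "restrict_space lborel S"
  have m: "(\<lambda>y. ereal \<bar>h y\<bar>) \<in> borel_measurable ?M"
  proof (rule measurable_restrict_space1)
    have [measurable]: "h \<in> borel_measurable borel" using h by simp
    show "(\<lambda>y. ereal \<bar>h y\<bar>) \<in> borel_measurable lborel" by measurable
  qed
  have sp: "space ?M = S" by (simp add: space_restrict_space)
  have up: "esssup ?M (\<lambda>y. ereal \<bar>h y\<bar>) \<le> ereal B"
    by (rule esssup_I[OF m]) (auto intro!: AE_I2 simp: sp B)
  have "emeasure ?M (space ?M) \<noteq> 0"
    using S by (simp add: sp emeasure_restrict_space)
  hence "esssup ?M (\<lambda>y. 0::ereal) = 0" by (rule esssup_const)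
  moreover have "esssup ?M (\<lambda>y. 0::ereal) \<le> esssup ?M (\<lambda>y. ereal \<bar>h y\<bar>)"
    by (rule esssup_mono) (use m in auto)
  ultimately have lo: "0 \<le> esssup ?M (\<lambda>y. ereal \<bar>h y\<bar>)" by simp
  show "0 \<le> Linf_norm_on S h" unfolding Linf_norm_on_def using lo by (rule real_of_ereal_pos)
  show "Linf_norm_on S h \<le> B" unfolding Linf_norm_on_def using lo up
    by (cases "esssup ?M (\<lambda>y. ereal \<bar>h y\<bar>)") auto
qed

section \<open>The two tails\<close>

lemma grid_pos_iff [simp]: "0 < grid m u \<longleftrightarrow> 0 < u"
  using grid_less_iff[of m 0 u] by (simp add: grid_def)

context grid_tail
begin

text \<open>The norm enters as a parameter N, since in the reflected instance it is taken over {..-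
  U}.\<close>

definition exp_bound :: "(real \<Rightarrow> real) \<Rightarrow> real \<Rightarrow> real" where
  "exp_bound N U = C * exp (\<alpha> * \<mu>) * (N U + \<epsilon>V / \<bar>U\<bar>)
     * (\<bar>U - \<mu>\<bar> powr (\<gamma> - 1) * exp (- \<kappa> * \<bar>U - \<mu>\<bar>) / (\<kappa> - (\<gamma> - 1) / \<bar>U - \<mu>\<bar>))"

definition alg_bound :: "real \<Rightarrow> real" where
  "alg_bound U = \<epsilon>D * ((LINT t:{U..}|lborel. p t) + \<epsilon>V) * max (1 / \<bar>U\<bar>) (1 / \<bar>U - \<mu>\<bar>)"

lemma eventually_grid:
  assumes "\<forall>\<^sub>F U in at_top. Q U"
  shows "\<exists>u0. \<forall>u\<ge>u0. Q (grid m u)"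
proof -
  obtain Y where Y: "\<And>U. Y \<le> U \<Longrightarrow> Q U" using assms unfolding eventually_at_top_linorder by blast
  have "Y \<le> grid m u" if "\<lceil>Y * 2 powi m\<rceil> \<le> u" for u
  proof -
    have "Y * 2 powi m \<le> real_of_int u" using that by (simp add: ceiling_le_iff)
    thus ?thesis unfolding grid_def by (subst pos_le_divide_eq) auto
  qed
  thus ?thesis using Y by blast
qed

text \<open>All three estimates are first obtained for large u, where exp_bound is nonnegative and
  may be added to the bound of \<open>tail_sum_le\<close>; the patch then carries each of them to
  every u > 0.\<close>

lemma one_sided_bounds:
  assumes fin: "finite (local_maxima g ({0<..} \<inter> {1 + \<mu><..}))"
    and eq: "\<And>y. Y0 < y \<Longrightarrow> \<bar>\<mu>\<bar> < y \<Longrightarrow> g y = G y" and cont: "continuous_on {Y0<..} p"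
    and N: "\<And>U. Y0 < U \<Longrightarrow> 0 \<le> N U \<and> N U \<le> B"
  shows "\<exists>K c. \<forall>u>0.
     (\<Sum>\<^sub>\<infinity>k\<in>{u<..}. \<bar>d k * v k\<bar>) \<le> exp_bound N (grid m u) + alg_bound (grid m u) + K / (grid m u)\<^sup>2 \<and>
     exp_bound N (grid m u) \<le> c * (grid m u powr (\<gamma> - 1) * exp (- \<kappa> * grid m u)) \<and>
     alg_bound (grid m u) \<le> c / grid m u"
proof -
  have W: "0 \<le> C * exp (\<alpha> * \<mu>)" using C by simp
  obtain c1 where c1: "\<forall>\<^sub>F U in at_top. \<forall>N. 0 \<le> N \<and> N \<le> B \<longrightarrow>
    (let E = C * exp (\<alpha> * \<mu>) * (N + \<epsilon>V / U) * ((U - \<mu>) powr (\<gamma> - 1) * exp (- \<kappa> * (U - \<mu>)) / (\<kappa> - (\<gamma> - 1) / (U - \<mu>)))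
     in 0 \<le> E \<and> E \<le> c1 * (U powr (\<gamma> - 1) * exp (- \<kappa> * U)))"
    using exp_part_bound[OF \<kappa> W B_nonneg \<epsilon>(2)] by blast
  have "\<forall>\<^sub>F U in at_top. 0 \<le> exp_bound N U \<and> exp_bound N U \<le> c1 * (U powr (\<gamma> - 1) * exp (- \<kappa> * U))"
    using c1 eventually_gt_at_top[of "max Y0 \<bar>\<mu>\<bar>"]
  proof eventually_elim
    case (elim U)
    thus ?case using N[of U] by (auto simp: exp_bound_def Let_def)
  qed
  then obtain u1 where u1: "\<And>u. u1 \<le> u \<Longrightarrow> 0 \<le> exp_bound N (grid m u) \<and>
      exp_bound N (grid m u) \<le> c1 * (grid m u powr (\<gamma> - 1) * exp (- \<kappa> * grid m u))"
    using eventually_grid by blast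
  have "\<forall>\<^sub>F U in at_top. alg_bound U \<le> (2 * \<epsilon>D * (I + \<epsilon>V)) * (1 / U)"
    using eventually_gt_at_top[of "2 * \<bar>\<mu>\<bar>"]
  proof eventually_elim
    case (elim U)
    have "1 / \<bar>U - \<mu>\<bar> \<le> 1 / (U / 2)" using elim by (intro divide_left_mono) auto
    moreover have "1 / \<bar>U\<bar> \<le> 2 / U" using elim by (simp add: divide_right_mono)
    ultimately have mx: "max (1 / \<bar>U\<bar>) (1 / \<bar>U - \<mu>\<bar>) \<le> 2 / U" by simp
    have "alg_bound U \<le> \<epsilon>D * (I + \<epsilon>V) * (2 / U)"
      unfolding alg_bound_def using \<epsilon> mx I_nonneg elim
      by (intro mult_mono add_right_mono set_p_le mult_left_mono) (auto simp: le_max_iff_disj)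
    thus ?case by (simp add: mult_ac)
  qed
  then obtain u2 where u2: "\<And>u. u2 \<le> u \<Longrightarrow> alg_bound (grid m u) \<le> (2 * \<epsilon>D * (I + \<epsilon>V)) * (1 / grid m u)"
    using eventually_grid by blast
  obtain Y1 where "\<And>x y. Y1 < x \<Longrightarrow> x \<le> y \<Longrightarrow> G y \<le> G x"
    using G_eventually_antimono[OF fin eq cont] by blast
  from tail_sum_le[OF this] obtain K' u3 where u3: "\<And>u. u3 \<le> u \<Longrightarrow>
     (\<Sum>\<^sub>\<infinity>k\<in>{u<..}. \<bar>d k * v k\<bar>) \<le> alg_bound (grid m u) + K' / (grid m u)\<^sup>2"
    unfolding alg_bound_def by blast
  \<comment> \<open>For small u the denominator in exp_bound may be negative or zero. The whole
    difference is then just one of finitely many real numbers absorbed into K.\<close>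
  have "\<exists>K. \<forall>u>0. (\<Sum>\<^sub>\<infinity>k\<in>{u<..}. \<bar>d k * v k\<bar>) - exp_bound N (grid m u) - alg_bound (grid m u) \<le> K * (1 / (grid m u)\<^sup>2)"
  proof (rule eventual_bound_patch[of "max u1 u3"])
    fix u assume "max u1 u3 \<le> u"
    thus "(\<Sum>\<^sub>\<infinity>k\<in>{u<..}. \<bar>d k * v k\<bar>) - exp_bound N (grid m u) - alg_bound (grid m u) \<le> K' * (1 / (grid m u)\<^sup>2)"
      using u1[of u] u3[of u] by simp
  qed (simp add: less_imp_neq[THEN not_sym])
  then obtain K where K: "\<And>u. 0 < u \<Longrightarrow> (\<Sum>\<^sub>\<infinity>k\<in>{u<..}. \<bar>d k * v k\<bar>) - exp_bound N (grid m u) - alg_bound (grid m u) \<le> K * (1 / (grid m u)\<^sup>2)"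
    by blast
  have "\<exists>c. \<forall>u>0. exp_bound N (grid m u) \<le> c * (grid m u powr (\<gamma> - 1) * exp (- \<kappa> * grid m u))"
    by (rule eventual_bound_patch[of u1]) (use u1 in \<open>auto simp: less_imp_neq[THEN not_sym]\<close>)
  then obtain c2 where c2: "\<And>u. 0 < u \<Longrightarrow> exp_bound N (grid m u) \<le> c2 * (grid m u powr (\<gamma> - 1) * exp (- \<kappa> * grid m u))"
    by blast
  have "\<exists>c. \<forall>u>0. alg_bound (grid m u) \<le> c * (1 / grid m u)"
    by (rule eventual_bound_patch[of u2, OF u2]) auto
  then obtain c3 where c3: "\<And>u. 0 < u \<Longrightarrow> alg_bound (grid m u) \<le> c3 * (1 / grid m u)" by blast
  show ?thesis
  proof (rule exI[of _ K], rule exI[of _ "max c2 c3"], intro allI impI conjI)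
    fix u :: int assume u: "0 < u"
    show "(\<Sum>\<^sub>\<infinity>k\<in>{u<..}. \<bar>d k * v k\<bar>) \<le> exp_bound N (grid m u) + alg_bound (grid m u) + K / (grid m u)\<^sup>2"
      using K[OF u] by simp
    have "c2 * (grid m u powr (\<gamma> - 1) * exp (- \<kappa> * grid m u)) \<le> max c2 c3 * (grid m u powr (\<gamma> - 1) * exp (- \<kappa> * grid m u))"
      by (intro mult_right_mono) auto
    thus "exp_bound N (grid m u) \<le> max c2 c3 * (grid m u powr (\<gamma> - 1) * exp (- \<kappa> * grid m u))"
      using c2[OF u] by linarith
    have "c3 * (1 / grid m u) \<le> max c2 c3 * (1 / grid m u)" using u by (intro mult_right_mono) (auto intro: less_imp_le)
    thus "alg_bound (grid m u) \<le> max c2 c3 / grid m u" using c3[OF u] by simp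
  qed
qed

end

lemma payoff_regularity:
  assumes "piecewise_C1 P" "finite (critical_points P)"
  obtains Y where "0 \<le> Y" "\<And>y. Y < \<bar>y\<bar> \<Longrightarrow> isCont P y"
    "mono_on {Y<..} P \<or> antimono_on {Y<..} P" "mono_on {..<- Y} P \<or> antimono_on {..<- Y} P"
proof -
  obtain X where X: "finite X" "P C1_differentiable_on (UNIV - X)"
    using assms(1) unfolding piecewise_C1_def by blast
  define Y where "Y = Max (insert 0 (abs ` (X \<union> critical_points P)))"
  have Y: "0 \<le> Y" "\<And>x. x \<in> X \<union> critical_points P \<Longrightarrow> \<bar>x\<bar> \<le> Y"
    unfolding Y_def using X(1) assms(2) by (intro Max_ge; simp)+
  have c: "isCont P y" if "Y < \<bar>y\<bar>" for y
  proof -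
    have "y \<in> UNIV - X" using Y(2)[of y] that by auto
    thus ?thesis using X(2) unfolding C1_differentiable_on_def
      by (blast intro: has_vector_derivative_continuous)
  qed
  have m: "mono_on S P \<or> antimono_on S P" if "open S" "convex S" "\<And>x. x \<in> S \<Longrightarrow> Y < \<bar>x\<bar>" for S
  proof (rule no_critical_points_monotone[OF that(1,2)])
    show "P C1_differentiable_on S"
      using X(2) by (rule C1_differentiable_on_subset) (use Y(2) that(3) in force)
    show "S \<inter> critical_points P = {}" using Y(2) that(3) by force
  qed
  show ?thesis
    by (rule that[OF Y(1) c m m]) (use Y(1) in auto)
qed

text \<open>Damping shifts the argument of the transform off the real axis, so \<epsilon>V is the
  band edge value of the damped payoff.\<close>

lemma fourier_damp_payoff:
  "fourier P (of_real r - \<i> * of_real \<alpha>) = fourier (damp_payoff \<alpha> P) (of_real r)"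
  unfolding fourier_def damp_payoff_def
proof (rule Bochner_Integration.integral_cong[OF refl])
  fix y :: real
  have eq: "- \<i> * (of_real r - \<i> * of_real \<alpha>) * complex_of_real y = of_real (- \<alpha> * y) + - \<i> * of_real r * of_real y"
    by (simp add: algebra_simps)
  show "of_real (P y) * exp (- \<i> * (of_real r - \<i> * of_real \<alpha>) * of_real y)
      = of_real (exp (- \<alpha> * y) * P y) * exp (- \<i> * of_real r * of_real y)"
    unfolding eq exp_add exp_of_real by simp
qed

lemma emeasure_lborel_half_line:
  "emeasure lborel {a::real..} \<noteq> 0" "emeasure lborel {..a::real} \<noteq> 0"
proof -
  have "emeasure lborel {a..a + 1} \<le> emeasure lborel {a..}" by (rule emeasure_mono) auto
  thus "emeasure lborel {a..} \<noteq> 0" by auto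
  have "emeasure lborel {a - 1..a} \<le> emeasure lborel {..a}" by (rule emeasure_mono) auto
  thus "emeasure lborel {..a} \<noteq> 0" by auto
qed

section \<open>Infinite sums over the two tails of the integers\<close>

lemma infsum_ennreal_le:
  assumes "g summable_on A" "\<And>k. 0 \<le> g k" "infsum g A \<le> (b::real)"
  shows "(\<Sum>\<^sub>\<infinity>k\<in>A. ennreal (g k)) \<le> ennreal b"
proof (rule infsum_le_finite_sums)
  fix F assume F: "finite F" "F \<subseteq> A"
  have "sum g F \<le> infsum g A" by (rule finite_sum_le_infsum) (use assms F in auto)
  hence "sum g F \<le> b" using assms(3) by linarith
  thus "(\<Sum>k\<in>F. ennreal (g k)) \<le> ennreal b" using assms(2) by (simp add: ennreal_leI)
qed (rule nonneg_summable_on_complete, simp)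

lemma infsum_lessThan_minus: "(\<Sum>\<^sub>\<infinity>k\<in>{..<l::int}. g k) = (\<Sum>\<^sub>\<infinity>k\<in>{- l<..}. g (- k))"
  by (rule infsum_reindex_bij_witness[of _ uminus uminus]) auto

lemma summable_lessThan_minus: "g summable_on {..<l::int} \<longleftrightarrow> (\<lambda>k. g (- k)) summable_on {- l<..}"
  by (rule summable_on_reindex_bij_witness[of _ uminus uminus]) auto

lemma summable_two_tails:
  fixes g :: "int \<Rightarrow> real"
  assumes "g summable_on {u<..}" "(\<lambda>k. g (- k)) summable_on {w<..}"
  shows "g summable_on UNIV"
proof -
  have "g summable_on {..<- w}" using assms(2) by (simp add: summable_lessThan_minus)
  hence "g summable_on ({u<..} \<union> {..<- w} \<union> {- w..u})"
    by (intro summable_on_union assms(1)) auto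
  moreover have "{u<..} \<union> {..<- w} \<union> {- w..u} = UNIV" by auto
  ultimately show ?thesis by simp
qed

lemma truncation_error_le:
  fixes g :: "int \<Rightarrow> real"
  assumes s: "(\<lambda>k. \<bar>g k\<bar>) summable_on UNIV" and lu: "l \<le> u"
  shows "\<bar>(\<Sum>\<^sub>\<infinity>k\<in>UNIV. g k) - (\<Sum>k=l..u. g k)\<bar> \<le> (\<Sum>\<^sub>\<infinity>k\<in>{..<l}. \<bar>g k\<bar>) + (\<Sum>\<^sub>\<infinity>k\<in>{u<..}. \<bar>g k\<bar>)"
proof -
  have sA: "(\<lambda>k. \<bar>g k\<bar>) summable_on A" for A by (rule summable_on_subset_banach[OF s]) simp
  have gA: "g summable_on A" for A
    by (rule Infinite_Sum.abs_summable_summable) (simp add: sA)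
  have b: "\<bar>infsum g A\<bar> \<le> (\<Sum>\<^sub>\<infinity>k\<in>A. \<bar>g k\<bar>)" for A
    using norm_infsum_bound[of g A] sA by simp
  have U: "UNIV = ({..<l} \<union> {u<..}) \<union> {l..u}" by auto
  have "(\<Sum>\<^sub>\<infinity>k\<in>UNIV. g k) = infsum g ({..<l} \<union> {u<..}) + infsum g {l..u}"
    by (subst U, rule infsum_Un_disjoint[OF gA gA]) auto
  also have "infsum g ({..<l} \<union> {u<..}) = infsum g {..<l} + infsum g {u<..}"
    by (rule infsum_Un_disjoint[OF gA gA]) (use lu in auto)
  finally show ?thesis using b[of "{..<l}"] b[of "{u<..}"] by simp
qed

text \<open>K and c are fixed before u and l, so the remainders and the two decay regimes are
  uniform in the truncation points. Summability stands outside the premises on local maxima, as it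
  rests on the payoff values instead of on G.\<close>

theorem corollary4p5:
  fixes m :: int and f P :: "real \<Rightarrow> real"
    and \<alpha> \<mu> a b \<gamma>p \<gamma>m Cp Cm \<epsilon>D \<epsilon>V :: real
    and Gp Gm Ep Em Ap Am :: "real \<Rightarrow> real" and Yp Ym :: "real set"
  assumes dens: "prob_density f"
    and standing: "standing_assumptions f P \<alpha>"
    and A_f: "assumption_A (damp_density \<alpha> f) (a + \<alpha>) (b - \<alpha>) \<gamma>m \<gamma>p"
    and A_P: "\<exists>a' b' \<gamma>m' \<gamma>p'. assumption_A (damp_payoff \<alpha> P) a' b' \<gamma>m' \<gamma>p'"
    and B_f: "assumption_B m (damp_density \<alpha> f)"
    and B_P: "assumption_B m (damp_payoff \<alpha> P)"
    and eps_D: "\<epsilon>D = \<bar>Im (fourier f (complex_of_real (2 powi m * pi) + \<i> * complex_of_real \<alpha>))\<bar> / pi"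
    and eps_V: "\<epsilon>V = \<bar>Im (fourier P (complex_of_real (2 powi m * pi) - \<i> * complex_of_real \<alpha>))\<bar> / pi"
    and C_pos: "0 < Cp" "0 < Cm"
    and D_right: "\<exists>K. \<forall>k. 1 < grid m k - \<mu> \<longrightarrow>
           \<bar>coeff_D m \<alpha> f k\<bar> \<le> 2 powr (- real_of_int m / 2) *
             (density_bound Cp \<alpha> \<mu> (b - \<alpha>) \<gamma>p \<epsilon>D (grid m k - \<mu>) + K / (grid m k - \<mu>)\<^sup>2)"
    and D_left: "\<exists>K. \<forall>k. grid m k - \<mu> < - 1 \<longrightarrow>
           \<bar>coeff_D m \<alpha> f k\<bar> \<le> 2 powr (- real_of_int m / 2) *
             (density_bound Cm \<alpha> \<mu> (a + \<alpha>) \<gamma>m \<epsilon>D \<bar>grid m k - \<mu>\<bar> + K / (grid m k - \<mu>)\<^sup>2)"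
    and Gp: "Gp = G_fun m P Cp \<alpha> \<mu> (b - \<alpha>) \<gamma>p \<epsilon>D \<epsilon>V"
    and Gm: "Gm = G_fun m P Cm \<alpha> \<mu> (a + \<alpha>) \<gamma>m \<epsilon>D \<epsilon>V"
    and Yp: "Yp = local_maxima Gp ({0<..} \<inter> {1 + \<mu><..})"
    and Ym: "Ym = local_maxima Gm ({..<0} \<inter> {..<\<mu> - 1})"
    and Ep: "Ep = (\<lambda>U. exp_term P Cp \<alpha> \<mu> (b - \<alpha>) \<gamma>p \<epsilon>V {U..} U)"
    and Ap: "Ap = (\<lambda>U. alg_term P \<alpha> \<mu> \<epsilon>D \<epsilon>V {U..} U)"
    and Em: "Em = (\<lambda>L. exp_term P Cm \<alpha> \<mu> (a + \<alpha>) \<gamma>m \<epsilon>V {..L} L)"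
    and Am: "Am = (\<lambda>L. alg_term P \<alpha> \<mu> \<epsilon>D \<epsilon>V {..L} L)"
  shows
    "(finite Yp \<longrightarrow>
        (\<exists>K c. \<forall>u. let U = grid m u in
           Max ({0, \<mu> + 1, \<mu> + (\<gamma>p - 1) / (b - \<alpha>)} \<union> Yp) < U \<longrightarrow>
             tail_plus m \<alpha> f P u \<le> ennreal (Ep U + Ap U + K / U\<^sup>2) \<and>
             Ep U \<le> c * (U powr (\<gamma>p - 1) * exp (- (b - \<alpha>) * U)) \<and>
             Ap U \<le> c / U)) \<and>
     (finite Ym \<longrightarrow>
        (\<exists>K c. \<forall>l. let L = grid m l in
           L < Min ({0, \<mu> - 1, \<mu> - (\<gamma>m - 1) / (a + \<alpha>)} \<union> Ym) \<longrightarrow>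
             tail_minus m \<alpha> f P l \<le> ennreal (Em L + Am L + K / L\<^sup>2) \<and>
             Em L \<le> c * (\<bar>L\<bar> powr (\<gamma>m - 1) * exp (- (a + \<alpha>) * \<bar>L\<bar>)) \<and>
             Am L \<le> c / \<bar>L\<bar>)) \<and>
     (\<lambda>k. coeff_D m \<alpha> f k * coeff_V m \<alpha> P k) summable_on UNIV \<and>
     (finite Yp \<and> finite Ym \<longrightarrow>
        (\<exists>K. \<forall>l u. let L = grid m l; U = grid m u in
           Max ({0, \<mu> + 1, \<mu> + (\<gamma>p - 1) / (b - \<alpha>)} \<union> Yp) < U \<and>
           L < Min ({0, \<mu> - 1, \<mu> - (\<gamma>m - 1) / (a + \<alpha>)} \<union> Ym) \<longrightarrow>
             truncation_error m \<alpha> f P l u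
               \<le> Em L + Am L + K / L\<^sup>2 + (Ep U + Ap U + K / U\<^sup>2)))"
proof -
  define h where "h = damp_payoff \<alpha> P"
  define \<delta> where "\<delta> = 1 / (2::real) powi m"
  define d where "d = coeff_D m \<alpha> f"
  define v where "v = coeff_V m \<alpha> P"
  have \<delta>: "0 < \<delta>" by (simp add: \<delta>_def)
  have \<kappa>: "0 < a + \<alpha>" "0 < b - \<alpha>" using A_f unfolding assumption_A_def by blast+
  have \<epsilon>: "0 \<le> \<epsilon>D" "0 \<le> \<epsilon>V" by (simp_all add: eps_D eps_V)
  have h: "integrable lborel h"
    using standing by (simp add: standing_assumptions_def delta_V_def delta_P_def h_def)
  have h_exp: "h = (\<lambda>y. exp (- \<alpha> * y) * P y)" by (simp add: h_def damp_payoff_def)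
  obtain Y where Y: "0 \<le> Y" "\<And>y. Y < \<bar>y\<bar> \<Longrightarrow> isCont P y"
    "mono_on {Y<..} P \<or> antimono_on {Y<..} P" "mono_on {..<- Y} P \<or> antimono_on {..<- Y} P"
    using standing by (auto simp: standing_assumptions_def elim: payoff_regularity)
  have ch: "isCont h y" if "Y < \<bar>y\<bar>" for y
    unfolding h_exp by (intro continuous_intros Y(2) that)
  obtain Kv where Kv: "\<And>k. 1 \<le> \<bar>grid m k\<bar> \<Longrightarrow> isCont h (grid m k) \<Longrightarrow>
      \<bar>v k\<bar> \<le> 2 powr (- real_of_int m / 2) * (\<bar>h (grid m k)\<bar> + \<epsilon>V / \<bar>grid m k\<bar> + Kv / (grid m k)\<^sup>2)"
    using A_P assumption_A_coeff_bound[of h _ _ _ _ m]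
    unfolding eps_V fourier_damp_payoff h_def[symmetric] v_def coeff_V_def by blast
  obtain Kp where Kp: "\<And>k. 1 < grid m k - \<mu> \<Longrightarrow> \<bar>d k\<bar> \<le> 2 powr (- real_of_int m / 2) *
      (density_bound Cp \<alpha> \<mu> (b - \<alpha>) \<gamma>p \<epsilon>D (grid m k - \<mu>) + Kp / (grid m k - \<mu>)\<^sup>2)"
    using D_right unfolding d_def by blast
  obtain Km where Km: "\<And>k. grid m k - \<mu> < - 1 \<Longrightarrow> \<bar>d k\<bar> \<le> 2 powr (- real_of_int m / 2) *
      (density_bound Cm \<alpha> \<mu> (a + \<alpha>) \<gamma>m \<epsilon>D \<bar>grid m k - \<mu>\<bar> + Km / (grid m k - \<mu>)\<^sup>2)"
    using D_left unfolding d_def by blast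
  \<comment> \<open>One cell width beyond Y puts both cells around a later point into the region of
    monotonicity. The rest makes such a point, and its mirror image, lie at distance more than 1
    from 0 and from \<mu>.\<close>
  define Y0 where "Y0 = Y + \<delta> + \<bar>\<mu>\<bar> + 1"
  have Y0: "Y < Y0" "1 \<le> Y0" "\<bar>\<mu>\<bar> + 1 \<le> Y0" "Y + \<delta> < Y0" using Y(1) \<delta> by (auto simp: Y0_def)
  define cm where "cm = exp (\<bar>\<alpha>\<bar> * \<delta>) / \<delta>"
  define h' where "h' = (\<lambda>y. h (- y))"
  have h'_exp: "h' = (\<lambda>y. exp (- (- \<alpha>) * y) * P (- y))" by (simp add: h'_def h_exp)
  have hi': "integrable lborel h'" unfolding h'_def using integrable_minus_real[of h] h by simp
  have ch': "isCont h' y" if "Y < \<bar>y\<bar>" for y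
  proof -
    have "isCont uminus y" by (intro continuous_intros)
    from isCont_o2[OF this, of h] show ?thesis using ch[of "- y"] that by (simp add: h'_def)
  qed
  interpret R: grid_tail m d v "\<lambda>y. \<bar>h y\<bar>" Cp \<alpha> \<mu> "b - \<alpha>" \<gamma>p \<epsilon>D \<epsilon>V Kp Kv cm Y0
  proof unfold_locales
    show "integrable lborel (\<lambda>y. \<bar>h y\<bar>)" using h by (rule integrable_abs)
    show "\<bar>d k\<bar> \<le> 2 powr (- real_of_int m / 2) *
      (density_bound Cp \<alpha> \<mu> (b - \<alpha>) \<gamma>p \<epsilon>D (grid m k - \<mu>) + Kp / (grid m k - \<mu>)\<^sup>2)" if "Y0 < grid m k" for k
      using that Y0 by (intro Kp) auto
    show "\<bar>v k\<bar> \<le> 2 powr (- real_of_int m / 2) * (\<bar>h (grid m k)\<bar> + \<epsilon>V / grid m k + Kv / (grid m k)\<^sup>2)"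
      if "Y0 < grid m k" for k
      using Kv[of k] ch[of "grid m k"] that Y0 Y(1) by auto
    fix y assume y: "Y0 < y"
    have sub: "{y - \<delta>..y + \<delta>} \<subseteq> {Y<..}" using y Y0 by auto
    have "mono_on {y - \<delta>..y + \<delta>} P \<or> antimono_on {y - \<delta>..y + \<delta>} P"
      using Y(3) monotone_on_subset[OF _ sub] by blast
    from monotone_local_mass[OF this \<delta> h[unfolded h_exp]]
    show "\<bar>h y\<bar> \<le> cm * ((LINT t:{y - 1 / 2 powi m<..y}|lborel. \<bar>h t\<bar>)
        + (LINT t:{y<..y + 1 / 2 powi m}|lborel. \<bar>h t\<bar>))"
      unfolding h_exp cm_def \<delta>_def .
  qed (use C_pos \<kappa> \<epsilon> in auto)
  \<comment> \<open>Reflection changes the signs of \<alpha> and \<mu>, so exp(\<alpha> \<mu>) is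
    preserved; the rate a + \<alpha> is a separate parameter and is passed unchanged.\<close>
  interpret L: grid_tail m "\<lambda>k. d (- k)" "\<lambda>k. v (- k)" "\<lambda>y. \<bar>h' y\<bar>" Cm "- \<alpha>" "- \<mu>" "a + \<alpha>" \<gamma>m \<epsilon>D \<epsilon>V Km Kv cm Y0
  proof unfold_locales
    show "integrable lborel (\<lambda>y. \<bar>h' y\<bar>)" using hi' by (rule integrable_abs)
    show "\<bar>d (- k)\<bar> \<le> 2 powr (- real_of_int m / 2) *
      (density_bound Cm (- \<alpha>) (- \<mu>) (a + \<alpha>) \<gamma>m \<epsilon>D (grid m k - - \<mu>) + Km / (grid m k - - \<mu>)\<^sup>2)" if "Y0 < grid m k" for k
    proof -
      have "\<bar>- grid m k - \<mu>\<bar> = grid m k - - \<mu>" "(- grid m k - \<mu>)\<^sup>2 = (grid m k - - \<mu>)\<^sup>2"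
        using that Y0 by (auto simp: power2_eq_square algebra_simps)
      thus ?thesis using Km[of "- k"] that Y0 by (auto simp: grid_minus density_bound_def add.commute[of \<mu>])
    qed
    show "\<bar>v (- k)\<bar> \<le> 2 powr (- real_of_int m / 2) * (\<bar>h' (grid m k)\<bar> + \<epsilon>V / grid m k + Kv / (grid m k)\<^sup>2)"
      if "Y0 < grid m k" for k
      using Kv[of "- k"] ch[of "- grid m k"] that Y0 Y(1) by (auto simp: grid_minus h'_def)
    fix y assume y: "Y0 < y"
    have neg: "- s \<in> {..<- Y}" if "s \<in> {y - \<delta>..y + \<delta>}" for s using that y Y0 by auto
    have "mono_on {y - \<delta>..y + \<delta>} (\<lambda>t. P (- t)) \<or> antimono_on {y - \<delta>..y + \<delta>} (\<lambda>t. P (- t))"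
      using Y(4)
    proof
      assume mono: "mono_on {..<- Y} P"
      have "antimono_on {y - \<delta>..y + \<delta>} (\<lambda>t. P (- t))"
      proof (rule monotone_onI)
        fix s t assume "s \<in> {y - \<delta>..y + \<delta>}" "t \<in> {y - \<delta>..y + \<delta>}" "s \<le> t"
        thus "P (- t) \<le> P (- s)" using neg by (intro mono_onD[OF mono]) auto
      qed
      thus ?thesis ..
    next
      assume anti: "antimono_on {..<- Y} P"
      have "mono_on {y - \<delta>..y + \<delta>} (\<lambda>t. P (- t))"
      proof (rule monotone_onI)
        fix s t assume "s \<in> {y - \<delta>..y + \<delta>}" "t \<in> {y - \<delta>..y + \<delta>}" "s \<le> t"
        thus "P (- s) \<le> P (- t)" using neg monotone_onD[OF anti, of "- t" "- s"] by auto
      qed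
      thus ?thesis ..
    qed
    from monotone_local_mass[OF this \<delta> hi'[unfolded h'_exp]]
    show "\<bar>h' y\<bar> \<le> cm * ((LINT t:{y - 1 / 2 powi m<..y}|lborel. \<bar>h' t\<bar>)
        + (LINT t:{y<..y + 1 / 2 powi m}|lborel. \<bar>h' t\<bar>))"
      unfolding h'_exp cm_def \<delta>_def by simp
  qed (use C_pos \<kappa> \<epsilon> in auto)
  have abs_summable: "(\<lambda>k. \<bar>d k * v k\<bar>) summable_on UNIV"
    using R.product_summable L.product_summable summable_two_tails[of "\<lambda>k. \<bar>d k * v k\<bar>"] by blast
  have summ: "(\<lambda>k. \<bar>d k * v k\<bar>) summable_on S" for S
    by (rule summable_on_subset_banach[OF abs_summable]) simp
  have meas: "h \<in> borel_measurable lborel" using h by auto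
  \<comment> \<open>Beyond Y the payoff has no jumps, so the functions of the statement coincide
    with G of the two instances there.\<close>
  have adj: "jump_adjusted m P y = P y" if "Y < \<bar>y\<bar>" for y
    using Y(2)[OF that] by (simp add: jump_adjusted_def)
  have cont: "continuous_on {Y0<..} (\<lambda>y. \<bar>h y\<bar>)" "continuous_on {Y0<..} (\<lambda>y. \<bar>h' y\<bar>)"
    using Y0 Y(1) by (auto intro!: continuous_intros continuous_at_imp_continuous_on ch ch')

  have right: "\<exists>K c. \<forall>u>0.
     (\<Sum>\<^sub>\<infinity>k\<in>{u<..}. \<bar>d k * v k\<bar>) \<le> Ep (grid m u) + Ap (grid m u) + K / (grid m u)\<^sup>2 \<and>
     Ep (grid m u) \<le> c * (grid m u powr (\<gamma>p - 1) * exp (- (b - \<alpha>) * grid m u)) \<and>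
     Ap (grid m u) \<le> c / grid m u" if fin: "finite Yp"
  proof -
    define N where "N = (\<lambda>U. Linf_norm_on {U..} h)"
    have "Ep U = R.exp_bound N U" for U
      by (simp add: Ep exp_term_def R.exp_bound_def N_def h_def)
    moreover have "Ap U = R.alg_bound U" for U
      unfolding Ap alg_term_def R.alg_bound_def L1_norm_on_def h_def[symmetric] by (rule refl)
    moreover have "Gp y = R.G y" if "Y0 < y" "\<bar>\<mu>\<bar> < y" for y
      using that Y0 Y(1) adj[of y] unfolding Gp G_fun_def R.G_def by (simp add: h_def damp_payoff_def)
    moreover have "0 \<le> N U \<and> N U \<le> R.B" if "Y0 < U" for U
      unfolding N_def using that
      by (intro conjI Linf_norm_bounds[OF meas]) (auto intro!: R.p_le simp: emeasure_lborel_half_line)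
    ultimately show ?thesis
      using R.one_sided_bounds[OF fin[unfolded Yp] _ cont(1), of N] by presburger
  qed
  have left: "\<exists>K c. \<forall>u>0.
     (\<Sum>\<^sub>\<infinity>k\<in>{u<..}. \<bar>d (- k) * v (- k)\<bar>) \<le> Em (- grid m u) + Am (- grid m u) + K / (grid m u)\<^sup>2 \<and>
     Em (- grid m u) \<le> c * (grid m u powr (\<gamma>m - 1) * exp (- (a + \<alpha>) * grid m u)) \<and>
     Am (- grid m u) \<le> c / grid m u" if fin: "finite Ym"
  proof -
    define N where "N = (\<lambda>U. Linf_norm_on {..- U} h)"
    have refl_abs: "\<bar>- U - \<mu>\<bar> = \<bar>U - - \<mu>\<bar>" for U by (simp add: abs_minus_commute)
    have "Em (- U) = L.exp_bound N U" for U
      unfolding Em exp_term_def L.exp_bound_def N_def h_def refl_abs by simp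
    moreover have "Am (- U) = L.alg_bound U" for U
    proof -
      have "(LINT t:{..- U}|lborel. \<bar>h t\<bar>) = (LINT t:{U..}|lborel. \<bar>h' t\<bar>)"
        unfolding set_lebesgue_integral_def
        by (subst integral_minus_real[symmetric]) (auto simp: h'_def indicator_def intro!: Bochner_Integration.integral_cong)
      thus ?thesis unfolding Am alg_term_def L.alg_bound_def L1_norm_on_def refl_abs h_def[symmetric] by simp
    qed
    moreover have "(\<lambda>y. Gm (- y)) y = L.G y" if "Y0 < y" "\<bar>- \<mu>\<bar> < y" for y
    proof -
      have "\<bar>- y - \<mu>\<bar> = y - - \<mu>" using that by auto
      thus ?thesis using that Y0 Y(1) adj[of "- y"]
        unfolding Gm G_fun_def L.G_def by (simp add: h'_def h_def damp_payoff_def density_bound_def add.commute)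
    qed
    moreover have "0 \<le> N U \<and> N U \<le> L.B" if "Y0 < U" for U
    proof -
      have "\<bar>h y\<bar> \<le> L.B" if "y \<in> {..- U}" for y
        using L.p_le[of "- y"] that \<open>Y0 < U\<close> by (auto simp: h'_def)
      thus ?thesis unfolding N_def by (intro conjI Linf_norm_bounds[OF meas]) (auto simp: emeasure_lborel_half_line)
    qed
    moreover have "finite (local_maxima (\<lambda>y. Gm (- y)) ({0<..} \<inter> {1 + - \<mu><..}))"
    proof -
      have "{0<..} \<inter> {1 + - \<mu><..} = uminus ` ({..<0} \<inter> {..<\<mu> - 1})"
      proof (intro set_eqI iffI)
        fix x assume "x \<in> {0<..} \<inter> {1 + - \<mu><..}"
        hence "- x \<in> {..<0} \<inter> {..<\<mu> - 1}" by auto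
        thus "x \<in> uminus ` ({..<0} \<inter> {..<\<mu> - 1})" by (metis image_eqI minus_minus)
      qed auto
      thus ?thesis using fin by (simp add: local_maxima_minus Ym)
    qed
    ultimately show ?thesis
      using L.one_sided_bounds[of "\<lambda>y. Gm (- y)" N, OF _ _ cont(2)] by presburger
  qed

  \<comment> \<open>The element 0 of the threshold set forces u > 0, the range on which
    \<open>right\<close> holds.\<close>
  have upos: "0 < u" if "finite Yp" "Max ({0, \<mu> + 1, \<mu> + (\<gamma>p - 1) / (b - \<alpha>)} \<union> Yp) < grid m u" for u
  proof -
    have "0 \<le> Max ({0, \<mu> + 1, \<mu> + (\<gamma>p - 1) / (b - \<alpha>)} \<union> Yp)" using that(1) by (intro Max_ge) auto
    hence "0 < grid m u" using that(2) by linarith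
    thus ?thesis by simp
  qed
  have lneg: "0 < - l" if "finite Ym" "grid m l < Min ({0, \<mu> - 1, \<mu> - (\<gamma>m - 1) / (a + \<alpha>)} \<union> Ym)" for l
  proof -
    have "Min ({0, \<mu> - 1, \<mu> - (\<gamma>m - 1) / (a + \<alpha>)} \<union> Ym) \<le> 0" using that(1) by (intro Min_le) auto
    hence "0 < grid m (- l)" using that(2) by (simp add: grid_minus)
    thus ?thesis by simp
  qed
  have neg_grid: "grid m l = - grid m (- l)" for l by (simp add: grid_minus)
  have tp: "tail_plus m \<alpha> f P u \<le> ennreal x" if "(\<Sum>\<^sub>\<infinity>k\<in>{u<..}. \<bar>d k * v k\<bar>) \<le> x" for u x
    unfolding tail_plus_def d_def[symmetric] v_def[symmetric]
    by (rule infsum_ennreal_le[OF summ _ that]) simp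
  have tm: "tail_minus m \<alpha> f P l \<le> ennreal x" if "(\<Sum>\<^sub>\<infinity>k\<in>{..<l}. \<bar>d k * v k\<bar>) \<le> x" for l x
    unfolding tail_minus_def d_def[symmetric] v_def[symmetric]
    by (rule infsum_ennreal_le[OF summ _ that]) simp
  have P1: "finite Yp \<longrightarrow>
        (\<exists>K c. \<forall>u. let U = grid m u in
           Max ({0, \<mu> + 1, \<mu> + (\<gamma>p - 1) / (b - \<alpha>)} \<union> Yp) < U \<longrightarrow>
             tail_plus m \<alpha> f P u \<le> ennreal (Ep U + Ap U + K / U\<^sup>2) \<and>
             Ep U \<le> c * (U powr (\<gamma>p - 1) * exp (- (b - \<alpha>) * U)) \<and>
             Ap U \<le> c / U)"
  proof
    assume fin: "finite Yp"
    from right[OF this] obtain K c where Kc: "\<And>u. 0 < u \<Longrightarrow>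
       (\<Sum>\<^sub>\<infinity>k\<in>{u<..}. \<bar>d k * v k\<bar>) \<le> Ep (grid m u) + Ap (grid m u) + K / (grid m u)\<^sup>2 \<and>
       Ep (grid m u) \<le> c * (grid m u powr (\<gamma>p - 1) * exp (- (b - \<alpha>) * grid m u)) \<and>
       Ap (grid m u) \<le> c / grid m u" by blast
    show "\<exists>K c. \<forall>u. let U = grid m u in
           Max ({0, \<mu> + 1, \<mu> + (\<gamma>p - 1) / (b - \<alpha>)} \<union> Yp) < U \<longrightarrow>
             tail_plus m \<alpha> f P u \<le> ennreal (Ep U + Ap U + K / U\<^sup>2) \<and>
             Ep U \<le> c * (U powr (\<gamma>p - 1) * exp (- (b - \<alpha>) * U)) \<and>
             Ap U \<le> c / U"
      unfolding Let_def using Kc upos[OF fin] tp by blast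
  qed
  have P2: "finite Ym \<longrightarrow>
        (\<exists>K c. \<forall>l. let L = grid m l in
           L < Min ({0, \<mu> - 1, \<mu> - (\<gamma>m - 1) / (a + \<alpha>)} \<union> Ym) \<longrightarrow>
             tail_minus m \<alpha> f P l \<le> ennreal (Em L + Am L + K / L\<^sup>2) \<and>
             Em L \<le> c * (\<bar>L\<bar> powr (\<gamma>m - 1) * exp (- (a + \<alpha>) * \<bar>L\<bar>)) \<and>
             Am L \<le> c / \<bar>L\<bar>)"
  proof
    assume fin: "finite Ym"
    from left[OF this] obtain K c where Kc: "\<And>u. 0 < u \<Longrightarrow>
     (\<Sum>\<^sub>\<infinity>k\<in>{u<..}. \<bar>d (- k) * v (- k)\<bar>) \<le> Em (- grid m u) + Am (- grid m u) + K / (grid m u)\<^sup>2 \<and>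
     Em (- grid m u) \<le> c * (grid m u powr (\<gamma>m - 1) * exp (- (a + \<alpha>) * grid m u)) \<and>
     Am (- grid m u) \<le> c / grid m u" by blast
    show "\<exists>K c. \<forall>l. let L = grid m l in
           L < Min ({0, \<mu> - 1, \<mu> - (\<gamma>m - 1) / (a + \<alpha>)} \<union> Ym) \<longrightarrow>
             tail_minus m \<alpha> f P l \<le> ennreal (Em L + Am L + K / L\<^sup>2) \<and>
             Em L \<le> c * (\<bar>L\<bar> powr (\<gamma>m - 1) * exp (- (a + \<alpha>) * \<bar>L\<bar>)) \<and>
             Am L \<le> c / \<bar>L\<bar>"
      unfolding Let_def
    proof (rule exI[of _ K], rule exI[of _ c], intro allI impI)
      fix l assume l: "grid m l < Min ({0, \<mu> - 1, \<mu> - (\<gamma>m - 1) / (a + \<alpha>)} \<union> Ym)"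
      note B = Kc[OF lneg[OF fin l]]
      have "\<bar>grid m l\<bar> = grid m (- l)" using lneg[OF fin l] grid_pos_iff[of m "- l"] neg_grid[of l] by linarith
      with B show "tail_minus m \<alpha> f P l \<le> ennreal (Em (grid m l) + Am (grid m l) + K / (grid m l)\<^sup>2) \<and>
             Em (grid m l) \<le> c * (\<bar>grid m l\<bar> powr (\<gamma>m - 1) * exp (- (a + \<alpha>) * \<bar>grid m l\<bar>)) \<and>
             Am (grid m l) \<le> c / \<bar>grid m l\<bar>"
        by (intro conjI tm) (simp_all add: infsum_lessThan_minus grid_minus)
    qed
  qed
  have P3: "(\<lambda>k. coeff_D m \<alpha> f k * coeff_V m \<alpha> P k) summable_on UNIV"
    unfolding d_def[symmetric] v_def[symmetric]
    by (rule Infinite_Sum.abs_summable_summable) (simp add: abs_summable)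
  have P4: "finite Yp \<and> finite Ym \<longrightarrow>
        (\<exists>K. \<forall>l u. let L = grid m l; U = grid m u in
           Max ({0, \<mu> + 1, \<mu> + (\<gamma>p - 1) / (b - \<alpha>)} \<union> Yp) < U \<and>
           L < Min ({0, \<mu> - 1, \<mu> - (\<gamma>m - 1) / (a + \<alpha>)} \<union> Ym) \<longrightarrow>
             truncation_error m \<alpha> f P l u
               \<le> Em L + Am L + K / L\<^sup>2 + (Ep U + Ap U + K / U\<^sup>2))"
  proof (intro impI, elim conjE)
    assume fin: "finite Yp" "finite Ym"
    from right[OF fin(1)] obtain K1 where K1: "\<And>u. 0 < u \<Longrightarrow>
       (\<Sum>\<^sub>\<infinity>k\<in>{u<..}. \<bar>d k * v k\<bar>) \<le> Ep (grid m u) + Ap (grid m u) + K1 / (grid m u)\<^sup>2" by blast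
    from left[OF fin(2)] obtain K2 where K2: "\<And>u. 0 < u \<Longrightarrow>
     (\<Sum>\<^sub>\<infinity>k\<in>{u<..}. \<bar>d (- k) * v (- k)\<bar>) \<le> Em (- grid m u) + Am (- grid m u) + K2 / (grid m u)\<^sup>2" by blast
    define K where "K = max K1 K2"
    show "\<exists>K. \<forall>l u. let L = grid m l; U = grid m u in
           Max ({0, \<mu> + 1, \<mu> + (\<gamma>p - 1) / (b - \<alpha>)} \<union> Yp) < U \<and>
           L < Min ({0, \<mu> - 1, \<mu> - (\<gamma>m - 1) / (a + \<alpha>)} \<union> Ym) \<longrightarrow>
             truncation_error m \<alpha> f P l u
               \<le> Em L + Am L + K / L\<^sup>2 + (Ep U + Ap U + K / U\<^sup>2)"
      unfolding Let_def
    proof (rule exI[of _ K], intro allI impI, elim conjE)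
      fix l u assume u: "Max ({0, \<mu> + 1, \<mu> + (\<gamma>p - 1) / (b - \<alpha>)} \<union> Yp) < grid m u"
        and l: "grid m l < Min ({0, \<mu> - 1, \<mu> - (\<gamma>m - 1) / (a + \<alpha>)} \<union> Ym)"
      \<comment> \<open>Since l < 0 < u, the retained range of indices separates two disjoint
        tails.\<close>
      have pos: "0 < u" "0 < - l" using upos[OF fin(1) u] lneg[OF fin(2) l] by auto
      have "truncation_error m \<alpha> f P l u \<le> (\<Sum>\<^sub>\<infinity>k\<in>{..<l}. \<bar>d k * v k\<bar>) + (\<Sum>\<^sub>\<infinity>k\<in>{u<..}. \<bar>d k * v k\<bar>)"
        unfolding truncation_error_def d_def[symmetric] v_def[symmetric]
        by (rule truncation_error_le[OF abs_summable]) (use pos in auto)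
      moreover have "(\<Sum>\<^sub>\<infinity>k\<in>{..<l}. \<bar>d k * v k\<bar>) \<le> Em (grid m l) + Am (grid m l) + K2 / (grid m l)\<^sup>2"
        using K2[OF pos(2)] by (simp add: infsum_lessThan_minus grid_minus)
      moreover have "K2 / (grid m l)\<^sup>2 \<le> K / (grid m l)\<^sup>2" "K1 / (grid m u)\<^sup>2 \<le> K / (grid m u)\<^sup>2"
        by (intro divide_right_mono; simp add: K_def)+
      ultimately show "truncation_error m \<alpha> f P l u \<le> Em (grid m l) + Am (grid m l) + K / (grid m l)\<^sup>2
           + (Ep (grid m u) + Ap (grid m u) + K / (grid m u)\<^sup>2)"
        using K1[OF pos(1)] by linarith
    qed
  qed
  show ?thesis using P1 P2 P3 P4 by blast
qed

end
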